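(* (1) For a C*-algebra $A$ with character density $\chi(A)\le\aleph_1$, $A$ is AF if and only if $A$ is LF. (2) For every cardinal $\kappa>\aleph_1$ there exists an LF algebra with character density $\kappa$ which is not AF.
   Context: For a C*-algebra $A$, $\varepsilon>0$ and subsets $\mathcal F,\mathcal G\subseteq A$, write $\mathcal F\subseteq_\varepsilon\mathcal G$ if every $x\in\mathcal F$ is within norm distance $<\varepsilon$ of some element of $\mathcal G$. A C*-algebra $A$ is AF (approximately finite-dimensional) if it has a directed family of finite-dimensional C*-subalgebras with dense union; it is LF (locally finite-dimensional) if for every finite $\mathcal F\subseteq A$ and every $\varepsilon>0$ there is a finite-dimensional C*-subalgebra $D\subseteq A$ with $\mathcal F\subseteq_\varepsilon D$. The character density $\chi(A)$ is the smallest cardinality of a dense subset of $A$; $\aleph_1$ is the smallest uncountable cardinal. *)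

theory Defs
  imports Complex_Main
begin

record 'a cstar_struct =
  carrier :: "'a set"
  zer :: 'a
  add :: "'a \<Rightarrow> 'a \<Rightarrow> 'a"
  smul :: "complex \<Rightarrow> 'a \<Rightarrow> 'a"
  mul :: "'a \<Rightarrow> 'a \<Rightarrow> 'a"
  star :: "'a \<Rightarrow> 'a"
  nrm :: "'a \<Rightarrow> real"

definition cdist :: "'a cstar_struct \<Rightarrow> 'a \<Rightarrow> 'a \<Rightarrow> real" where
  "cdist A x y = nrm A (add A x (smul A (-1) y))"

definition cstar_algebra :: "'a cstar_struct \<Rightarrow> bool" where
  "cstar_algebra A \<longleftrightarrow>
     zer A \<in> carrier A \<and>
     (\<forall>x\<in>carrier A. \<forall>y\<in>carrier A. add A x y \<in> carrier A \<and> mul A x y \<in> carrier A) \<and>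
     (\<forall>c. \<forall>x\<in>carrier A. smul A c x \<in> carrier A) \<and>
     (\<forall>x\<in>carrier A. star A x \<in> carrier A) \<and>
     \<comment> \<open>complex vector space\<close>
     (\<forall>x\<in>carrier A. \<forall>y\<in>carrier A. \<forall>z\<in>carrier A. add A (add A x y) z = add A x (add A y z)) \<and>
     (\<forall>x\<in>carrier A. \<forall>y\<in>carrier A. add A x y = add A y x) \<and>
     (\<forall>x\<in>carrier A. add A (zer A) x = x) \<and>
     (\<forall>x\<in>carrier A. add A x (smul A (-1) x) = zer A) \<and>
     (\<forall>x\<in>carrier A. smul A 1 x = x) \<and>
     (\<forall>a b. \<forall>x\<in>carrier A. smul A a (smul A b x) = smul A (a * b) x) \<and>
     (\<forall>a b. \<forall>x\<in>carrier A. smul A (a + b) x = add A (smul A a x) (smul A b x)) \<and>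
     (\<forall>a. \<forall>x\<in>carrier A. \<forall>y\<in>carrier A. smul A a (add A x y) = add A (smul A a x) (smul A a y)) \<and>
     \<comment> \<open>associative algebra\<close>
     (\<forall>x\<in>carrier A. \<forall>y\<in>carrier A. \<forall>z\<in>carrier A. mul A (mul A x y) z = mul A x (mul A y z)) \<and>
     (\<forall>x\<in>carrier A. \<forall>y\<in>carrier A. \<forall>z\<in>carrier A. mul A (add A x y) z = add A (mul A x z) (mul A y z)) \<and>
     (\<forall>x\<in>carrier A. \<forall>y\<in>carrier A. \<forall>z\<in>carrier A. mul A x (add A y z) = add A (mul A x y) (mul A x z)) \<and>
     (\<forall>a. \<forall>x\<in>carrier A. \<forall>y\<in>carrier A. mul A (smul A a x) y = smul A a (mul A x y)) \<and>
     (\<forall>a. \<forall>x\<in>carrier A. \<forall>y\<in>carrier A. mul A x (smul A a y) = smul A a (mul A x y)) \<and>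
     \<comment> \<open>involution\<close>
     (\<forall>x\<in>carrier A. star A (star A x) = x) \<and>
     (\<forall>x\<in>carrier A. \<forall>y\<in>carrier A. star A (add A x y) = add A (star A x) (star A y)) \<and>
     (\<forall>a. \<forall>x\<in>carrier A. star A (smul A a x) = smul A (cnj a) (star A x)) \<and>
     (\<forall>x\<in>carrier A. \<forall>y\<in>carrier A. star A (mul A x y) = mul A (star A y) (star A x)) \<and>
     \<comment> \<open>norm, submultiplicativity, C*-identity\<close>
     (\<forall>x\<in>carrier A. nrm A x = 0 \<longleftrightarrow> x = zer A) \<and>
     (\<forall>x\<in>carrier A. \<forall>y\<in>carrier A. nrm A (add A x y) \<le> nrm A x + nrm A y) \<and>
     (\<forall>a. \<forall>x\<in>carrier A. nrm A (smul A a x) = cmod a * nrm A x) \<and>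
     (\<forall>x\<in>carrier A. \<forall>y\<in>carrier A. nrm A (mul A x y) \<le> nrm A x * nrm A y) \<and>
     (\<forall>x\<in>carrier A. nrm A (mul A (star A x) x) = (nrm A x)\<^sup>2) \<and>
     \<comment> \<open>completeness\<close>
     (\<forall>f :: nat \<Rightarrow> 'a. (\<forall>n. f n \<in> carrier A) \<longrightarrow>
          (\<forall>e>0. \<exists>N. \<forall>m\<ge>N. \<forall>n\<ge>N. cdist A (f m) (f n) < e) \<longrightarrow>
          (\<exists>x\<in>carrier A. \<forall>e>0. \<exists>N. \<forall>n\<ge>N. cdist A (f n) x < e))"

inductive_set lin_span :: "'a cstar_struct \<Rightarrow> 'a set \<Rightarrow> 'a set" for A B where
  span_zero: "zer A \<in> lin_span A B"
| span_base: "x \<in> B \<Longrightarrow> x \<in> lin_span A B"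
| span_add: "x \<in> lin_span A B \<Longrightarrow> y \<in> lin_span A B \<Longrightarrow> add A x y \<in> lin_span A B"
| span_smul: "x \<in> lin_span A B \<Longrightarrow> smul A c x \<in> lin_span A B"

text \<open>Finite-dimensional C*-subalgebra (finite-dimensional *-subalgebras are automatically closed).\<close>

definition fd_subalgebra :: "'a cstar_struct \<Rightarrow> 'a set \<Rightarrow> bool" where
  "fd_subalgebra A D \<longleftrightarrow>
     D \<subseteq> carrier A \<and> zer A \<in> D \<and>
     (\<forall>x\<in>D. \<forall>y\<in>D. add A x y \<in> D \<and> mul A x y \<in> D) \<and>
     (\<forall>c. \<forall>x\<in>D. smul A c x \<in> D) \<and>
     (\<forall>x\<in>D. star A x \<in> D) \<and>
     (\<exists>B. finite B \<and> B \<subseteq> D \<and> D \<subseteq> lin_span A B)"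

definition approx_subset :: "'a cstar_struct \<Rightarrow> real \<Rightarrow> 'a set \<Rightarrow> 'a set \<Rightarrow> bool" where
  "approx_subset A e F G \<longleftrightarrow> (\<forall>x\<in>F. \<exists>y\<in>G. cdist A x y < e)"

definition dense_in :: "'a cstar_struct \<Rightarrow> 'a set \<Rightarrow> bool" where
  "dense_in A S \<longleftrightarrow> S \<subseteq> carrier A \<and> (\<forall>x\<in>carrier A. \<forall>e>0. \<exists>y\<in>S. cdist A x y < e)"

definition is_AF :: "'a cstar_struct \<Rightarrow> bool" where
  "is_AF A \<longleftrightarrow> (\<exists>\<D>. \<D> \<noteq> {} \<and> (\<forall>D\<in>\<D>. fd_subalgebra A D) \<and>
      (\<forall>D1\<in>\<D>. \<forall>D2\<in>\<D>. \<exists>D3\<in>\<D>. D1 \<union> D2 \<subseteq> D3) \<and>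
      dense_in A (\<Union>\<D>))"

definition is_LF :: "'a cstar_struct \<Rightarrow> bool" where
  "is_LF A \<longleftrightarrow> (\<forall>F e. finite F \<and> F \<subseteq> carrier A \<and> e > 0 \<longrightarrow>
      (\<exists>D. fd_subalgebra A D \<and> approx_subset A e F D))"

definition density_le :: "'a cstar_struct \<Rightarrow> 'b rel \<Rightarrow> bool" where
  "density_le A r \<longleftrightarrow> (\<exists>S. dense_in A S \<and> (card_of S, r) \<in> ordLeq)"

definition density_eq :: "'a cstar_struct \<Rightarrow> 'b rel \<Rightarrow> bool" where
  "density_eq A r \<longleftrightarrow> (\<exists>S. dense_in A S \<and> (card_of S, r) \<in> ordIso) \<and>
                      (\<forall>S. dense_in A S \<longrightarrow> (r, card_of S) \<in> ordLeq)"

abbreviation aleph1 :: "nat set rel" where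
  "aleph1 \<equiv> cardSuc natLeq"

end

theory Submission
  imports Defs "HOL-Analysis.Analysis" "HOL-Computational_Algebra.Fundamental_Theorem_Algebra"
    "HOL-Library.Function_Algebras"
begin

text \<open>
  For a finite-dimensional algebra \<open>D\<close> let \<open>\<tau>\<close> be the trace of the left regular representation. It
  is a faithful positive trace, and if \<open>S\<close> is an orthonormal basis for \<open>\<tau>(y\<^sup>* x)\<close>, then the
  Casimir element \<open>\<Sum>\<^sub>p p \<otimes> p\<^sup>*\<close> commutes with \<open>D\<close>. It plays the role of matrix units: averaging
  against it turns a linear map of \<open>D\<close> into \<open>F\<close> close to the inclusion into a unitary that
  conjugates \<open>D\<close> quadratically closer to \<open>F\<close>, so a Newton iteration conjugates \<open>D\<close> into \<open>F\<close> by a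
  unitary close to \<open>1\<close> that commutes with any given \<open>D\<^sub>0 \<subseteq> D \<inter> F\<close>. Hence every increasing sequence
  of finite-dimensional subalgebras is dominated by one whose union is dense in a prescribed
  larger separable subalgebra, and a recursion of length \<open>\<omega>\<^sub>1\<close> with countable directed families
  yields a directed family with dense union.

  For \<open>\<kappa>\<close> above aleph 1, take projections \<open>p\<^sub>\<xi>\<close> for \<open>\<xi> < \<kappa>\<close> whose pairwise products are in \<open>c\<^sub>0\<close>
  such that any two of them generate an infinite-dimensional algebra. Finitely many of them can be
  perturbed to generate something finite-dimensional, which gives LF. If the algebra were AF,
  every \<open>p\<^sub>\<xi>\<close> would be perturbed once and for all, and each perturbation only involves countably
  many \<open>\<eta>\<close>; since \<open>\<kappa>\<close> is at least aleph 2, two of them do not see each other, a contradiction.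
\<close>

section \<open>Finite-dimensional star-subalgebras\<close>

context vector_space
begin

lemma span_poly_relation:
  fixes f :: "nat \<Rightarrow> 'b"
  assumes B: "finite B" "\<And>k. f k \<in> span B"
  obtains p where "p \<noteq> 0" "(\<Sum>k\<le>degree p. coeff p k *s f k) = 0"
proof -
  define n where "n = card B"
  obtain u k where u: "(\<Sum>k\<le>n. u k *s f k) = 0" and k: "k \<le> n" "u k \<noteq> 0"
  proof (cases "inj_on f {..n}")
    case True
    then have "card (f ` {..n}) = Suc n" by (simp add: card_image)
    then have "dependent (f ` {..n})"
      using independent_span_bound[OF B(1), of "f ` {..n}"] B(2) by (auto simp: n_def)
    then obtain u where "(\<Sum>v\<in>f ` {..n}. u v *s v) = 0" "\<exists>v\<in>f ` {..n}. u v \<noteq> 0"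
      unfolding dependent_finite[OF finite_imageI[OF finite_atMost]] by blast
    then show thesis
      using that[of "u \<circ> f"] by (auto simp: sum.reindex[OF True])
  next
    case False
    then obtain i j where ij: "i \<le> n" "j \<le> n" "i \<noteq> j" "f i = f j"
      by (auto simp: inj_on_def)
    have "(\<Sum>k\<le>n. (of_bool (k = i) - of_bool (k = j)) *s f k) = f i - f j"
      using ij
      by (simp add: scale_left_diff_distrib sum_subtractf of_bool_def if_distrib[of "\<lambda>c. scale c _"]
          cong: if_cong)
    with ij show thesis
      by (intro that[of "\<lambda>k. of_bool (k = i) - of_bool (k = j)" i]) auto
  qed
  define p where "p = (\<Sum>k\<le>n. monom (u k) k)"
  have coeff: "coeff p i = (if i \<le> n then u i else 0)" for i
    by (simp add: p_def coeff_sum)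
  have "degree p \<le> n"
    by (rule degree_le) (simp add: coeff)
  then have "(\<Sum>k\<le>degree p. coeff p k *s f k) = (\<Sum>k\<le>n. coeff p k *s f k)"
    by (intro sum.mono_neutral_left) (auto simp: coeff_eq_0)
  also have "\<dots> = 0" using u by (simp add: coeff)
  finally have "(\<Sum>k\<le>degree p. coeff p k *s f k) = 0" .
  moreover have "p \<noteq> 0" using k coeff[of k] by auto
  ultimately show thesis by (rule that[rotated])
qed

end

class star_banach = real_normed_algebra_1 + banach +
  fixes scaleC :: "complex \<Rightarrow> 'a \<Rightarrow> 'a"  (infixr "*\<^sub>C" 75)
    and adj :: "'a \<Rightarrow> 'a"
  assumes scaleC_add_right: "c *\<^sub>C (x + y) = c *\<^sub>C x + c *\<^sub>C y"
    and scaleC_add_left: "(c + d) *\<^sub>C x = c *\<^sub>C x + d *\<^sub>C x"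
    and scaleC_scaleC: "c *\<^sub>C (d *\<^sub>C x) = (c * d) *\<^sub>C x"
    and scaleC_of_real: "of_real r *\<^sub>C x = r *\<^sub>R x"
    and mult_scaleC_left: "(c *\<^sub>C x) * y = c *\<^sub>C (x * y)"
    and mult_scaleC_right: "x * (c *\<^sub>C y) = c *\<^sub>C (x * y)"
    and norm_scaleC: "norm (c *\<^sub>C x) = cmod c * norm x"
    and adj_adj: "adj (adj x) = x"
    and adj_add: "adj (x + y) = adj x + adj y"
    and adj_mult: "adj (x * y) = adj y * adj x"
    and adj_scaleC: "adj (c *\<^sub>C x) = cnj c *\<^sub>C adj x"
    and norm_adj: "norm (adj x) = norm x"
    and adj_mult_self_eq_0: "adj x * x = 0 \<Longrightarrow> x = 0"

lemma scaleC_one: "1 *\<^sub>C x = (x :: 'a :: star_banach)"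
  using scaleC_of_real[of 1 x] by simp

global_interpretation cvs: vector_space "scaleC :: complex \<Rightarrow> 'a \<Rightarrow> 'a :: star_banach"
  by unfold_locales (auto simp: scaleC_add_right scaleC_add_left scaleC_scaleC scaleC_one)

lemmas star_simps = adj_adj adj_add adj_mult adj_scaleC mult_scaleC_left mult_scaleC_right

lemma adj_zero [simp]: "adj (0 :: 'a :: star_banach) = 0"
  using norm_adj[of "0 :: 'a"] by simp

lemma adj_one [simp]: "adj (1 :: 'a :: star_banach) = 1"
  by (metis adj_adj adj_mult mult.right_neutral mult.left_neutral)

lemma adj_minus: "adj (- x :: 'a :: star_banach) = - adj x"
  by (metis adj_add adj_zero add.right_inverse add_eq_0_iff)

lemma adj_diff: "adj (x - y :: 'a :: star_banach) = adj x - adj y"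
  using adj_add[of x "- y"] by (simp add: adj_minus)

lemma adj_scaleR: "adj (r *\<^sub>R x :: 'a :: star_banach) = r *\<^sub>R adj x"
  by (simp add: scaleC_of_real[symmetric] adj_scaleC)

lemma bounded_linear_adj: "bounded_linear (adj :: 'a \<Rightarrow> 'a :: star_banach)"
  by (rule bounded_linear_intro[where K=1]) (auto simp: adj_add adj_scaleR norm_adj)

lemma adj_sum: "adj (\<Sum>i\<in>I. f i :: 'a :: star_banach) = (\<Sum>i\<in>I. adj (f i))"
  by (induction I rule: infinite_finite_induct) (auto simp: adj_add)

lemma bounded_linear_scaleC_left: "bounded_linear (\<lambda>c. c *\<^sub>C (x :: 'a :: star_banach))"
proof (rule bounded_linear_intro[where K="norm x"])
  show "(r *\<^sub>R c) *\<^sub>C x = r *\<^sub>R (c *\<^sub>C x)" for r c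
    by (metis scaleC_of_real scaleC_scaleC scaleR_conv_of_real)
qed (auto simp: scaleC_add_left norm_scaleC)

definition re_part :: "'a :: star_banach \<Rightarrow> 'a" where
  "re_part x = (1/2) *\<^sub>C (x + adj x)"

definition im_part :: "'a :: star_banach \<Rightarrow> 'a" where
  "im_part x = (- \<i>/2) *\<^sub>C (x - adj x)"

lemma adj_re_part: "adj (re_part x) = re_part x"
  and adj_im_part: "adj (im_part x) = im_part x"
  by (simp_all add: re_part_def im_part_def star_simps adj_diff add.commute
      cvs.scale_right_diff_distrib)

lemma re_im_decomposition: "x = re_part x + \<i> *\<^sub>C im_part x"
  and adj_re_im_decomposition: "adj x = re_part x - \<i> *\<^sub>C im_part x"
proof -
  have "(1/2) *\<^sub>C y + (1/2) *\<^sub>C y = y" for y :: 'a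
    by (simp flip: scaleC_add_left add: scaleC_one)
  from this[of x] this[of "adj x"]
  show "x = re_part x + \<i> *\<^sub>C im_part x" "adj x = re_part x - \<i> *\<^sub>C im_part x"
    by (simp_all add: re_part_def im_part_def scaleC_scaleC scaleC_add_right
        cvs.scale_right_diff_distrib)
qed

lemma norm_re_part_le: "norm (re_part x) \<le> norm x"
  and norm_im_part_le: "norm (im_part x) \<le> norm x"
  using norm_triangle_ineq[of x "adj x"] norm_triangle_ineq4[of x "adj x"]
  by (simp_all add: re_part_def im_part_def norm_scaleC norm_adj norm_divide)

lemma adj_mult_self_plus_mult_adj_self:
  "adj x * x + x * adj x = 2 *\<^sub>C (re_part x * re_part x + im_part x * im_part x)"
proof -
  define a b where "a = re_part x" and "b = im_part x"
  have "adj x * x + x * adj x = (a - \<i> *\<^sub>C b) * (a + \<i> *\<^sub>C b) + (a + \<i> *\<^sub>C b) * (a - \<i> *\<^sub>C b)"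
    unfolding a_def b_def by (metis adj_re_im_decomposition re_im_decomposition)
  also have "\<dots> = (a * a + b * b) + (a * a + b * b)"
    by (simp add: algebra_simps star_simps scaleC_scaleC)
  also have "\<dots> = 2 *\<^sub>C (a * a + b * b)"
    using scaleC_add_left[of 1 1 "a * a + b * b"] by (simp add: scaleC_one)
  finally show ?thesis unfolding a_def b_def .
qed

definition star_subalgebra :: "'a :: star_banach set \<Rightarrow> bool" where
  "star_subalgebra D \<longleftrightarrow> cvs.subspace D \<and> 1 \<in> D \<and> (\<forall>x\<in>D. \<forall>y\<in>D. x * y \<in> D) \<and> (\<forall>x\<in>D. adj x \<in> D)"

definition fd_star_subalgebra :: "'a :: star_banach set \<Rightarrow> bool" where
  "fd_star_subalgebra D \<longleftrightarrow> star_subalgebra D \<and> (\<exists>B. finite B \<and> D = cvs.span B)"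

lemma star_subalgebra_subspace: "star_subalgebra D \<Longrightarrow> cvs.subspace D"
  by (simp add: star_subalgebra_def)

lemma star_subalgebra_closed:
  assumes "star_subalgebra D"
  shows "0 \<in> D" "1 \<in> D" "x \<in> D \<Longrightarrow> y \<in> D \<Longrightarrow> x + y \<in> D" "x \<in> D \<Longrightarrow> y \<in> D \<Longrightarrow> x - y \<in> D"
    "x \<in> D \<Longrightarrow> y \<in> D \<Longrightarrow> x * y \<in> D" "x \<in> D \<Longrightarrow> c *\<^sub>C x \<in> D" "x \<in> D \<Longrightarrow> r *\<^sub>R x \<in> D"
    "x \<in> D \<Longrightarrow> adj x \<in> D" "(\<And>i. i \<in> I \<Longrightarrow> f i \<in> D) \<Longrightarrow> (\<Sum>i\<in>I. f i) \<in> D"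
  using assms
  by (auto simp: star_subalgebra_def scaleC_of_real[symmetric] cvs.subspace_0 cvs.subspace_add
      cvs.subspace_diff cvs.subspace_scale intro: cvs.subspace_sum)

lemma star_subalgebra_re_part: "star_subalgebra D \<Longrightarrow> x \<in> D \<Longrightarrow> re_part x \<in> D"
  and star_subalgebra_im_part: "star_subalgebra D \<Longrightarrow> x \<in> D \<Longrightarrow> im_part x \<in> D"
  unfolding re_part_def im_part_def
  by (simp_all add: star_subalgebra_closed del: cvs.scale_minus_left)

lemma star_subalgebra_of_fd: "fd_star_subalgebra D \<Longrightarrow> star_subalgebra D"
  by (simp add: fd_star_subalgebra_def)

lemma fd_star_subalgebra_basis:
  assumes "fd_star_subalgebra D"
  obtains B where "finite B" "cvs.independent B" "cvs.span B = D"
proof -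
  obtain C where C: "finite C" "D = cvs.span C"
    using assms by (auto simp: fd_star_subalgebra_def)
  obtain B where B: "B \<subseteq> C" "cvs.independent B" "C \<subseteq> cvs.span B"
    using cvs.maximal_independent_subset[of C] by blast
  have "cvs.span B = D"
    using B C cvs.span_mono cvs.span_minimal cvs.subspace_span by (metis subset_antisym)
  with B C show thesis using that finite_subset by blast
qed

subsection \<open>Diagonalization of self-adjoint elements\<close>

lemma selfadjoint_eigenvalue_real:
  fixes r :: "'a :: star_banach"
  assumes "adj r = r" "r * y = c *\<^sub>C y" "y \<noteq> 0"
  shows "c \<in> \<real>"
proof -
  have "adj y * (r * y) = adj (r * y) * y"
    by (simp add: adj_mult assms(1) mult.assoc)
  then have "c *\<^sub>C (adj y * y) = cnj c *\<^sub>C (adj y * y)"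
    by (simp add: assms(2) star_simps)
  then have "c = cnj c"
    using assms(3) adj_mult_self_eq_0[of y] by auto
  then show ?thesis by (simp add: Reals_cnj_iff)
qed

lemma selfadjoint_no_generalized_eigenvector:
  fixes r :: "'a :: star_banach"
  assumes r: "adj r = r" and z: "z = r * y - c *\<^sub>C y" "r * z = c *\<^sub>C z"
  shows "z = 0"
proof (rule ccontr)
  assume "z \<noteq> 0"
  then have "cnj c = c"
    using selfadjoint_eigenvalue_real[OF r z(2)] by (simp add: Reals_cnj_iff)
  then have "adj z * z = adj y * (r * z - c *\<^sub>C z)"
    by (subst (1) z(1)) (simp add: adj_diff star_simps r algebra_simps)
  then show False using \<open>z \<noteq> 0\<close> adj_mult_self_eq_0[of z] z(2) by simp
qed

definition eigenvectors_in :: "'a :: star_banach set \<Rightarrow> 'a \<Rightarrow> 'a set" where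
  "eigenvectors_in D r = {y \<in> D. \<exists>c. r * y = c *\<^sub>C y}"

lemma span_eigenvectors_split:
  fixes r :: "'a :: star_banach"
  assumes "y \<in> cvs.span (eigenvectors_in D r)"
  shows "\<exists>w z. r * w = c *\<^sub>C w \<and> z \<in> cvs.span (eigenvectors_in D r) \<and> y = w + (r * z - c *\<^sub>C z)"
  using assms
proof (induction rule: cvs.span_induct_alt)
  case base
  show ?case by (intro exI[of _ 0]) (simp add: cvs.span_zero)
next
  case (step a x y)
  obtain w z where wz: "r * w = c *\<^sub>C w" "z \<in> cvs.span (eigenvectors_in D r)"
      "y = w + (r * z - c *\<^sub>C z)"
    using step.IH by blast
  obtain d where d: "r * x = d *\<^sub>C x" using step.hyps by (auto simp: eigenvectors_in_def)
  show ?case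
  proof (cases "d = c")
    case True
    have "r * (a *\<^sub>C x + w) = c *\<^sub>C (a *\<^sub>C x + w)"
      using d wz(1) True
      by (simp add: distrib_left mult_scaleC_right scaleC_add_right scaleC_scaleC mult.commute)
    moreover have "a *\<^sub>C x + y = (a *\<^sub>C x + w) + (r * z - c *\<^sub>C z)" using wz(3) by simp
    ultimately show ?thesis using wz(2) by blast
  next
    case False
    define z' where "z' = (a / (d - c)) *\<^sub>C x + z"
    have "a *\<^sub>C x = (a / (d - c) * d) *\<^sub>C x - (a / (d - c) * c) *\<^sub>C x"
      using False by (simp add: divide_simps flip: cvs.scale_left_diff_distrib right_diff_distrib)
    then have "a *\<^sub>C x + y = w + (r * z' - c *\<^sub>C z')"
      by (simp add: wz(3) z'_def d distrib_left mult_scaleC_right scaleC_add_right scaleC_scaleC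
          mult.commute)
    moreover have "z' \<in> cvs.span (eigenvectors_in D r)"
      using wz(2) step.hyps by (auto simp: z'_def intro: cvs.span_add cvs.span_scale cvs.span_base)
    ultimately show ?thesis using wz(1) by blast
  qed
qed

lemma span_eigenvectors_in_subset: "cvs.subspace D \<Longrightarrow> cvs.span (eigenvectors_in D r) \<subseteq> D"
  by (rule cvs.span_minimal) (auto simp: eigenvectors_in_def)

lemma mem_span_eigenvectors_if_shift:
  fixes r :: "'a :: star_banach"
  assumes D: "cvs.subspace D" and r: "adj r = r" and y: "y \<in> D"
    and shift: "r * y - c *\<^sub>C y \<in> cvs.span (eigenvectors_in D r)"
  shows "y \<in> cvs.span (eigenvectors_in D r)"
proof -
  obtain w z where w: "r * w = c *\<^sub>C w" and z: "z \<in> cvs.span (eigenvectors_in D r)"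
      and split: "r * y - c *\<^sub>C y = w + (r * z - c *\<^sub>C z)"
    using span_eigenvectors_split[OF shift] by blast
  have w_eq: "w = r * (y - z) - c *\<^sub>C (y - z)"
    using split by (simp add: right_diff_distrib cvs.scale_right_diff_distrib algebra_simps)
  then have "w = 0" by (rule selfadjoint_no_generalized_eigenvector[OF r _ w])
  then have "r * (y - z) = c *\<^sub>C (y - z)" using w_eq by simp
  moreover have "y - z \<in> D"
    using y z span_eigenvectors_in_subset[OF D] D by (blast intro: cvs.subspace_diff)
  ultimately have "y - z \<in> eigenvectors_in D r" by (auto simp: eigenvectors_in_def)
  then have "(y - z) + z \<in> cvs.span (eigenvectors_in D r)"
    using z by (rule cvs.span_add[OF cvs.span_base])
  then show ?thesis by simp
qed

definition poly_eval :: "complex poly \<Rightarrow> 'a :: star_banach \<Rightarrow> 'a" where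
  "poly_eval p r = (\<Sum>k\<le>degree p. coeff p k *\<^sub>C r ^ k)"

lemma poly_eval_eq: "degree p \<le> n \<Longrightarrow> poly_eval p r = (\<Sum>k\<le>n. coeff p k *\<^sub>C r ^ k)"
  unfolding poly_eval_def by (intro sum.mono_neutral_left) (auto simp: coeff_eq_0)

lemma poly_eval_linear_factor:
  "poly_eval ([:- c, 1:] * q) r = poly_eval q r * r - c *\<^sub>C poly_eval q r"
proof -
  have eq: "[:- c, 1:] * q = pCons 0 q - smult c q" by simp
  have "degree ([:- c, 1:] * q) \<le> Suc (degree q)"
    unfolding eq by (intro degree_diff_le degree_pCons_le order_trans[OF degree_smult_le]) auto
  then have "poly_eval ([:- c, 1:] * q) r = (\<Sum>k\<le>Suc (degree q). coeff ([:- c, 1:] * q) k *\<^sub>C r ^ k)"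
    by (rule poly_eval_eq)
  also have "\<dots> = (\<Sum>k\<le>Suc (degree q). coeff (pCons 0 q) k *\<^sub>C r ^ k)
      - (\<Sum>k\<le>Suc (degree q). c *\<^sub>C coeff q k *\<^sub>C r ^ k)"
    unfolding eq
    by (simp only: coeff_diff coeff_smult cvs.scale_left_diff_distrib sum_subtractf scaleC_scaleC)
  also have "(\<Sum>k\<le>Suc (degree q). coeff (pCons 0 q) k *\<^sub>C r ^ k) = poly_eval q r * r"
    by (simp add: sum.atMost_Suc_shift poly_eval_def sum_distrib_right mult_scaleC_left
        power_commutes del: sum.atMost_Suc)
  also have "(\<Sum>k\<le>Suc (degree q). c *\<^sub>C coeff q k *\<^sub>C r ^ k) = c *\<^sub>C poly_eval q r"
    unfolding poly_eval_eq[OF le_SucI[OF order_refl]] by (simp only: cvs.scale_sum_right)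
  finally show ?thesis .
qed

lemma poly_eval_smult: "poly_eval (smult c q) r = c *\<^sub>C poly_eval q r"
  by (simp add: poly_eval_def cvs.scale_sum_right scaleC_scaleC)

lemma killed_by_split_poly_imp_mem_span_eigenvectors:
  fixes r :: "'a :: star_banach"
  assumes D: "star_subalgebra D" and r: "r \<in> D" "adj r = r"
    and "y \<in> D" "poly_eval (\<Prod>c\<in>#A. [:- c, 1:]) r * y = 0"
  shows "y \<in> cvs.span (eigenvectors_in D r)"
  using assms(4,5)
proof (induction A arbitrary: y)
  case empty
  then show ?case by (simp add: poly_eval_def scaleC_one cvs.span_zero)
next
  case (add c A)
  have "poly_eval (\<Prod>c\<in>#A. [:- c, 1:]) r * (r * y - c *\<^sub>C y) = 0"
    using add.prems(2) unfolding image_mset_add_mset prod_mset.add_mset poly_eval_linear_factor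
    by (simp add: algebra_simps mult_scaleC_left mult_scaleC_right)
  then have "r * y - c *\<^sub>C y \<in> cvs.span (eigenvectors_in D r)"
    using add.prems(1) r D by (intro add.IH star_subalgebra_closed)
  then show ?case
    by (rule mem_span_eigenvectors_if_shift[OF star_subalgebra_subspace[OF D] r(2) add.prems(1)])
qed

lemma selfadjoint_span_eigenvectors:
  fixes D :: "'a :: star_banach set"
  assumes D: "fd_star_subalgebra D" and r: "r \<in> D" "adj r = r"
  shows "cvs.span (eigenvectors_in D r) = D"
proof
  note closed = star_subalgebra_closed[OF star_subalgebra_of_fd[OF D]]
  show "cvs.span (eigenvectors_in D r) \<subseteq> D"
    by (intro span_eigenvectors_in_subset star_subalgebra_subspace star_subalgebra_of_fd D)
  obtain B where B: "finite B" "D = cvs.span B" using D by (auto simp: fd_star_subalgebra_def)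
  have "r ^ k \<in> cvs.span B" for k
    by (induction k) (auto simp: closed r simp flip: B(2))
  then obtain p where p: "p \<noteq> 0" "poly_eval p r = 0"
    using cvs.span_poly_relation[OF B(1), of "\<lambda>k. r ^ k"] unfolding poly_eval_def by blast
  obtain A where A: "p = smult (lead_coeff p) (\<Prod>c\<in>#A. [:- c, 1:])"
    using alg_closed_imp_factorization[OF p(1)] by blast
  have "poly_eval (\<Prod>c\<in>#A. [:- c, 1:]) r = 0"
    using p A by (metis cvs.scale_eq_0_iff leading_coeff_0_iff poly_eval_smult)
  then show "D \<subseteq> cvs.span (eigenvectors_in D r)"
    using killed_by_split_poly_imp_mem_span_eigenvectors[OF star_subalgebra_of_fd[OF D] r, of _ A]
    by auto
qed

lemma selfadjoint_eigenbasis: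
  fixes D :: "'a :: star_banach set"
  assumes D: "fd_star_subalgebra D" and r: "r \<in> D" "adj r = r"
  obtains S \<mu> where "finite S" "cvs.independent S" "cvs.span S = D"
      "\<And>p. p \<in> S \<Longrightarrow> r * p = of_real (\<mu> p) *\<^sub>C p"
proof -
  obtain S where S: "S \<subseteq> eigenvectors_in D r" "cvs.independent S" "eigenvectors_in D r \<subseteq> cvs.span S"
    using cvs.maximal_independent_subset by blast
  have span: "cvs.span S = D"
    using S selfadjoint_span_eigenvectors[OF D r] cvs.span_mono cvs.span_minimal cvs.subspace_span
    by (metis subset_antisym)
  obtain B where "finite B" "D = cvs.span B" using D by (auto simp: fd_star_subalgebra_def)
  then have "finite S" using cvs.independent_span_bound[of B S] S(2) span cvs.span_superset by blast
  moreover have "\<exists>l. r * p = of_real l *\<^sub>C p" if p: "p \<in> S" for p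
  proof -
    obtain c where c: "r * p = c *\<^sub>C p" using p S(1) by (auto simp: eigenvectors_in_def)
    have "p \<noteq> 0" using p S(2) cvs.dependent_zero by blast
    then have "c \<in> \<real>" by (rule selfadjoint_eigenvalue_real[OF r(2) c])
    then show ?thesis using c by (auto elim: Reals_cases)
  qed
  ultimately show thesis using that S(2) span by metis
qed

subsection \<open>The trace of the regular representation\<close>

definition clinear_on :: "'a :: star_banach set \<Rightarrow> (complex \<Rightarrow> 'b \<Rightarrow> 'b) \<Rightarrow> ('a \<Rightarrow> 'b :: ab_group_add)
    \<Rightarrow> bool" where
  "clinear_on D s T \<longleftrightarrow> (\<forall>a\<in>D. \<forall>b\<in>D. T (a + b) = T a + T b) \<and> (\<forall>c. \<forall>a\<in>D. T (c *\<^sub>C a) = s c (T a))"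

lemma clinear_onI:
  assumes "\<And>a b. a \<in> D \<Longrightarrow> b \<in> D \<Longrightarrow> T (a + b) = T a + T b" "\<And>c a. a \<in> D \<Longrightarrow> T (c *\<^sub>C a) = s c (T a)"
  shows "clinear_on D s T"
  using assms by (simp add: clinear_on_def)

lemma clinear_on_add: "clinear_on D s T \<Longrightarrow> a \<in> D \<Longrightarrow> b \<in> D \<Longrightarrow> T (a + b) = T a + T b"
  and clinear_on_scale: "clinear_on D s T \<Longrightarrow> a \<in> D \<Longrightarrow> T (c *\<^sub>C a) = s c (T a)"
  by (simp_all add: clinear_on_def)

lemma clinear_on_diff:
  assumes T: "clinear_on D s T" and D: "cvs.subspace D" and ab: "a \<in> D" "b \<in> D"
  shows "T (a - b) = T a - T b"
  using clinear_on_add[OF T cvs.subspace_diff[OF D ab] ab(2)] by simp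

lemma clinear_on_sum:
  assumes T: "clinear_on D s T" and D: "cvs.subspace D" and g: "\<And>i. i \<in> I \<Longrightarrow> g i \<in> D"
  shows "T (\<Sum>i\<in>I. f i *\<^sub>C g i) = (\<Sum>i\<in>I. s (f i) (T (g i)))"
proof -
  have "T 0 = 0"
    using clinear_on_diff[OF T D cvs.subspace_0[OF D] cvs.subspace_0[OF D]] by simp
  then show ?thesis
    using g
  proof (induction I rule: infinite_finite_induct)
    case (insert i I)
    have "(\<Sum>i\<in>I. f i *\<^sub>C g i) \<in> D"
      using insert.prems by (intro cvs.subspace_sum[OF D] cvs.subspace_scale[OF D]) auto
    then show ?case
      using insert cvs.subspace_scale[OF D]
      by (simp add: clinear_on_add[OF T] clinear_on_scale[OF T])
  qed simp_all
qed

definition frame :: "'a :: star_banach set \<Rightarrow> 'a set \<Rightarrow> ('a \<Rightarrow> 'a \<Rightarrow> complex) \<Rightarrow> bool" where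
  "frame D S \<phi> \<longleftrightarrow> finite S \<and> S \<subseteq> D \<and> (\<forall>p\<in>S. clinear_on D (*) (\<phi> p)) \<and>
      (\<forall>a\<in>D. a = (\<Sum>p\<in>S. \<phi> p a *\<^sub>C p))"

lemma frame_finite: "frame D S \<phi> \<Longrightarrow> finite S"
  and frame_subset: "frame D S \<phi> \<Longrightarrow> p \<in> S \<Longrightarrow> p \<in> D"
  and frame_clinear: "frame D S \<phi> \<Longrightarrow> p \<in> S \<Longrightarrow> clinear_on D (*) (\<phi> p)"
  and frame_expansion: "frame D S \<phi> \<Longrightarrow> a \<in> D \<Longrightarrow> (\<Sum>p\<in>S. \<phi> p a *\<^sub>C p) = a"
  by (auto simp: frame_def)

lemma frame_representation:
  assumes B: "finite B" "cvs.independent B" "cvs.span B = D"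
  shows "frame D B (\<lambda>p a. cvs.representation B a p)"
  unfolding frame_def
proof (intro conjI ballI)
  show "B \<subseteq> D" using B(3) cvs.span_superset by blast
  show "clinear_on D (*) (\<lambda>a. cvs.representation B a p)" for p
    using B by (intro clinear_onI) (simp_all add: cvs.representation_add cvs.representation_scale)
  show "a = (\<Sum>p\<in>B. cvs.representation B a p *\<^sub>C p)" if "a \<in> D" for a
    using cvs.sum_representation_eq[OF B(2) _ B(1) subset_refl] that B(3) by simp
qed (rule B(1))

lemma frame_trace_unique:
  assumes D: "cvs.subspace D" and S: "frame D S \<phi>" and S': "frame D S' \<psi>"
    and T: "clinear_on D scaleC T" "\<And>a. a \<in> D \<Longrightarrow> T a \<in> D"
  shows "(\<Sum>p\<in>S. \<phi> p (T p)) = (\<Sum>q\<in>S'. \<psi> q (T q))"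
proof -
  have "(\<Sum>p\<in>S. \<phi> p (T p)) = (\<Sum>p\<in>S. \<phi> p (\<Sum>q\<in>S'. \<psi> q (T p) *\<^sub>C q))"
    using S T by (intro sum.cong refl) (simp add: frame_expansion[OF S'] frame_subset)
  also have "\<dots> = (\<Sum>p\<in>S. \<Sum>q\<in>S'. \<psi> q (T p) * \<phi> p q)"
    using S S'
    by (intro sum.cong refl clinear_on_sum[OF frame_clinear[OF S] D]) (auto intro: frame_subset)
  also have "\<dots> = (\<Sum>q\<in>S'. \<Sum>p\<in>S. \<phi> p q * \<psi> q (T p))"
    by (subst sum.swap) (simp add: mult.commute)
  also have "\<dots> = (\<Sum>q\<in>S'. \<psi> q (\<Sum>p\<in>S. \<phi> p q *\<^sub>C T p))"
    using S S' T
    by (intro sum.cong refl clinear_on_sum[OF frame_clinear[OF S'] D, symmetric])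
       (auto intro: frame_subset)
  also have "\<dots> = (\<Sum>q\<in>S'. \<psi> q (T (\<Sum>p\<in>S. \<phi> p q *\<^sub>C p)))"
    using S
    by (intro sum.cong refl arg_cong[where f="\<psi> _"] clinear_on_sum[OF T(1) D, symmetric])
       (auto intro: frame_subset)
  also have "\<dots> = (\<Sum>q\<in>S'. \<psi> q (T q))"
    using S' by (intro sum.cong refl) (simp add: frame_expansion[OF S] frame_subset)
  finally show ?thesis .
qed

definition regular_trace :: "'a :: star_banach set \<Rightarrow> 'a \<Rightarrow> complex" where
  "regular_trace D x = (let B = SOME B. finite B \<and> cvs.independent B \<and> cvs.span B = D
     in \<Sum>b\<in>B. cvs.representation B (x * b) b)"

context
  fixes D :: "'a :: star_banach set"
  assumes D: "fd_star_subalgebra D"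
begin

private abbreviation (input) \<tau> :: "'a \<Rightarrow> complex" where "\<tau> \<equiv> regular_trace D"

private lemmas closed = star_subalgebra_closed[OF star_subalgebra_of_fd[OF D]]
private lemmas subspace = star_subalgebra_subspace[OF star_subalgebra_of_fd[OF D]]

lemma regular_trace_frame:
  assumes S: "frame D S \<phi>" and x: "x \<in> D"
  shows "\<tau> x = (\<Sum>p\<in>S. \<phi> p (x * p))"
proof -
  define B where "B = (SOME B. finite B \<and> cvs.independent B \<and> cvs.span B = D)"
  have B: "finite B \<and> cvs.independent B \<and> cvs.span B = D"
    unfolding B_def by (rule someI_ex) (metis fd_star_subalgebra_basis[OF D])
  have "\<tau> x = (\<Sum>b\<in>B. cvs.representation B (x * b) b)"
    by (simp add: regular_trace_def B_def[symmetric])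
  also have "\<dots> = (\<Sum>p\<in>S. \<phi> p (x * p))"
  proof (rule frame_trace_unique[OF subspace _ S])
    show "frame D B (\<lambda>p a. cvs.representation B a p)" using B by (intro frame_representation) auto
    show "clinear_on D scaleC ((*) x)"
      by (rule clinear_onI) (simp_all add: distrib_left mult_scaleC_right)
    show "x * a \<in> D" if "a \<in> D" for a using x that by (rule closed)
  qed
  finally show ?thesis .
qed

lemma regular_trace_clinear: "clinear_on D (*) \<tau>"
proof -
  obtain B where "finite B" "cvs.independent B" "cvs.span B = D"
    by (rule fd_star_subalgebra_basis[OF D])
  note S = frame_representation[OF this]
  show ?thesis
  proof (rule clinear_onI)
    show "\<tau> (x + y) = \<tau> x + \<tau> y" if "x \<in> D" "y \<in> D" for x y
      using that
      by (simp add: regular_trace_frame[OF S] closed frame_subset[OF S] distrib_right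
          clinear_on_add[OF frame_clinear[OF S]] sum.distrib)
    show "\<tau> (c *\<^sub>C x) = c * \<tau> x" if "x \<in> D" for c x
      using that
      by (simp add: regular_trace_frame[OF S] closed frame_subset[OF S] mult_scaleC_left
          clinear_on_scale[OF frame_clinear[OF S]] sum_distrib_left)
  qed
qed

lemma regular_trace_mult_commute:
  assumes x: "x \<in> D" and y: "y \<in> D"
  shows "\<tau> (x * y) = \<tau> (y * x)"
proof -
  obtain B where "finite B" "cvs.independent B" "cvs.span B = D"
    by (rule fd_star_subalgebra_basis[OF D])
  then obtain S \<phi> where S: "frame D S \<phi>" using frame_representation by blast
  have expand: "\<tau> (x * y) = (\<Sum>p\<in>S. \<Sum>q\<in>S. \<phi> q (y * p) * \<phi> p (x * q))" if xy: "x \<in> D" "y \<in> D" for x y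
  proof -
    have "\<tau> (x * y) = (\<Sum>p\<in>S. \<phi> p (x * (y * p)))"
      using xy by (simp add: regular_trace_frame[OF S] closed mult.assoc)
    also have "\<dots> = (\<Sum>p\<in>S. \<phi> p (\<Sum>q\<in>S. \<phi> q (y * p) *\<^sub>C (x * q)))"
    proof (intro sum.cong refl)
      fix p assume "p \<in> S"
      then have "x * (y * p) = x * (\<Sum>q\<in>S. \<phi> q (y * p) *\<^sub>C q)"
        using xy by (simp add: frame_expansion[OF S] frame_subset[OF S] closed)
      then show "\<phi> p (x * (y * p)) = \<phi> p (\<Sum>q\<in>S. \<phi> q (y * p) *\<^sub>C (x * q))"
        by (simp add: sum_distrib_left mult_scaleC_right)
    qed
    also have "\<dots> = (\<Sum>p\<in>S. \<Sum>q\<in>S. \<phi> q (y * p) * \<phi> p (x * q))"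
      using xy frame_subset[OF S]
      by (intro sum.cong refl clinear_on_sum[OF frame_clinear[OF S] subspace]) (auto intro: closed)
    finally show ?thesis .
  qed
  show ?thesis
    unfolding expand[OF x y] expand[OF y x] by (subst sum.swap) (simp add: mult.commute)
qed

lemma regular_trace_selfadjoint:
  assumes r: "r \<in> D" "adj r = r"
  obtains S \<mu> where "cvs.independent S" "cvs.span S = D" "\<And>p. p \<in> S \<Longrightarrow> r * p = of_real (\<mu> p) *\<^sub>C p"
    "finite S" "\<tau> r = of_real (\<Sum>p\<in>S. \<mu> p)" "\<tau> (r * r) = of_real (\<Sum>p\<in>S. (\<mu> p)\<^sup>2)"
proof -
  obtain S \<mu> where S: "finite S" "cvs.independent S" "cvs.span S = D"
      and eigen: "\<And>p. p \<in> S \<Longrightarrow> r * p = of_real (\<mu> p) *\<^sub>C p"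
    using selfadjoint_eigenbasis[OF D r] by metis
  note frame = frame_representation[OF S]
  have coefficient: "cvs.representation S (c *\<^sub>C p) p = c" if "p \<in> S" for p c
    using that clinear_on_scale[OF frame_clinear[OF frame that] frame_subset[OF frame that]]
    by (simp add: cvs.representation_basis[OF S(2)])
  have "\<tau> r = of_real (\<Sum>p\<in>S. \<mu> p)"
    using eigen coefficient by (simp add: regular_trace_frame[OF frame r(1)])
  moreover have "\<tau> (r * r) = of_real (\<Sum>p\<in>S. (\<mu> p)\<^sup>2)"
    using eigen coefficient r(1)
    by (simp add: regular_trace_frame[OF frame] closed mult.assoc mult_scaleC_right scaleC_scaleC
        power2_eq_square flip: of_real_mult)
  ultimately show thesis using that S eigen by blast
qed

lemma regular_trace_re_im:
  assumes x: "x \<in> D"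
  shows "\<tau> x = \<tau> (re_part x) + \<i> * \<tau> (im_part x)"
proof -
  note parts = star_subalgebra_re_part[OF star_subalgebra_of_fd[OF D] x]
    star_subalgebra_im_part[OF star_subalgebra_of_fd[OF D] x]
  show ?thesis
    using parts closed
    by (subst re_im_decomposition)
       (simp add: clinear_on_add[OF regular_trace_clinear]
         clinear_on_scale[OF regular_trace_clinear])
qed

lemma regular_trace_adj:
  assumes x: "x \<in> D"
  shows "\<tau> (adj x) = cnj (\<tau> x)"
proof -
  note parts = star_subalgebra_re_part[OF star_subalgebra_of_fd[OF D] x]
    star_subalgebra_im_part[OF star_subalgebra_of_fd[OF D] x]
  have "\<tau> (re_part x) \<in> \<real>" "\<tau> (im_part x) \<in> \<real>"
    using regular_trace_selfadjoint[OF parts(1) adj_re_part]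
      regular_trace_selfadjoint[OF parts(2) adj_im_part]
    by (metis Reals_of_real)+
  moreover have "\<tau> (adj x) = \<tau> (re_part x) - \<i> * \<tau> (im_part x)"
    using parts closed
    by (subst adj_re_im_decomposition)
       (simp add: clinear_on_diff[OF regular_trace_clinear subspace]
         clinear_on_scale[OF regular_trace_clinear])
  ultimately show ?thesis by (auto simp: regular_trace_re_im[OF x] Reals_cnj_iff)
qed

lemma regular_trace_square:
  assumes r: "r \<in> D" "adj r = r"
  obtains t where "\<tau> (r * r) = of_real t" "0 \<le> t" "t = 0 \<Longrightarrow> r = 0"
proof -
  obtain S \<mu> where S: "cvs.span S = D" "finite S"
      and eigen: "\<And>p. p \<in> S \<Longrightarrow> r * p = of_real (\<mu> p) *\<^sub>C p"
      and trace: "\<tau> (r * r) = of_real (\<Sum>p\<in>S. (\<mu> p)\<^sup>2)"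
    using regular_trace_selfadjoint[OF r] by metis
  have "r = 0" if "(\<Sum>p\<in>S. (\<mu> p)\<^sup>2) = 0"
  proof -
    have "\<forall>p\<in>S. \<mu> p = 0" using that by (subst (asm) sum_nonneg_eq_0_iff) (simp_all add: S)
    then have kill: "r * p = 0" if "p \<in> S" for p using eigen[OF that] that by simp
    have "r * y = 0" if "y \<in> cvs.span S" for y
      using that
    proof (induction rule: cvs.span_induct_alt)
      case (step c p y)
      then show ?case by (simp add: kill distrib_left mult_scaleC_right)
    qed simp
    then show ?thesis using S(1) closed(2) by (metis mult.right_neutral)
  qed
  then show thesis using that[OF trace] by (simp add: sum_nonneg)
qed

lemma regular_trace_adj_mult_self:
  assumes x: "x \<in> D"
  obtains t where "\<tau> (adj x * x) = of_real t" "0 \<le> t" "t = 0 \<Longrightarrow> x = 0"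
proof -
  note parts = star_subalgebra_re_part[OF star_subalgebra_of_fd[OF D] x]
    star_subalgebra_im_part[OF star_subalgebra_of_fd[OF D] x]
  obtain s where s: "\<tau> (re_part x * re_part x) = of_real s" "0 \<le> s" "s = 0 \<Longrightarrow> re_part x = 0"
    using regular_trace_square[OF parts(1) adj_re_part] by blast
  obtain t where t: "\<tau> (im_part x * im_part x) = of_real t" "0 \<le> t" "t = 0 \<Longrightarrow> im_part x = 0"
    using regular_trace_square[OF parts(2) adj_im_part] by blast
  have "2 * \<tau> (adj x * x) = \<tau> (adj x * x + x * adj x)"
    using regular_trace_mult_commute[of x "adj x"] x closed
    by (simp add: clinear_on_add[OF regular_trace_clinear])
  also have "\<dots> = 2 * of_real (s + t)"
    using parts closed
    by (simp add: adj_mult_self_plus_mult_adj_self clinear_on_add[OF regular_trace_clinear]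
        clinear_on_scale[OF regular_trace_clinear] s t)
  finally have "\<tau> (adj x * x) = of_real (s + t)"
    by (rule mult_left_cancel[THEN iffD1, rotated]) simp
  moreover have "x = 0" if "s + t = 0"
  proof -
    have "re_part x = 0" "im_part x = 0" using that s t by auto
    then show ?thesis using re_im_decomposition[of x] by simp
  qed
  ultimately show thesis using that[of "s + t"] s(2) t(2) by simp
qed

lemma regular_trace_adj_mult_self_eq_0:
  assumes "x \<in> D" "\<tau> (adj x * x) = 0"
  shows "x = 0"
  by (rule regular_trace_adj_mult_self[OF assms(1)]) (use assms(2) in simp)

lemma regular_trace_bounded:
  assumes x: "x \<in> D"
  shows "cmod (\<tau> x) \<le> 2 * real (cvs.dim D) * norm x"
proof -
  have selfadjoint: "cmod (\<tau> r) \<le> real (cvs.dim D) * norm r" if r: "r \<in> D" "adj r = r" for r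
  proof -
    obtain S \<mu> where S: "cvs.independent S" "cvs.span S = D" "finite S"
        and eigen: "\<And>p. p \<in> S \<Longrightarrow> r * p = of_real (\<mu> p) *\<^sub>C p" and trace: "\<tau> r = of_real (\<Sum>p\<in>S. \<mu> p)"
      using regular_trace_selfadjoint[OF r] by metis
    have "\<bar>\<mu> p\<bar> \<le> norm r" if p: "p \<in> S" for p
    proof -
      have "p \<noteq> 0" using p S(1) cvs.dependent_zero by blast
      moreover have "\<bar>\<mu> p\<bar> * norm p \<le> norm r * norm p"
        using norm_mult_ineq[of r p] by (simp add: eigen[OF p] norm_scaleC)
      ultimately show ?thesis by simp
    qed
    then have "\<bar>\<Sum>p\<in>S. \<mu> p\<bar> \<le> real (card S) * norm r"
      using sum_norm_le[of S \<mu> "\<lambda>_. norm r"] by simp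
    also have "card S = cvs.dim D" using cvs.dim_span_eq_card_independent[OF S(1)] S(2) by simp
    finally show ?thesis by (simp add: trace del: of_real_sum)
  qed
  note parts = star_subalgebra_re_part[OF star_subalgebra_of_fd[OF D] x]
    star_subalgebra_im_part[OF star_subalgebra_of_fd[OF D] x]
  have "cmod (\<tau> x) \<le> cmod (\<tau> (re_part x)) + cmod (\<tau> (im_part x))"
    using norm_triangle_ineq[of "\<tau> (re_part x)" "\<i> * \<tau> (im_part x)"]
    by (simp add: regular_trace_re_im[OF x] norm_mult)
  also have "\<dots> \<le> real (cvs.dim D) * norm x + real (cvs.dim D) * norm x"
    by (intro add_mono order_trans[OF selfadjoint] mult_left_mono parts adj_re_part adj_im_part
        norm_re_part_le norm_im_part_le) simp_all
  finally show ?thesis by (simp add: mult_ac)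
qed

subsection \<open>Casimir frames\<close>

definition trace_orthonormal :: "'a set \<Rightarrow> bool" where
  "trace_orthonormal S \<longleftrightarrow> S \<subseteq> D \<and> (\<forall>p\<in>S. \<forall>q\<in>S. \<tau> (adj q * p) = of_bool (p = q))"

lemma trace_orthonormal_projection:
  assumes S: "finite S" "trace_orthonormal S" and v: "v \<in> D" and q: "q \<in> S"
  shows "\<tau> (adj q * (v - (\<Sum>p\<in>S. \<tau> (adj p * v) *\<^sub>C p))) = 0"
proof -
  have SD: "p \<in> D" if "p \<in> S" for p using that S(2) by (auto simp: trace_orthonormal_def)
  have "\<tau> (\<Sum>p\<in>S. \<tau> (adj p * v) *\<^sub>C (adj q * p)) = (\<Sum>p\<in>S. \<tau> (adj p * v) * \<tau> (adj q * p))"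
    using q SD by (intro clinear_on_sum[OF regular_trace_clinear subspace]) (simp add: closed)
  also have "\<dots> = (\<Sum>p\<in>S. if p = q then \<tau> (adj p * v) else 0)"
    using S(2) q by (intro sum.cong) (auto simp: trace_orthonormal_def)
  also have "\<dots> = \<tau> (adj q * v)" using q S(1) by simp
  finally show ?thesis
    using q v SD
    by (simp add: right_diff_distrib sum_distrib_left mult_scaleC_right closed
        clinear_on_diff[OF regular_trace_clinear subspace])
qed

lemma trace_normalize:
  assumes w: "w \<in> D" "w \<noteq> 0"
  obtains g :: complex where "g \<noteq> 0" "\<tau> (adj (g *\<^sub>C w) * (g *\<^sub>C w)) = 1"
proof -
  obtain t where t: "\<tau> (adj w * w) = of_real t" "0 < t"
    using regular_trace_adj_mult_self[OF w(1)] w(2) by (metis less_eq_real_def)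
  define g where "g = 1 / sqrt t"
  have "\<tau> (adj (of_real g *\<^sub>C w) * (of_real g *\<^sub>C w)) = of_real (g * g * t)"
    using w closed by (simp add: star_simps clinear_on_scale[OF regular_trace_clinear] t)
  also have "g * g * t = 1" using t(2) by (simp add: g_def)
  finally show thesis using that[of "of_real g"] t(2) by (simp add: g_def)
qed

lemma trace_orthonormal_insert:
  assumes S: "trace_orthonormal S" and p: "p \<in> D" "\<tau> (adj p * p) = 1"
    and orth: "\<And>q. q \<in> S \<Longrightarrow> \<tau> (adj q * p) = 0"
  shows "trace_orthonormal (insert p S)"
proof -
  have "\<tau> (adj p * q) = 0" if "q \<in> S" for q
  proof -
    have "q \<in> D" using that S by (auto simp: trace_orthonormal_def)
    then have "\<tau> (adj (adj q * p)) = 0"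
      using orth[OF that] p(1) closed by (subst regular_trace_adj) auto
    then show ?thesis by (simp add: star_simps)
  qed
  moreover have "p \<notin> S" using orth p(2) by auto
  ultimately show ?thesis
    using S p orth by (auto simp: trace_orthonormal_def)
qed

lemma trace_orthonormal_extend:
  assumes S: "finite S" "trace_orthonormal S" and v: "v \<in> D"
  shows "\<exists>S'. finite S' \<and> trace_orthonormal S' \<and> S \<subseteq> S' \<and> v \<in> cvs.span S'"
proof -
  define s where "s = (\<Sum>p\<in>S. \<tau> (adj p * v) *\<^sub>C p)"
  have s: "s \<in> cvs.span S"
    unfolding s_def by (intro cvs.span_sum cvs.span_scale cvs.span_base)
  show ?thesis
  proof (cases "v = s")
    case True
    then show ?thesis using S s by blast
  next
    case False
    have "S \<subseteq> D" using S(2) by (simp add: trace_orthonormal_def)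
    then have "v - s \<in> D" using v s cvs.span_minimal[OF _ subspace] by (auto intro: closed)
    then obtain g where g: "g \<noteq> 0" "\<tau> (adj (g *\<^sub>C (v - s)) * (g *\<^sub>C (v - s))) = 1"
      using trace_normalize[of "v - s"] False by auto
    define p where "p = g *\<^sub>C (v - s)"
    have "p \<in> D" using \<open>v - s \<in> D\<close> by (simp add: p_def closed)
    have "\<tau> (adj q * p) = 0" if "q \<in> S" for q
    proof -
      have "\<tau> (adj q * p) = g * \<tau> (adj q * (v - s))"
        using that \<open>S \<subseteq> D\<close> \<open>v - s \<in> D\<close>
        by (simp add: p_def mult_scaleC_right clinear_on_scale[OF regular_trace_clinear] closed
            subset_iff)
      then show ?thesis using trace_orthonormal_projection[OF S v that] by (simp add: s_def)
    qed
    then have "trace_orthonormal (insert p S)"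
      using trace_orthonormal_insert[OF S(2) \<open>p \<in> D\<close>] g(2) by (simp add: p_def)
    moreover have "v \<in> cvs.span (insert p S)"
    proof -
      have "v = s + inverse g *\<^sub>C p" using g(1) by (simp add: p_def scaleC_scaleC scaleC_one)
      moreover have "s \<in> cvs.span (insert p S)" using s cvs.span_mono[of S "insert p S"] by blast
      ultimately show ?thesis by (simp add: cvs.span_add cvs.span_scale cvs.span_base)
    qed
    ultimately show ?thesis using S(1) by blast
  qed
qed

lemma trace_orthonormal_basis:
  obtains S where "finite S" "trace_orthonormal S" "cvs.span S = D"
proof -
  obtain B where B: "finite B" "D = cvs.span B" using D by (auto simp: fd_star_subalgebra_def)
  have "\<exists>S. finite S \<and> trace_orthonormal S \<and> C \<subseteq> cvs.span S" if "finite C" "C \<subseteq> D" for C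
    using that
  proof (induction C)
    case empty
    then show ?case by (intro exI[of _ "{}"]) (simp add: trace_orthonormal_def)
  next
    case (insert v C)
    have "v \<in> D" "C \<subseteq> D" using insert.prems by simp_all
    obtain S where S: "finite S" "trace_orthonormal S" "C \<subseteq> cvs.span S"
      using insert.IH[OF \<open>C \<subseteq> D\<close>] by blast
    obtain S' where S': "finite S'" "trace_orthonormal S'" "S \<subseteq> S'" "v \<in> cvs.span S'"
      using trace_orthonormal_extend[OF S(1,2) \<open>v \<in> D\<close>] by blast
    then show ?case using S(3) cvs.span_mono[OF S'(3)] by (intro exI[of _ S']) auto
  qed
  from this[OF B(1)] obtain S where S: "finite S" "trace_orthonormal S" "B \<subseteq> cvs.span S"
    using cvs.span_superset[of B] by (auto simp: B(2))
  have "cvs.span S = D"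
  proof
    show "cvs.span S \<subseteq> D"
      using S(2) by (intro cvs.span_minimal subspace) (simp add: trace_orthonormal_def)
    show "D \<subseteq> cvs.span S" using S(3) by (simp add: B(2) cvs.span_minimal cvs.subspace_span)
  qed
  then show thesis using that S by blast
qed

lemma trace_orthonormal_frame:
  assumes S: "finite S" "trace_orthonormal S" "cvs.span S = D"
  shows "frame D S (\<lambda>p a. \<tau> (adj p * a))"
  unfolding frame_def
proof (intro conjI ballI)
  show SD: "S \<subseteq> D" using S(2) by (simp add: trace_orthonormal_def)
  show "clinear_on D (*) (\<lambda>a. \<tau> (adj p * a))" if "p \<in> S" for p
    using that SD
    by (intro clinear_onI)
       (auto simp: distrib_left mult_scaleC_right subset_iff
         clinear_on_add[OF regular_trace_clinear] clinear_on_scale[OF regular_trace_clinear] closed)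
  show "a = (\<Sum>p\<in>S. \<tau> (adj p * a) *\<^sub>C p)" if a: "a \<in> D" for a
  proof -
    define w where "w = a - (\<Sum>p\<in>S. \<tau> (adj p * a) *\<^sub>C p)"
    have w: "w \<in> D" unfolding w_def using a SD by (intro closed) auto
    have "\<tau> (adj w * q) = 0" if q: "q \<in> S" for q
    proof -
      have "\<tau> (adj q * w) = 0" unfolding w_def by (rule trace_orthonormal_projection[OF S(1,2) a q])
      moreover have "\<tau> (adj (adj q * w)) = cnj (\<tau> (adj q * w))"
        using q SD w by (intro regular_trace_adj closed) auto
      ultimately show ?thesis by (simp add: star_simps)
    qed
    moreover obtain u where "w = (\<Sum>q\<in>S. u q *\<^sub>C q)"
      using w cvs.span_finite[OF S(1)] S(3) by auto
    ultimately have "\<tau> (adj w * w) = 0"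
      using clinear_on_sum[OF regular_trace_clinear subspace, of S "\<lambda>q. adj w * q" u] w SD
      by (simp add: sum_distrib_left mult_scaleC_right closed subset_iff)
    then have "w = 0" by (rule regular_trace_adj_mult_self_eq_0[OF w])
    then show ?thesis by (simp add: w_def)
  qed
qed (rule S(1))

lemma sum_trace_orthonormal_eq_1:
  assumes S: "finite S" "trace_orthonormal S" "cvs.span S = D"
  shows "(\<Sum>p\<in>S. p * adj p) = 1"
proof -
  note frame = trace_orthonormal_frame[OF S]
  define e where "e = (\<Sum>p\<in>S. p * adj p)"
  have e: "e \<in> D" unfolding e_def using frame_subset[OF frame] by (intro closed) auto
  have trace_e: "\<tau> (x * e) = \<tau> x" if x: "x \<in> D" for x
  proof -
    have "\<tau> (x * e) = (\<Sum>p\<in>S. \<tau> (x * p * adj p))"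
      using clinear_on_sum[OF regular_trace_clinear subspace, of S "\<lambda>p. x * p * adj p" "\<lambda>_. 1"] x
        frame_subset[OF frame]
      by (simp add: e_def sum_distrib_left mult.assoc scaleC_one closed)
    also have "\<dots> = (\<Sum>p\<in>S. \<tau> (adj p * (x * p)))"
      using x frame_subset[OF frame]
      by (intro sum.cong refl regular_trace_mult_commute) (auto intro: closed)
    also have "\<dots> = \<tau> x" by (rule regular_trace_frame[OF frame x, symmetric])
    finally show ?thesis .
  qed
  have "\<tau> (adj (e - 1) * (e - 1)) = \<tau> (adj (e - 1) * e) - \<tau> (adj (e - 1))"
    using e closed
    by (simp add: right_diff_distrib clinear_on_diff[OF regular_trace_clinear subspace])
  also have "\<dots> = 0" using trace_e[of "adj (e - 1)"] e by (simp add: closed)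
  finally have "e - 1 = 0"
    using e closed by (intro regular_trace_adj_mult_self_eq_0) auto
  then show ?thesis by (simp add: e_def)
qed

lemma clinear_functional_bounded:
  assumes f: "clinear_on D (*) f"
  obtains K where "0 \<le> K" "\<And>a. a \<in> D \<Longrightarrow> cmod (f a) \<le> K * norm a"
proof -
  obtain S where S: "finite S" "trace_orthonormal S" "cvs.span S = D"
    by (rule trace_orthonormal_basis)
  note frame = trace_orthonormal_frame[OF S]
  define K where "K = (\<Sum>p\<in>S. 2 * real (cvs.dim D) * norm p * cmod (f p))"
  have "cmod (f a) \<le> K * norm a" if a: "a \<in> D" for a
  proof -
    have "f a = f (\<Sum>p\<in>S. \<tau> (adj p * a) *\<^sub>C p)" by (simp add: frame_expansion[OF frame a])
    also have "\<dots> = (\<Sum>p\<in>S. \<tau> (adj p * a) * f p)"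
      by (rule clinear_on_sum[OF f subspace frame_subset[OF frame]])
    also have "cmod \<dots> \<le> (\<Sum>p\<in>S. 2 * real (cvs.dim D) * norm p * cmod (f p) * norm a)"
    proof (rule sum_norm_le)
      fix p assume p: "p \<in> S"
      have "cmod (\<tau> (adj p * a)) \<le> 2 * real (cvs.dim D) * norm (adj p * a)"
        using a frame_subset[OF frame p] by (intro regular_trace_bounded closed)
      also have "\<dots> \<le> 2 * real (cvs.dim D) * (norm p * norm a)"
        using norm_mult_ineq[of "adj p" a] by (intro mult_left_mono) (simp_all add: norm_adj)
      finally have "cmod (\<tau> (adj p * a)) * cmod (f p)
          \<le> 2 * real (cvs.dim D) * (norm p * norm a) * cmod (f p)"
        by (rule mult_right_mono) simp
      then show "cmod (\<tau> (adj p * a) * f p) \<le> 2 * real (cvs.dim D) * norm p * cmod (f p) * norm a"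
        by (simp add: norm_mult mult_ac)
    qed
    finally show ?thesis by (simp add: K_def sum_distrib_right)
  qed
  then show thesis using that[of K] by (simp add: K_def sum_nonneg)
qed

end

text \<open>The expansions of \<open>a q\<close> in terms of \<open>p\<close> and of \<open>p\<^sup>* a\<close> in terms of \<open>q\<^sup>*\<close> have the same
  coefficients \<open>\<phi>\<^sub>p(a q)\<close>, so that \<open>\<Sum>\<^sub>p a p \<otimes> p\<^sup>* = \<Sum>\<^sub>p p \<otimes> p\<^sup>* a\<close>: the Casimir element
  \<open>\<Sum>\<^sub>p p \<otimes> p\<^sup>*\<close> is a diagonal for \<open>D\<close> in the sense of amenability.\<close>

definition casimir_frame :: "'a :: star_banach set \<Rightarrow> 'a set \<Rightarrow> ('a \<Rightarrow> 'a \<Rightarrow> complex) \<Rightarrow> bool" where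
  "casimir_frame D S \<phi> \<longleftrightarrow> frame D S \<phi> \<and> (\<Sum>p\<in>S. p * adj p) = 1 \<and>
     (\<forall>p\<in>S. \<forall>a\<in>D. adj p * a = (\<Sum>q\<in>S. \<phi> p (a * q) *\<^sub>C adj q))"

lemma casimir_frame_imp_frame: "casimir_frame D S \<phi> \<Longrightarrow> frame D S \<phi>"
  and casimir_frame_sum: "casimir_frame D S \<phi> \<Longrightarrow> (\<Sum>p\<in>S. p * adj p) = 1"
  and casimir_frame_adj_mult:
    "casimir_frame D S \<phi> \<Longrightarrow> p \<in> S \<Longrightarrow> a \<in> D \<Longrightarrow> adj p * a = (\<Sum>q\<in>S. \<phi> p (a * q) *\<^sub>C adj q)"
  by (simp_all add: casimir_frame_def)

lemma casimir_frame_exists: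
  assumes D: "fd_star_subalgebra D"
  obtains S \<phi> where "casimir_frame D S \<phi>"
proof -
  note closed = star_subalgebra_closed[OF star_subalgebra_of_fd[OF D]]
  obtain S where S: "finite S" "trace_orthonormal D S" "cvs.span S = D"
    by (rule trace_orthonormal_basis[OF D])
  define \<phi> where "\<phi> p a = regular_trace D (adj p * a)" for p a
  have frame: "frame D S \<phi>" unfolding \<phi>_def by (rule trace_orthonormal_frame[OF D S])
  have "adj p * a = (\<Sum>q\<in>S. \<phi> p (a * q) *\<^sub>C adj q)" if p: "p \<in> S" and a: "a \<in> D" for p a
  proof -
    have p_mem: "p \<in> D" by (rule frame_subset[OF frame p])
    have "adj p * a = adj (\<Sum>q\<in>S. \<phi> q (adj a * p) *\<^sub>C q)"
      using a p_mem by (simp add: frame_expansion[OF frame] closed star_simps)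
    also have "\<dots> = (\<Sum>q\<in>S. cnj (\<phi> q (adj a * p)) *\<^sub>C adj q)"
      by (simp add: adj_sum star_simps)
    also have "\<dots> = (\<Sum>q\<in>S. \<phi> p (a * q) *\<^sub>C adj q)"
    proof (intro sum.cong refl)
      fix q assume "q \<in> S"
      then have "cnj (\<phi> q (adj a * p)) = \<phi> p (a * q)"
        using regular_trace_adj[OF D, of "adj q * (adj a * p)"] frame_subset[OF frame] p_mem a
        by (simp add: \<phi>_def star_simps mult.assoc closed)
      then show "cnj (\<phi> q (adj a * p)) *\<^sub>C adj q = \<phi> p (a * q) *\<^sub>C adj q" by simp
    qed
    finally show ?thesis .
  qed
  then have "casimir_frame D S \<phi>"
    unfolding casimir_frame_def using frame sum_trace_orthonormal_eq_1[OF D S] by blast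
  then show thesis by (rule that)
qed

lemma clinear_functional_limit:
  fixes D :: "'a :: star_banach set"
  assumes D: "fd_star_subalgebra D" and f: "clinear_on D (*) f" and X: "Cauchy X" "\<And>n. X n \<in> D"
  shows "convergent (\<lambda>n. f (X n))"
proof -
  obtain K where K: "0 \<le> K" "\<And>a. a \<in> D \<Longrightarrow> cmod (f a) \<le> K * norm a"
    using clinear_functional_bounded[OF D f] by blast
  have "K-lipschitz_on D f"
  proof (rule lipschitz_onI[OF _ K(1)])
    fix a b assume ab: "a \<in> D" "b \<in> D"
    note subspace = star_subalgebra_subspace[OF star_subalgebra_of_fd[OF D]]
    show "dist (f a) (f b) \<le> K * dist a b"
      using K(2)[OF cvs.subspace_diff[OF subspace ab]]
      by (simp add: dist_norm clinear_on_diff[OF f subspace ab])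
  qed
  then have "Cauchy (\<lambda>n. f (X n))"
    using lipschitz_on_uniformly_continuous uniformly_continuous_on_Cauchy X by blast
  then show ?thesis by (simp add: Cauchy_convergent_iff)
qed

lemma closed_fd_star_subalgebra:
  fixes D :: "'a :: star_banach set"
  assumes D: "fd_star_subalgebra D"
  shows "closed D"
proof (rule closed_sequential_limits[THEN iffD2], intro allI impI, elim conjE)
  fix X l assume X: "\<forall>n. X n \<in> D" "X \<longlonglongrightarrow> l"
  obtain B where "finite B" "cvs.independent B" "cvs.span B = D"
    by (rule fd_star_subalgebra_basis[OF D])
  then obtain S \<phi> where S: "frame D S \<phi>" using frame_representation by blast
  have "\<exists>c. (\<lambda>n. \<phi> p (X n)) \<longlonglongrightarrow> c" if "p \<in> S" for p
    using clinear_functional_limit[OF D frame_clinear[OF S that] LIMSEQ_imp_Cauchy[OF X(2)]] X(1)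
    by (simp add: convergent_def)
  then obtain c where c: "\<And>p. p \<in> S \<Longrightarrow> (\<lambda>n. \<phi> p (X n)) \<longlonglongrightarrow> c p" by metis
  have "(\<lambda>n. \<Sum>p\<in>S. \<phi> p (X n) *\<^sub>C p) \<longlonglongrightarrow> (\<Sum>p\<in>S. c p *\<^sub>C p)"
    using c by (intro tendsto_sum bounded_linear.tendsto[OF bounded_linear_scaleC_left])
  then have "X \<longlonglongrightarrow> (\<Sum>p\<in>S. c p *\<^sub>C p)" using X(1) by (simp add: frame_expansion[OF S])
  then have "l = (\<Sum>p\<in>S. c p *\<^sub>C p)" using X(2) LIMSEQ_unique by blast
  also have "\<dots> \<in> D"
    using frame_subset[OF S] by (intro star_subalgebra_closed[OF star_subalgebra_of_fd[OF D]])
  finally show "l \<in> D" .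
qed

section \<open>Perturbation of finite-dimensional star-subalgebras\<close>

definition approximates :: "'a :: real_normed_vector set \<Rightarrow> 'a set \<Rightarrow> real \<Rightarrow> bool" where
  "approximates F S \<delta> \<longleftrightarrow> (\<forall>p\<in>S. \<exists>f\<in>F. norm (f - p) \<le> \<delta>)"

lemma approximatesI: "(\<And>p. p \<in> S \<Longrightarrow> \<exists>f\<in>F. norm (f - p) \<le> \<delta>) \<Longrightarrow> approximates F S \<delta>"
  and approximatesE: "approximates F S \<delta> \<Longrightarrow> p \<in> S \<Longrightarrow> (\<And>f. f \<in> F \<Longrightarrow> norm (f - p) \<le> \<delta> \<Longrightarrow> thesis) \<Longrightarrow> thesis"
  by (auto simp: approximates_def)

lemma approximates_mono: "approximates F S \<delta> \<Longrightarrow> S' \<subseteq> S \<Longrightarrow> \<delta> \<le> \<epsilon> \<Longrightarrow> approximates F S' \<epsilon>"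
  unfolding approximates_def by (meson order_trans subsetD)

definition near_inclusion :: "'a :: star_banach set \<Rightarrow> 'a set \<Rightarrow> real \<Rightarrow> ('a \<Rightarrow> 'a) \<Rightarrow> bool" where
  "near_inclusion D F \<eta> T \<longleftrightarrow> clinear_on D scaleC T \<and> (\<forall>a\<in>D. T a \<in> F \<and> norm (T a - a) \<le> \<eta> * norm a)"

lemma near_inclusion_clinear: "near_inclusion D F \<eta> T \<Longrightarrow> clinear_on D scaleC T"
  and near_inclusion_mem: "near_inclusion D F \<eta> T \<Longrightarrow> a \<in> D \<Longrightarrow> T a \<in> F"
  and near_inclusion_norm: "near_inclusion D F \<eta> T \<Longrightarrow> a \<in> D \<Longrightarrow> norm (T a - a) \<le> \<eta> * norm a"
  by (simp_all add: near_inclusion_def)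

definition hermitian_on :: "'a :: star_banach set \<Rightarrow> ('a \<Rightarrow> 'a) \<Rightarrow> bool" where
  "hermitian_on D T \<longleftrightarrow> (\<forall>a\<in>D. T (adj a) = adj (T a))"

definition left_module_map :: "'a :: star_banach set \<Rightarrow> 'a set \<Rightarrow> ('a \<Rightarrow> 'a) \<Rightarrow> bool" where
  "left_module_map D\<^sub>0 D T \<longleftrightarrow> (\<forall>d\<in>D\<^sub>0. \<forall>a\<in>D. T (d * a) = d * T a)"

definition centralizes :: "'a :: star_banach set \<Rightarrow> 'a \<Rightarrow> bool" where
  "centralizes D u \<longleftrightarrow> (\<forall>d\<in>D. u * d = d * u)"

lemma norm_mult3:
  fixes a b c :: "'a :: real_normed_algebra"
  shows "norm (a * b * c) \<le> norm a * norm b * norm c"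
  by (rule order_trans[OF norm_mult_ineq]) (intro mult_right_mono norm_mult_ineq norm_ge_zero)

subsection \<open>Near inclusions as bimodule maps\<close>

lemma near_inclusion_exists:
  fixes D :: "'a :: star_banach set"
  assumes D: "fd_star_subalgebra D" and S: "frame D S \<phi>"
  obtains m where "0 \<le> m"
    "\<And>F \<delta>. cvs.subspace F \<Longrightarrow> approximates F S \<delta> \<Longrightarrow> \<exists>T. near_inclusion D F (m * \<delta>) T"
proof -
  have "\<exists>K. 0 \<le> K \<and> (\<forall>a\<in>D. cmod (\<phi> p a) \<le> K * norm a)" if "p \<in> S" for p
    by (rule clinear_functional_bounded[OF D frame_clinear[OF S that]]) blast
  then obtain K where K: "\<And>p. p \<in> S \<Longrightarrow> 0 \<le> K p" "\<And>p a. p \<in> S \<Longrightarrow> a \<in> D \<Longrightarrow> cmod (\<phi> p a) \<le> K p * norm a"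
    by metis
  show thesis
  proof (rule that)
    show "0 \<le> (\<Sum>p\<in>S. K p)" using K(1) by (rule sum_nonneg)
    fix F \<delta> assume F: "cvs.subspace F" and "approximates F S \<delta>"
    then obtain f where f: "\<And>p. p \<in> S \<Longrightarrow> f p \<in> F" "\<And>p. p \<in> S \<Longrightarrow> norm (f p - p) \<le> \<delta>"
      unfolding approximates_def by metis
    define T where "T a = (\<Sum>p\<in>S. \<phi> p a *\<^sub>C f p)" for a
    have "near_inclusion D F ((\<Sum>p\<in>S. K p) * \<delta>) T"
      unfolding near_inclusion_def
    proof (intro conjI ballI)
      show "clinear_on D scaleC T"
        using clinear_on_add[OF frame_clinear[OF S]] clinear_on_scale[OF frame_clinear[OF S]]
        by (intro clinear_onI)
           (simp_all add: T_def scaleC_add_left sum.distrib scaleC_scaleC cvs.scale_sum_right)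
      fix a assume a: "a \<in> D"
      show "T a \<in> F"
        unfolding T_def using f(1) by (intro cvs.subspace_sum[OF F] cvs.subspace_scale[OF F])
      have "T a - a = T a - (\<Sum>p\<in>S. \<phi> p a *\<^sub>C p)" by (simp add: frame_expansion[OF S a])
      also have "\<dots> = (\<Sum>p\<in>S. \<phi> p a *\<^sub>C (f p - p))"
        by (simp add: T_def sum_subtractf cvs.scale_right_diff_distrib)
      also have "norm \<dots> \<le> (\<Sum>p\<in>S. K p * norm a * \<delta>)"
      proof (rule sum_norm_le)
        fix p assume p: "p \<in> S"
        show "norm (\<phi> p a *\<^sub>C (f p - p)) \<le> K p * norm a * \<delta>"
          unfolding norm_scaleC using K[OF p] f(2)[OF p] a by (intro mult_mono) simp_all
      qed
      also have "\<dots> = (\<Sum>p\<in>S. K p) * \<delta> * norm a"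
        by (simp add: sum_distrib_right sum_distrib_left mult_ac)
      finally show "norm (T a - a) \<le> (\<Sum>p\<in>S. K p) * \<delta> * norm a" .
    qed
    then show "\<exists>T. near_inclusion D F ((\<Sum>p\<in>S. K p) * \<delta>) T" by blast
  qed
qed

definition hermitian_part :: "('a \<Rightarrow> 'a) \<Rightarrow> 'a \<Rightarrow> 'a :: star_banach" where
  "hermitian_part T a = (1/2) *\<^sub>R (T a + adj (T (adj a)))"

lemma hermitian_on_hermitian_part: "hermitian_on D (hermitian_part T)"
  by (simp add: hermitian_on_def hermitian_part_def adj_scaleR adj_add adj_adj add.commute)

lemma near_inclusion_hermitian_part:
  assumes D: "star_subalgebra D" and F: "star_subalgebra F" and T: "near_inclusion D F \<eta> T"
  shows "near_inclusion D F \<eta> (hermitian_part T)"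
  unfolding near_inclusion_def
proof (intro conjI ballI)
  note D_closed = star_subalgebra_closed[OF D] and F_closed = star_subalgebra_closed[OF F]
  show "clinear_on D scaleC (hermitian_part T)"
  proof (rule clinear_onI)
    fix a b assume "a \<in> D" "b \<in> D"
    then show "hermitian_part T (a + b) = hermitian_part T a + hermitian_part T b"
      by (simp add: hermitian_part_def adj_add clinear_on_add[OF near_inclusion_clinear[OF T]]
          D_closed algebra_simps)
  next
    fix c a assume "a \<in> D"
    then show "hermitian_part T (c *\<^sub>C a) = c *\<^sub>C hermitian_part T a"
      by (simp add: hermitian_part_def adj_scaleC clinear_on_scale[OF near_inclusion_clinear[OF T]]
          D_closed scaleC_add_right mult.commute flip: scaleC_of_real add: scaleC_scaleC)
  qed
  fix a assume a: "a \<in> D"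
  show "hermitian_part T a \<in> F"
    unfolding hermitian_part_def using a by (intro F_closed near_inclusion_mem[OF T] D_closed)
  have "hermitian_part T a - a = (1/2) *\<^sub>R ((T a - a) + adj (T (adj a) - adj a))"
    using scaleR_half_double[of a] by (simp add: hermitian_part_def adj_diff adj_adj algebra_simps)
  also have "norm \<dots> \<le> (1/2) * (norm (T a - a) + norm (T (adj a) - adj a))"
    using norm_triangle_ineq[of "T a - a" "adj (T (adj a) - adj a)"] by (simp add: norm_adj)
  also have "\<dots> \<le> (1/2) * (\<eta> * norm a + \<eta> * norm a)"
    using near_inclusion_norm[OF T a] near_inclusion_norm[OF T D_closed(8)[OF a]]
    by (simp add: norm_adj)
  finally show "norm (hermitian_part T a - a) \<le> \<eta> * norm a" by simp
qed

lemma casimir_frame_commute_left: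
  assumes D: "star_subalgebra D" and S: "casimir_frame D S \<phi>" and T: "clinear_on D scaleC T"
    and d: "d \<in> D"
  shows "(\<Sum>p\<in>S. p * T (adj p * d)) = d * (\<Sum>p\<in>S. p * T (adj p))"
proof -
  note frame = casimir_frame_imp_frame[OF S] and closed = star_subalgebra_closed[OF D]
  have "(\<Sum>p\<in>S. p * T (adj p * d)) = (\<Sum>p\<in>S. p * (\<Sum>q\<in>S. \<phi> p (d * q) *\<^sub>C T (adj q)))"
  proof (intro sum.cong refl arg_cong2[where f=times])
    fix p assume p: "p \<in> S"
    show "T (adj p * d) = (\<Sum>q\<in>S. \<phi> p (d * q) *\<^sub>C T (adj q))"
      unfolding casimir_frame_adj_mult[OF S p d]
      by (intro clinear_on_sum[OF T star_subalgebra_subspace[OF D]] closed frame_subset[OF frame])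
  qed
  also have "\<dots> = (\<Sum>q\<in>S. (\<Sum>p\<in>S. \<phi> p (d * q) *\<^sub>C p) * T (adj q))"
    unfolding sum_distrib_left sum_distrib_right mult_scaleC_left mult_scaleC_right
    by (rule sum.swap)
  also have "\<dots> = (\<Sum>q\<in>S. d * q * T (adj q))"
    using d
    by (intro sum.cong refl) (simp add: frame_expansion[OF frame] frame_subset[OF frame] closed)
  finally show ?thesis by (simp add: sum_distrib_left mult.assoc)
qed

lemma casimir_frame_commute_right:
  assumes D: "star_subalgebra D" and S: "casimir_frame D S \<phi>" and T: "clinear_on D scaleC T"
    and d: "d \<in> D"
  shows "(\<Sum>p\<in>S. T (d * p) * adj p) = (\<Sum>p\<in>S. T p * adj p) * d"
proof -
  note frame = casimir_frame_imp_frame[OF S] and closed = star_subalgebra_closed[OF D]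
  have "(\<Sum>p\<in>S. T (d * p) * adj p) = (\<Sum>q\<in>S. (\<Sum>p\<in>S. \<phi> p (d * q) *\<^sub>C T p) * adj q)"
  proof (intro sum.cong refl arg_cong2[where f=times])
    fix q assume q: "q \<in> S"
    have "T (d * q) = T (\<Sum>p\<in>S. \<phi> p (d * q) *\<^sub>C p)"
      using d q by (simp add: frame_expansion[OF frame] frame_subset[OF frame] closed)
    also have "\<dots> = (\<Sum>p\<in>S. \<phi> p (d * q) *\<^sub>C T p)"
      by (intro clinear_on_sum[OF T star_subalgebra_subspace[OF D]] frame_subset[OF frame])
    finally show "T (d * q) = (\<Sum>p\<in>S. \<phi> p (d * q) *\<^sub>C T p)" .
  qed
  also have "\<dots> = (\<Sum>p\<in>S. T p * (\<Sum>q\<in>S. \<phi> p (d * q) *\<^sub>C adj q))"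
    unfolding sum_distrib_left sum_distrib_right mult_scaleC_left mult_scaleC_right
    by (rule sum.swap)
  also have "\<dots> = (\<Sum>p\<in>S. T p * (adj p * d))"
    by (intro sum.cong refl) (simp add: casimir_frame_adj_mult[OF S _ d])
  finally show ?thesis by (simp add: sum_distrib_right mult.assoc)
qed

definition sum_norm_squares :: "'a :: real_normed_vector set \<Rightarrow> real" where
  "sum_norm_squares S = (\<Sum>p\<in>S. (norm p)\<^sup>2)"

lemma sum_norm_squares_nonneg: "0 \<le> sum_norm_squares S"
  by (simp add: sum_norm_squares_def sum_nonneg)

definition bimodule_average :: "'a :: star_banach set \<Rightarrow> ('a \<Rightarrow> 'a) \<Rightarrow> 'a \<Rightarrow> 'a" where
  "bimodule_average S T a = (\<Sum>p\<in>S. \<Sum>q\<in>S. p * T (adj p * a * q) * adj q)"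

lemma bimodule_average_clinear:
  assumes D: "star_subalgebra D" and S: "S \<subseteq> D" and T: "clinear_on D scaleC T"
  shows "clinear_on D scaleC (bimodule_average S T)"
  using S
  by (intro clinear_onI)
     (simp_all add: bimodule_average_def distrib_left distrib_right clinear_on_add[OF T]
       clinear_on_scale[OF T] star_subalgebra_closed[OF D] subset_iff sum.distrib
       mult_scaleC_left mult_scaleC_right cvs.scale_sum_right)

lemma bimodule_average_hermitian:
  assumes D: "star_subalgebra D" and S: "S \<subseteq> D" and T: "hermitian_on D T"
  shows "hermitian_on D (bimodule_average S T)"
  unfolding hermitian_on_def
proof
  fix a assume a: "a \<in> D"
  have "adj (T (adj p * a * q)) = T (adj q * adj a * p)" if "p \<in> S" "q \<in> S" for p q
  proof -
    have "adj p * a * q \<in> D" using that S a by (intro star_subalgebra_closed[OF D]) auto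
    then have "adj (T (adj p * a * q)) = T (adj (adj p * a * q))"
      using T by (simp add: hermitian_on_def)
    then show ?thesis by (simp add: star_simps mult.assoc)
  qed
  then have "adj (bimodule_average S T a) = (\<Sum>p\<in>S. \<Sum>q\<in>S. q * T (adj q * adj a * p) * adj p)"
    by (simp add: bimodule_average_def adj_sum star_simps mult.assoc)
  also have "\<dots> = bimodule_average S T (adj a)"
    unfolding bimodule_average_def by (rule sum.swap)
  finally show "bimodule_average S T (adj a) = adj (bimodule_average S T a)" by simp
qed

lemma bimodule_average_left_module:
  assumes D\<^sub>0: "star_subalgebra D\<^sub>0" and S: "casimir_frame D\<^sub>0 S \<psi>"
    and D: "star_subalgebra D" "D\<^sub>0 \<subseteq> D" and T: "clinear_on D scaleC T"
  shows "left_module_map D\<^sub>0 D (bimodule_average S T)"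
  unfolding left_module_map_def
proof (intro ballI)
  fix d a assume d: "d \<in> D\<^sub>0" and a: "a \<in> D"
  define G where "G b = (\<Sum>q\<in>S. T (b * a * q) * adj q)" for b
  have "clinear_on D\<^sub>0 scaleC G"
    using a D(2) frame_subset[OF casimir_frame_imp_frame[OF S]]
    by (intro clinear_onI)
       (simp_all add: G_def distrib_right clinear_on_add[OF T] clinear_on_scale[OF T]
         star_subalgebra_closed[OF D(1)] subset_iff sum.distrib mult_scaleC_left cvs.scale_sum_right)
  from casimir_frame_commute_left[OF D\<^sub>0 S this d]
  show "bimodule_average S T (d * a) = d * bimodule_average S T a"
    by (simp add: bimodule_average_def G_def sum_distrib_left mult.assoc)
qed

lemma norm_sandwiched_defect_le:
  assumes D: "star_subalgebra D" and T: "near_inclusion D F \<eta> T" and mem: "p \<in> D" "a \<in> D" "q \<in> D"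
  shows "norm (p * (T (adj p * a * q) - adj p * a * q) * adj q)
      \<le> (norm p)\<^sup>2 * (norm q)\<^sup>2 * (\<eta> * norm a)"
proof (cases "a = 0")
  case False
  note closed = star_subalgebra_closed[OF D]
  have "0 \<le> \<eta> * norm a" using near_inclusion_norm[OF T mem(2)] norm_ge_zero order_trans by blast
  then have "0 \<le> \<eta>" using False by (simp add: zero_le_mult_iff)
  have "norm (T (adj p * a * q) - adj p * a * q) \<le> \<eta> * norm (adj p * a * q)"
    using mem by (intro near_inclusion_norm[OF T] closed)
  also have "\<dots> \<le> \<eta> * (norm p * norm a * norm q)"
    using norm_mult3[of "adj p" a q] \<open>0 \<le> \<eta>\<close> by (intro mult_left_mono) (simp_all add: norm_adj)
  finally have defect: "norm (T (adj p * a * q) - adj p * a * q) \<le> \<eta> * (norm p * norm a * norm q)" .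
  have "norm (p * (T (adj p * a * q) - adj p * a * q) * adj q)
      \<le> norm p * norm (T (adj p * a * q) - adj p * a * q) * norm q"
    using norm_mult3[of p _ "adj q"] by (simp add: norm_adj)
  also have "\<dots> \<le> norm p * (\<eta> * (norm p * norm a * norm q)) * norm q"
    by (intro mult_right_mono mult_left_mono norm_ge_zero defect)
  finally show ?thesis by (simp add: power2_eq_square mult_ac)
next
  case True
  then show ?thesis using near_inclusion_norm[OF T star_subalgebra_closed(1)[OF D]] by simp
qed

lemma bimodule_average_near_inclusion:
  assumes S: "casimir_frame D\<^sub>0 S \<psi>"
    and D: "star_subalgebra D" "D\<^sub>0 \<subseteq> D" and F: "star_subalgebra F" "D\<^sub>0 \<subseteq> F"
    and T: "near_inclusion D F \<eta> T"
  shows "near_inclusion D F ((sum_norm_squares S)\<^sup>2 * \<eta>) (bimodule_average S T)"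
  unfolding near_inclusion_def
proof (intro conjI ballI)
  note D_closed = star_subalgebra_closed[OF D(1)] and F_closed = star_subalgebra_closed[OF F(1)]
  have SD: "p \<in> D" and SF: "p \<in> F" if "p \<in> S" for p
    using frame_subset[OF casimir_frame_imp_frame[OF S] that] D(2) F(2) by auto
  show "clinear_on D scaleC (bimodule_average S T)"
    using SD by (intro bimodule_average_clinear D(1) near_inclusion_clinear[OF T]) blast
  fix a assume a: "a \<in> D"
  show "bimodule_average S T a \<in> F"
    unfolding bimodule_average_def using SF SD a
    by (intro F_closed near_inclusion_mem[OF T] D_closed)
  have "(\<Sum>p\<in>S. p * adj p) * a * (\<Sum>q\<in>S. q * adj q) = (\<Sum>p\<in>S. \<Sum>q\<in>S. p * (adj p * a * q) * adj q)"
    by (simp add: sum_distrib_left sum_distrib_right mult.assoc) (rule sum.swap)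
  then have "bimodule_average S T a - a
      = (\<Sum>p\<in>S. \<Sum>q\<in>S. p * (T (adj p * a * q) - adj p * a * q) * adj q)"
    by (simp add: bimodule_average_def casimir_frame_sum[OF S] sum_subtractf right_diff_distrib
        left_diff_distrib)
  also have "norm \<dots> \<le> (\<Sum>p\<in>S. \<Sum>q\<in>S. (norm p)\<^sup>2 * (norm q)\<^sup>2 * (\<eta> * norm a))"
    using SD a by (intro sum_norm_le norm_sandwiched_defect_le[OF D(1) T])
  also have "\<dots> = (sum_norm_squares S)\<^sup>2 * \<eta> * norm a"
    unfolding sum_norm_squares_def power2_eq_square[of "sum _ _"] sum_product
    by (simp add: sum_distrib_right mult.assoc)
  finally show "norm (bimodule_average S T a - a) \<le> (sum_norm_squares S)\<^sup>2 * \<eta> * norm a" .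
qed

lemma near_inclusion_module_map_exists:
  fixes D D\<^sub>0 :: "'a :: star_banach set"
  assumes D: "fd_star_subalgebra D" and S: "frame D S \<phi>"
    and D\<^sub>0: "fd_star_subalgebra D\<^sub>0" "D\<^sub>0 \<subseteq> D"
  obtains m where "0 \<le> m"
    "\<And>F \<delta>. star_subalgebra F \<Longrightarrow> D\<^sub>0 \<subseteq> F \<Longrightarrow> approximates F S \<delta> \<Longrightarrow>
      \<exists>T. near_inclusion D F (m * \<delta>) T \<and> hermitian_on D T \<and> left_module_map D\<^sub>0 D T"
proof -
  note subD = star_subalgebra_of_fd[OF D] and subD\<^sub>0 = star_subalgebra_of_fd[OF D\<^sub>0(1)]
  obtain m where m: "0 \<le> m"
      and near: "\<And>F \<delta>. cvs.subspace F \<Longrightarrow> approximates F S \<delta> \<Longrightarrow> \<exists>T. near_inclusion D F (m * \<delta>) T"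
    using near_inclusion_exists[OF D S] by metis
  obtain S\<^sub>0 \<psi> where S\<^sub>0: "casimir_frame D\<^sub>0 S\<^sub>0 \<psi>" by (rule casimir_frame_exists[OF D\<^sub>0(1)])
  show thesis
  proof (rule that)
    show "0 \<le> (sum_norm_squares S\<^sub>0)\<^sup>2 * m" using m by simp
    fix F \<delta> assume F: "star_subalgebra F" "D\<^sub>0 \<subseteq> F" and "approximates F S \<delta>"
    then obtain T where "near_inclusion D F (m * \<delta>) T"
      using near[OF star_subalgebra_subspace] by blast
    then have T: "near_inclusion D F (m * \<delta>) (hermitian_part T)"
      by (rule near_inclusion_hermitian_part[OF subD F(1)])
    let ?T = "bimodule_average S\<^sub>0 (hermitian_part T)"
    have "near_inclusion D F ((sum_norm_squares S\<^sub>0)\<^sup>2 * m * \<delta>) ?T"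
      using bimodule_average_near_inclusion[OF S\<^sub>0 subD D\<^sub>0(2) F T] by (simp add: mult.assoc)
    moreover have "hermitian_on D ?T"
      using frame_subset[OF casimir_frame_imp_frame[OF S\<^sub>0]] D\<^sub>0(2)
      by (intro bimodule_average_hermitian[OF subD _ hermitian_on_hermitian_part]) blast
    moreover have "left_module_map D\<^sub>0 D ?T"
      by (rule bimodule_average_left_module[OF subD\<^sub>0 S\<^sub>0 subD D\<^sub>0(2) near_inclusion_clinear[OF T]])
    ultimately show "\<exists>T. near_inclusion D F ((sum_norm_squares S\<^sub>0)\<^sup>2 * m * \<delta>) T \<and>
        hermitian_on D T \<and> left_module_map D\<^sub>0 D T"
      by blast
  qed
qed

subsection \<open>The Newton step\<close>

text \<open>With \<open>\<alpha> = T - id\<close>, averaging \<open>T\<close> against the Casimir element gives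
  \<open>\<Sum>\<^sub>p T(p) T(p\<^sup>* a) = a + x a + a x\<^sup>* + R(a)\<close> with \<open>x = \<Sum>\<^sub>p \<alpha>(p) p\<^sup>*\<close> and a quadratic remainder
  \<open>R\<close>. This lies in the target \<open>F\<close> of \<open>T\<close>; removing the self-adjoint part of \<open>x\<close> inside \<open>F\<close>
  leaves, up to second order, \<open>a + [k, a]\<close> with the skew-adjoint element \<open>k = (x - x\<^sup>*)/2\<close>, the
  derivative of \<open>e\<^sup>t\<^sup>k a e\<^sup>-\<^sup>t\<^sup>k\<close> at \<open>t = 0\<close>.\<close>

definition linear_defect :: "'a :: star_banach set \<Rightarrow> ('a \<Rightarrow> 'a) \<Rightarrow> 'a" where
  "linear_defect S T = (\<Sum>p\<in>S. (T p - p) * adj p)"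

definition quadratic_defect :: "'a :: star_banach set \<Rightarrow> ('a \<Rightarrow> 'a) \<Rightarrow> 'a \<Rightarrow> 'a" where
  "quadratic_defect S T a = (\<Sum>p\<in>S. (T p - p) * (T (adj p * a) - adj p * a))"

definition casimir_average :: "'a :: star_banach set \<Rightarrow> ('a \<Rightarrow> 'a) \<Rightarrow> 'a \<Rightarrow> 'a" where
  "casimir_average S T a = (\<Sum>p\<in>S. T p * T (adj p * a))"

definition corrected_average :: "'a :: star_banach set \<Rightarrow> ('a \<Rightarrow> 'a) \<Rightarrow> 'a \<Rightarrow> 'a" where
  "corrected_average S T a = casimir_average S T a
     - (1/2) *\<^sub>R ((casimir_average S T 1 - 1) * T a + T a * (casimir_average S T 1 - 1))"

definition newton_direction :: "'a :: star_banach set \<Rightarrow> ('a \<Rightarrow> 'a) \<Rightarrow> 'a" where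
  "newton_direction S T = (1/2) *\<^sub>R (linear_defect S T - adj (linear_defect S T))"

lemma adj_newton_direction: "adj (newton_direction S T) = - newton_direction S T"
  by (simp add: newton_direction_def adj_scaleR adj_diff adj_adj flip: scaleR_minus_right)

lemma adj_linear_defect:
  assumes "S \<subseteq> D" "hermitian_on D T"
  shows "adj (linear_defect S T) = (\<Sum>p\<in>S. p * (T (adj p) - adj p))"
  using assms
  by (simp add: linear_defect_def hermitian_on_def adj_sum star_simps adj_diff subset_iff)

lemma clinear_on_defect: "clinear_on D scaleC T \<Longrightarrow> clinear_on D scaleC (\<lambda>a. T a - a)"
  by (simp add: clinear_on_def cvs.scale_right_diff_distrib)

lemma casimir_average_eq:
  assumes D: "star_subalgebra D" and S: "casimir_frame D S \<phi>"
    and T: "clinear_on D scaleC T" "hermitian_on D T" and a: "a \<in> D"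
  shows "casimir_average S T a
      = a + linear_defect S T * a + a * adj (linear_defect S T) + quadratic_defect S T a"
proof -
  have "casimir_average S T a = (\<Sum>p\<in>S. p * adj p * a + (T p - p) * adj p * a
      + p * (T (adj p * a) - adj p * a) + (T p - p) * (T (adj p * a) - adj p * a))"
    unfolding casimir_average_def by (intro sum.cong refl) (simp add: algebra_simps)
  also have "\<dots> = (\<Sum>p\<in>S. p * adj p) * a + linear_defect S T * a
      + (\<Sum>p\<in>S. p * (T (adj p * a) - adj p * a)) + quadratic_defect S T a"
    by (simp add: sum.distrib linear_defect_def quadratic_defect_def sum_distrib_right)
  also have "(\<Sum>p\<in>S. p * (T (adj p * a) - adj p * a)) = a * adj (linear_defect S T)"
    using frame_subset[OF casimir_frame_imp_frame[OF S]]
      casimir_frame_commute_left[OF D S clinear_on_defect[OF T(1)] a]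
    by (simp add: adj_linear_defect[OF _ T(2)] subsetI)
  finally show ?thesis by (simp add: casimir_frame_sum[OF S])
qed

lemma linear_defect_commute:
  assumes D: "star_subalgebra D" and S: "casimir_frame D S \<phi>" and T: "clinear_on D scaleC T"
    and module: "left_module_map D\<^sub>0 D T" and d: "d \<in> D\<^sub>0" "d \<in> D"
  shows "linear_defect S T * d = d * linear_defect S T"
proof -
  have "linear_defect S T * d = (\<Sum>p\<in>S. (T (d * p) - d * p) * adj p)"
    unfolding linear_defect_def
    by (rule casimir_frame_commute_right[OF D S clinear_on_defect[OF T] d(2), symmetric])
  also have "\<dots> = (\<Sum>p\<in>S. d * ((T p - p) * adj p))"
    using module d(1) frame_subset[OF casimir_frame_imp_frame[OF S]]
    by (intro sum.cong refl) (simp add: left_module_map_def algebra_simps)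
  also have "\<dots> = d * linear_defect S T" by (simp add: linear_defect_def sum_distrib_left)
  finally show ?thesis .
qed

lemma newton_direction_centralizes:
  assumes D: "star_subalgebra D" and S: "casimir_frame D S \<phi>" and T: "clinear_on D scaleC T"
    and module: "left_module_map D\<^sub>0 D T" and D\<^sub>0: "star_subalgebra D\<^sub>0" "D\<^sub>0 \<subseteq> D"
  shows "centralizes D\<^sub>0 (newton_direction S T)"
  unfolding centralizes_def
proof
  let ?x = "linear_defect S T"
  fix d assume d: "d \<in> D\<^sub>0"
  have commute: "?x * d = d * ?x" if "d \<in> D\<^sub>0" for d
    using that D\<^sub>0(2) by (intro linear_defect_commute[OF D S T module]) auto
  have "adj (?x * adj d) = adj (adj d * ?x)"
    using commute[OF star_subalgebra_closed(8)[OF D\<^sub>0(1) d]] by simp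
  then have "adj ?x * d = d * adj ?x" by (simp add: star_simps)
  then show "newton_direction S T * d = d * newton_direction S T"
    using commute[OF d] by (simp add: newton_direction_def algebra_simps)
qed

context
  fixes D F S :: "'a :: star_banach set" and T :: "'a \<Rightarrow> 'a" and \<eta> :: real
  assumes D: "star_subalgebra D" and S: "S \<subseteq> D" and T: "near_inclusion D F \<eta> T" and \<eta>: "0 \<le> \<eta>"
begin

lemma norm_linear_defect_le: "norm (linear_defect S T) \<le> sum_norm_squares S * \<eta>"
proof -
  have "norm (linear_defect S T) \<le> (\<Sum>p\<in>S. (norm p)\<^sup>2 * \<eta>)"
    unfolding linear_defect_def
  proof (rule sum_norm_le)
    fix p assume "p \<in> S"
    then have "norm (T p - p) \<le> \<eta> * norm p" using S by (intro near_inclusion_norm[OF T]) auto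
    then have "norm (T p - p) * norm (adj p) \<le> \<eta> * norm p * norm p"
      by (simp add: norm_adj mult_right_mono)
    then show "norm ((T p - p) * adj p) \<le> (norm p)\<^sup>2 * \<eta>"
      by (intro order_trans[OF norm_mult_ineq]) (simp add: power2_eq_square mult_ac)
  qed
  then show ?thesis by (simp add: sum_norm_squares_def sum_distrib_right)
qed

lemma norm_quadratic_defect_le:
  assumes a: "a \<in> D"
  shows "norm (quadratic_defect S T a) \<le> sum_norm_squares S * \<eta>\<^sup>2 * norm a"
proof -
  have "norm (quadratic_defect S T a) \<le> (\<Sum>p\<in>S. (norm p)\<^sup>2 * (\<eta>\<^sup>2 * norm a))"
    unfolding quadratic_defect_def
  proof (rule sum_norm_le)
    fix p assume "p \<in> S"
    then have p: "p \<in> D" using S by blast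
    have "norm (T (adj p * a) - adj p * a) \<le> \<eta> * norm (adj p * a)"
      using p a by (intro near_inclusion_norm[OF T] star_subalgebra_closed[OF D])
    also have "\<dots> \<le> \<eta> * (norm p * norm a)"
      using norm_mult_ineq[of "adj p" a] \<eta> by (intro mult_left_mono) (simp_all add: norm_adj)
    finally have "norm (T p - p) * norm (T (adj p * a) - adj p * a)
        \<le> (\<eta> * norm p) * (\<eta> * (norm p * norm a))"
      using near_inclusion_norm[OF T p] \<eta> by (intro mult_mono) simp_all
    then show "norm ((T p - p) * (T (adj p * a) - adj p * a)) \<le> (norm p)\<^sup>2 * (\<eta>\<^sup>2 * norm a)"
      by (intro order_trans[OF norm_mult_ineq]) (simp add: power2_eq_square mult_ac)
  qed
  then show ?thesis by (simp add: sum_norm_squares_def sum_distrib_right mult.assoc)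
qed

lemma norm_newton_direction_le: "norm (newton_direction S T) \<le> sum_norm_squares S * \<eta>"
  using norm_triangle_ineq4[of "linear_defect S T" "adj (linear_defect S T)"] norm_linear_defect_le
  by (simp add: newton_direction_def norm_adj)

end

lemma corrected_average_mem:
  assumes D: "star_subalgebra D" and S: "S \<subseteq> D" and F: "star_subalgebra F"
    and T: "\<And>a. a \<in> D \<Longrightarrow> T a \<in> F" and a: "a \<in> D"
  shows "corrected_average S T a \<in> F"
proof -
  have "casimir_average S T b \<in> F" if "b \<in> D" for b
    unfolding casimir_average_def using that S
    by (intro star_subalgebra_closed[OF F] T star_subalgebra_closed[OF D]) auto
  then show ?thesis
    unfolding corrected_average_def using a
    by (intro star_subalgebra_closed[OF F] T) (simp_all add: star_subalgebra_closed[OF D])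
qed

lemma corrected_average_eq:
  fixes T :: "'a :: star_banach \<Rightarrow> 'a"
  assumes D: "star_subalgebra D" and S: "casimir_frame D S \<phi>"
    and T: "clinear_on D scaleC T" "hermitian_on D T" and a: "a \<in> D"
  defines "x \<equiv> linear_defect S T" and "R \<equiv> quadratic_defect S T" and "k \<equiv> newton_direction S T"
  shows "corrected_average S T a - (a + k * a - a * k) =
    R a - (1/2) *\<^sub>R (R 1 * T a + T a * R 1 + (x + adj x) * (T a - a) + (T a - a) * (x + adj x))"
proof -
  define \<alpha> where "\<alpha> = T a - a"
  have Ta: "T a = a + \<alpha>" by (simp add: \<alpha>_def)
  have symmetrize: "x * a + a * adj x = (1/2) *\<^sub>R (x * a + x * a + a * adj x + a * adj x)"
    using scaleR_half_double[of "x * a"] scaleR_half_double[of "a * adj x"]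
    by (simp add: scaleR_add_right)
  have "casimir_average S T 1 - 1 = x + adj x + R 1"
    using casimir_average_eq[OF D S T star_subalgebra_closed(2)[OF D]] by (simp add: x_def R_def)
  then have "corrected_average S T a - (a + k * a - a * k) = (x * a + a * adj x) + R a
      - (1/2) *\<^sub>R ((x + adj x + R 1) * T a + T a * (x + adj x + R 1))
      - (1/2) *\<^sub>R ((x - adj x) * a - a * (x - adj x))"
    using casimir_average_eq[OF D S T a]
    by (simp add: corrected_average_def newton_direction_def k_def flip: x_def R_def)
       (simp add: algebra_simps)
  also have "\<dots> = R a - (1/2) *\<^sub>R (R 1 * T a + T a * R 1 + (x + adj x) * \<alpha> + \<alpha> * (x + adj x))"
    unfolding symmetrize Ta by (simp add: algebra_simps)
  finally show ?thesis by (simp add: \<alpha>_def)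
qed

lemma corrected_average_near:
  assumes D: "star_subalgebra D" and S: "casimir_frame D S \<phi>"
    and T: "near_inclusion D F \<eta> T" "hermitian_on D T" and \<eta>: "0 \<le> \<eta>" "\<eta> \<le> 1" and a: "a \<in> D"
  defines "k \<equiv> newton_direction S T"
  shows "norm (corrected_average S T a - (a + k * a - a * k))
      \<le> 5 * sum_norm_squares S * \<eta>\<^sup>2 * norm a"
proof -
  define x where "x = linear_defect S T"
  define R where "R = quadratic_defect S T"
  define s where "s = sum_norm_squares S"
  have s: "0 \<le> s" by (simp add: s_def sum_norm_squares_nonneg)
  have SD: "S \<subseteq> D" using frame_subset[OF casimir_frame_imp_frame[OF S]] by blast
  have norm_R1: "norm (R 1) \<le> s * \<eta>\<^sup>2" and norm_Ra: "norm (R a) \<le> s * \<eta>\<^sup>2 * norm a"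
    using norm_quadratic_defect_le[OF D SD T(1) \<eta>(1)] star_subalgebra_closed(2)[OF D] a
    by (force simp: R_def s_def)+
  have norm_xx: "norm (x + adj x) \<le> 2 * (s * \<eta>)"
    using norm_linear_defect_le[OF D SD T(1) \<eta>(1)] norm_triangle_ineq[of x "adj x"]
    by (simp add: norm_adj x_def s_def)
  have \<alpha>: "norm (T a - a) \<le> \<eta> * norm a" by (rule near_inclusion_norm[OF T(1) a])
  have norm_Ta: "norm (T a) \<le> 2 * norm a"
    using \<alpha> norm_triangle_ineq[of "T a - a" a] mult_right_mono[OF \<eta>(2), of "norm a"] by simp
  have "norm (R 1 * T a) \<le> s * \<eta>\<^sup>2 * (2 * norm a)" "norm (T a * R 1) \<le> 2 * norm a * (s * \<eta>\<^sup>2)"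
      "norm ((x + adj x) * (T a - a)) \<le> 2 * (s * \<eta>) * (\<eta> * norm a)"
      "norm ((T a - a) * (x + adj x)) \<le> \<eta> * norm a * (2 * (s * \<eta>))"
    using norm_R1 norm_Ta norm_xx \<alpha> s \<eta>(1)
    by (intro order_trans[OF norm_mult_ineq] mult_mono; simp)+
  then have "norm (R 1 * T a + T a * R 1 + (x + adj x) * (T a - a) + (T a - a) * (x + adj x))
      \<le> s * \<eta>\<^sup>2 * (2 * norm a) + 2 * norm a * (s * \<eta>\<^sup>2) + 2 * (s * \<eta>) * (\<eta> * norm a)
        + \<eta> * norm a * (2 * (s * \<eta>))"
    by (intro norm_add_rule_thm)
  also have "\<dots> = 8 * (s * \<eta>\<^sup>2 * norm a)" by (simp add: power2_eq_square)
  finally have "norm ((1/2) *\<^sub>R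
      (R 1 * T a + T a * R 1 + (x + adj x) * (T a - a) + (T a - a) * (x + adj x)))
      \<le> 4 * (s * \<eta>\<^sup>2 * norm a)"
    by simp
  then have "norm (corrected_average S T a - (a + k * a - a * k))
      \<le> s * \<eta>\<^sup>2 * norm a + 4 * (s * \<eta>\<^sup>2 * norm a)"
    unfolding k_def corrected_average_eq[OF D S near_inclusion_clinear[OF T(1)] T(2) a]
    unfolding x_def[symmetric] R_def[symmetric]
    by (intro order_trans[OF norm_triangle_ineq4] add_mono norm_Ra)
  then show ?thesis by (simp add: s_def mult_ac)
qed

subsection \<open>Conjugation by unitaries near the identity\<close>

definition is_unitary :: "'a :: star_banach \<Rightarrow> bool" where
  "is_unitary u \<longleftrightarrow> adj u * u = 1 \<and> u * adj u = 1"

lemma is_unitary_one: "is_unitary 1"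
  by (simp add: is_unitary_def)

lemma is_unitary_adj: "is_unitary u \<Longrightarrow> is_unitary (adj u)"
  by (simp add: is_unitary_def adj_adj)

lemma unitary_cancel:
  assumes "is_unitary u"
  shows "adj u * (u * x) = x" "u * (adj u * x) = x"
  using assms unfolding is_unitary_def by (metis mult.assoc mult.left_neutral)+

lemma is_unitary_mult: "is_unitary u \<Longrightarrow> is_unitary v \<Longrightarrow> is_unitary (u * v)"
  by (simp add: is_unitary_def adj_mult mult.assoc unitary_cancel)

lemma adj_exp: "adj (exp x :: 'a :: star_banach) = exp (adj x)"
proof -
  have power: "adj (x ^ n) = adj x ^ n" for n
    by (induction n) (auto simp: adj_mult power_commutes)
  have "adj (exp x) = (\<Sum>n. adj (x ^ n /\<^sub>R fact n))"
    unfolding exp_def by (rule bounded_linear.suminf[OF bounded_linear_adj summable_exp_generic])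
  also have "\<dots> = exp (adj x)"
    by (simp add: exp_def adj_scaleR power)
  finally show ?thesis .
qed

lemma is_unitary_exp: "adj k = - k \<Longrightarrow> is_unitary (exp k)"
  using exp_minus_inverse[of k] exp_minus_inverse[of "- k"] by (simp add: is_unitary_def adj_exp)

lemma is_unitary_limit:
  assumes lim: "w \<longlonglongrightarrow> u" and w: "\<And>n. is_unitary (w n)"
  shows "is_unitary u"
proof -
  have "(\<lambda>n. adj (w n)) \<longlonglongrightarrow> adj u"
    using lim by (rule bounded_linear.tendsto[OF bounded_linear_adj])
  then have "(\<lambda>n. adj (w n) * w n) \<longlonglongrightarrow> adj u * u" "(\<lambda>n. w n * adj (w n)) \<longlonglongrightarrow> u * adj u"
    using lim by (auto intro: tendsto_mult)
  then show ?thesis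
    using w by (auto simp: is_unitary_def LIMSEQ_const_iff)
qed

lemma norm_near_one_le_2: "norm (u - 1 :: 'a :: real_normed_algebra_1) \<le> 1 \<Longrightarrow> norm u \<le> 2"
  using norm_triangle_ineq[of "u - 1" 1] by simp

lemma norm_adj_diff_one: "norm (adj u - 1 :: 'a :: star_banach) = norm (u - 1)"
  using norm_adj[of "u - 1"] by (simp add: adj_diff)

lemma centralizes_one: "centralizes D 1"
  by (simp add: centralizes_def)

lemma centralizes_mult: "centralizes D u \<Longrightarrow> centralizes D v \<Longrightarrow> centralizes D (u * v)"
  unfolding centralizes_def by (metis mult.assoc)

lemma centralizes_limit:
  assumes lim: "w \<longlonglongrightarrow> u" and w: "\<And>n. centralizes D (w n)"
  shows "centralizes D u"
  unfolding centralizes_def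
proof
  fix d assume "d \<in> D"
  have "(\<lambda>n. w n * d) \<longlonglongrightarrow> u * d" "(\<lambda>n. d * w n) \<longlonglongrightarrow> d * u"
    using lim by (auto intro: tendsto_mult_left tendsto_mult_right)
  then show "u * d = d * u" using w \<open>d \<in> D\<close> LIMSEQ_unique by (auto simp: centralizes_def)
qed

lemma centralizes_exp:
  assumes "centralizes D k"
  shows "centralizes D (exp k)"
  unfolding centralizes_def
proof
  fix d assume "d \<in> D"
  then have power: "k ^ n * d = d * k ^ n" for n
    using assms by (intro power_commuting_commutes) (simp add: centralizes_def)
  have "exp k * d = (\<Sum>n. k ^ n /\<^sub>R fact n * d)"
    unfolding exp_def by (rule suminf_mult2[OF summable_exp_generic])
  also have "\<dots> = (\<Sum>n. d * (k ^ n /\<^sub>R fact n))" by (simp add: power)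
  also have "\<dots> = d * exp k"
    unfolding exp_def by (rule suminf_mult[OF summable_exp_generic])
  finally show "exp k * d = d * exp k" .
qed

definition conjugate :: "'a :: star_banach \<Rightarrow> 'a \<Rightarrow> 'a" where
  "conjugate u x = u * x * adj u"

lemma conjugate_conjugate: "conjugate u (conjugate v x) = conjugate (u * v) x"
  by (simp add: conjugate_def adj_mult mult.assoc)

lemma conjugate_one: "conjugate 1 x = x"
  by (simp add: conjugate_def)

lemma conjugate_adj_cancel:
  assumes "is_unitary u"
  shows "conjugate (adj u) (conjugate u x) = x" "conjugate u (conjugate (adj u) x) = x"
  using assms by (simp_all add: conjugate_conjugate conjugate_one is_unitary_def)

lemma conjugate_diff: "conjugate u (x - y) = conjugate u x - conjugate u y"
  by (simp add: conjugate_def algebra_simps)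

lemma conjugate_fixes_centralized:
  assumes "is_unitary u" "centralizes D u" "d \<in> D"
  shows "conjugate u d = d"
proof -
  have "conjugate u d = d * (u * adj u)"
    using assms(2,3) by (simp add: conjugate_def centralizes_def mult.assoc)
  then show ?thesis using assms(1) by (simp add: is_unitary_def)
qed

lemma norm_conjugate_le:
  assumes "norm u \<le> 2"
  shows "norm (conjugate u x) \<le> 4 * norm x"
proof -
  have "norm (conjugate u x) \<le> norm u * norm x * norm u"
    unfolding conjugate_def using norm_mult3[of u x "adj u"] by (simp add: norm_adj)
  also have "\<dots> \<le> 2 * norm x * 2" using assms by (intro mult_mono) simp_all
  finally show ?thesis by simp
qed

lemma norm_conjugate_diff_le:
  assumes u: "norm (u - 1) \<le> t" "t \<le> 1"
  shows "norm (conjugate u x - x) \<le> 3 * t * norm x"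
proof -
  have t: "0 \<le> t" using u(1) norm_ge_zero order_trans by blast
  have "norm u \<le> 2" using u by (intro norm_near_one_le_2) simp
  have "conjugate u x - x = (u - 1) * x * adj u + x * (adj u - 1)"
    by (simp add: conjugate_def algebra_simps)
  also have "norm \<dots> \<le> t * norm x * 2 + norm x * t"
  proof (rule norm_triangle_mono)
    show "norm ((u - 1) * x * adj u) \<le> t * norm x * 2"
      using u t \<open>norm u \<le> 2\<close>
      by (intro order_trans[OF norm_mult3] mult_mono) (simp_all add: norm_adj)
    show "norm (x * (adj u - 1)) \<le> norm x * t"
      using u
      by (intro order_trans[OF norm_mult_ineq] mult_left_mono) (simp_all add: norm_adj_diff_one)
  qed
  finally show ?thesis by (simp add: mult_ac)
qed

lemma norm_conjugate_near_le:
  assumes u: "norm (u - 1) \<le> t" "t \<le> 1"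
  shows "norm (conjugate u y - x) \<le> 4 * norm (y - x) + 3 * t * norm x"
proof -
  have "norm u \<le> 2" using u by (intro norm_near_one_le_2) simp
  then have "norm (conjugate u (y - x)) \<le> 4 * norm (y - x)" by (rule norm_conjugate_le)
  then show ?thesis
    using norm_conjugate_diff_le[OF u, of x]
      norm_triangle_ineq[of "conjugate u (y - x)" "conjugate u x - x"]
    by (simp add: conjugate_diff)
qed

lemma star_subalgebra_conjugate:
  assumes u: "is_unitary u" and F: "star_subalgebra F"
  shows "star_subalgebra (conjugate u ` F)"
proof -
  note closed = star_subalgebra_closed[OF F]
  have eqs: "0 = conjugate u 0" "1 = conjugate u 1"
      "conjugate u a + conjugate u b = conjugate u (a + b)"
      "conjugate u a * conjugate u b = conjugate u (a * b)"
      "c *\<^sub>C conjugate u a = conjugate u (c *\<^sub>C a)"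
      "adj (conjugate u a) = conjugate u (adj a)" for a b c
    using u
    by (simp_all add: conjugate_def algebra_simps star_simps is_unitary_def unitary_cancel[OF u]
        mult.assoc)
  have "0 \<in> conjugate u ` F" "1 \<in> conjugate u ` F" by (subst eqs, intro imageI closed)+
  then show ?thesis
    unfolding star_subalgebra_def cvs.subspace_def using closed by (auto simp: eqs(3-6))
qed

lemma fd_star_subalgebra_conjugate:
  assumes u: "is_unitary u" and F: "fd_star_subalgebra F"
  shows "fd_star_subalgebra (conjugate u ` F)"
proof -
  obtain B where B: "finite B" "F = cvs.span B" using F by (auto simp: fd_star_subalgebra_def)
  have "Modules.module_hom scaleC scaleC (conjugate u)"
    by unfold_locales
       (auto simp: conjugate_def algebra_simps star_simps scaleC_add_right scaleC_add_left
         scaleC_scaleC scaleC_one)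
  then have "conjugate u ` F = cvs.span (conjugate u ` B)"
    unfolding B(2) by (rule Modules.module_hom.span_image[symmetric])
  then show ?thesis
    using star_subalgebra_conjugate[OF u star_subalgebra_of_fd[OF F]] B(1)
    by (auto simp: fd_star_subalgebra_def)
qed

lemma approximates_conjugate:
  assumes "norm u \<le> 2" "approximates F S \<delta>"
  shows "approximates (conjugate u ` F) (conjugate u ` S) (4 * \<delta>)"
proof (rule approximatesI, clarify)
  fix p assume "p \<in> S"
  with assms(2) obtain f where f: "f \<in> F" "norm (f - p) \<le> \<delta>" by (rule approximatesE)
  then have "norm (conjugate u f - conjugate u p) \<le> 4 * \<delta>"
    using norm_conjugate_le[OF assms(1), of "f - p"] by (simp add: conjugate_diff)
  then show "\<exists>g\<in>conjugate u ` F. norm (g - conjugate u p) \<le> 4 * \<delta>" using f(1) by blast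
qed

lemma norm_exp_remainder_le:
  fixes x :: "'a :: {real_normed_algebra_1, banach}"
  assumes "norm x \<le> 1"
  shows "norm (exp x - 1 - x) \<le> (norm x)\<^sup>2"
proof -
  have summable: "summable (\<lambda>n. inverse (fact (n + 2)) * norm x ^ (n + 2))"
    using summable_exp[of "norm x", THEN summable_ignore_initial_segment, of 2] .
  have term_le: "norm (inverse (fact (n + 2)) *\<^sub>R x ^ (n + 2))
      \<le> inverse (fact (n + 2)) * norm x ^ (n + 2)" for n
    using norm_power_ineq[of x "n + 2"] by (simp add: mult_left_mono)
  have "norm (exp x - 1 - x) = norm (\<Sum>n. inverse (fact (n + 2)) *\<^sub>R x ^ (n + 2))"
    by (subst exp_first_two_terms) simp
  also have "\<dots> \<le> (\<Sum>n. inverse (fact (n + 2)) * norm x ^ (n + 2))"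
    by (rule norm_suminf_le[OF term_le summable])
  also have "\<dots> = exp (norm x) - 1 - norm x"
    by (subst exp_first_two_terms[of "norm x"]) simp
  also have "\<dots> \<le> (norm x)\<^sup>2"
    using exp_bound[of "norm x"] assms by simp
  finally show ?thesis .
qed

lemma norm_exp_minus_one_le:
  fixes x :: "'a :: {real_normed_algebra_1, banach}"
  assumes "norm x \<le> 1"
  shows "norm (exp x - 1) \<le> 2 * norm x"
proof -
  have "norm (exp x - 1) \<le> (norm x)\<^sup>2 + norm x"
    using norm_triangle_ineq[of "exp x - 1 - x" x] norm_exp_remainder_le[OF assms] by simp
  also have "(norm x)\<^sup>2 \<le> norm x" using assms by (simp add: power2_eq_square mult_left_le)
  finally show ?thesis by simp
qed

lemma conjugate_exp_near:
  fixes k :: "'a :: star_banach"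
  assumes k: "adj k = - k" "norm k \<le> 1"
  shows "norm (p + k * p - p * k - conjugate (exp k) p) \<le> 6 * (norm k)\<^sup>2 * norm p"
proof -
  define v where "v = exp k"
  have adj_v: "adj v = exp (- k)" by (simp add: v_def adj_exp k(1))
  have remainder: "norm (v - 1 - k) \<le> (norm k)\<^sup>2" "norm (adj v - 1 + k) \<le> (norm k)\<^sup>2"
    using norm_exp_remainder_le[of k] norm_exp_remainder_le[of "- k"] k(2)
    by (simp_all add: v_def[symmetric] adj_v[symmetric])
  have norm_adj_v: "norm (adj v) \<le> 3"
    using norm_triangle_ineq[of "adj v - 1" 1] norm_exp_minus_one_le[of "- k"] k(2)
    by (simp add: adj_v[symmetric])
  have norm_one_plus_k: "norm (1 + k) \<le> 2" using norm_triangle_ineq[of 1 k] k(2) by simp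
  have "p + k * p - p * k - conjugate v p =
      k * p * k - (v - 1 - k) * p * adj v - (1 + k) * p * (adj v - 1 + k)"
    by (simp add: conjugate_def algebra_simps)
  also have "norm \<dots> \<le>
      norm (k * p * k) + norm ((v - 1 - k) * p * adj v) + norm ((1 + k) * p * (adj v - 1 + k))"
    by (meson add_mono norm_triangle_ineq4 order_refl order_trans)
  also have "\<dots> \<le> norm k * norm p * norm k + (norm k)\<^sup>2 * norm p * 3 + 2 * norm p * (norm k)\<^sup>2"
    by (intro add_mono order_trans[OF norm_mult3] mult_mono remainder norm_adj_v norm_one_plus_k
        order_refl) auto
  finally show ?thesis by (simp add: v_def power2_eq_square algebra_simps)
qed

lemma corrected_average_near_conjugate:
  assumes D: "star_subalgebra D" and S: "casimir_frame D S \<phi>"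
    and T: "near_inclusion D F \<eta> T" "hermitian_on D T"
    and \<eta>: "0 \<le> \<eta>" "\<eta> \<le> 1" "sum_norm_squares S * \<eta> \<le> 1" and a: "a \<in> D"
  defines "s \<equiv> sum_norm_squares S" and "k \<equiv> newton_direction S T"
  shows "norm (corrected_average S T a - conjugate (exp k) a) \<le> (5 * s + 6 * s\<^sup>2) * \<eta>\<^sup>2 * norm a"
proof -
  let ?f = "corrected_average S T a"
  have SD: "S \<subseteq> D" using frame_subset[OF casimir_frame_imp_frame[OF S]] by blast
  have norm_k: "norm k \<le> s * \<eta>"
    unfolding k_def s_def by (rule norm_newton_direction_le[OF D SD T(1) \<eta>(1)])
  then have "norm k \<le> 1" using \<eta>(3) by (simp add: s_def)
  have "norm (?f - conjugate (exp k) a)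
      \<le> norm (?f - (a + k * a - a * k)) + norm (a + k * a - a * k - conjugate (exp k) a)"
    using norm_triangle_ineq[of "?f - (a + k * a - a * k)"
        "a + k * a - a * k - conjugate (exp k) a"]
    by simp
  also have "\<dots> \<le> 5 * s * \<eta>\<^sup>2 * norm a + 6 * (s * \<eta>)\<^sup>2 * norm a"
  proof (rule add_mono)
    show "norm (?f - (a + k * a - a * k)) \<le> 5 * s * \<eta>\<^sup>2 * norm a"
      unfolding k_def s_def by (rule corrected_average_near[OF D S T \<eta>(1,2) a])
    have "6 * (norm k)\<^sup>2 * norm a \<le> 6 * (s * \<eta>)\<^sup>2 * norm a"
      using norm_k by (intro mult_right_mono mult_left_mono power_mono) simp_all
    then show "norm (a + k * a - a * k - conjugate (exp k) a) \<le> 6 * (s * \<eta>)\<^sup>2 * norm a"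
      using conjugate_exp_near[of k a] \<open>norm k \<le> 1\<close>
      by (simp add: k_def adj_newton_direction)
  qed
  also have "\<dots> = (5 * s + 6 * s\<^sup>2) * \<eta>\<^sup>2 * norm a" by (simp add: power_mult_distrib algebra_simps)
  finally show ?thesis .
qed

lemma newton_unitary:
  assumes D: "star_subalgebra D" and S: "casimir_frame D S \<phi>"
    and D\<^sub>0: "star_subalgebra D\<^sub>0" "D\<^sub>0 \<subseteq> D" and F: "star_subalgebra F"
    and T: "near_inclusion D F \<eta> T" "hermitian_on D T" "left_module_map D\<^sub>0 D T"
    and \<eta>: "0 \<le> \<eta>" "\<eta> \<le> 1" "sum_norm_squares S * \<eta> \<le> 1"
  defines "s \<equiv> sum_norm_squares S"
  obtains v where "is_unitary v" "centralizes D\<^sub>0 v" "norm (v - 1) \<le> 2 * (s * \<eta>)"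
    "\<And>a. a \<in> D \<Longrightarrow> \<exists>f\<in>F. norm (f - conjugate v a) \<le> (5 * s + 6 * s\<^sup>2) * \<eta>\<^sup>2 * norm a"
proof (rule that)
  define k where "k = newton_direction S T"
  have SD: "S \<subseteq> D" using frame_subset[OF casimir_frame_imp_frame[OF S]] by blast
  show "is_unitary (exp k)" unfolding k_def by (rule is_unitary_exp[OF adj_newton_direction])
  show "centralizes D\<^sub>0 (exp k)"
    unfolding k_def
    by (intro centralizes_exp
        newton_direction_centralizes[OF D S near_inclusion_clinear[OF T(1)] T(3) D\<^sub>0])
  have norm_k: "norm k \<le> s * \<eta>"
    unfolding k_def s_def by (rule norm_newton_direction_le[OF D SD T(1) \<eta>(1)])
  then have "norm k \<le> 1" using \<eta>(3) by (simp add: s_def)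
  then show "norm (exp k - 1) \<le> 2 * (s * \<eta>)" using norm_exp_minus_one_le[of k] norm_k by simp
  fix a assume a: "a \<in> D"
  have "corrected_average S T a \<in> F"
    using corrected_average_mem[OF D SD F near_inclusion_mem[OF T(1)] a] .
  then show "\<exists>f\<in>F. norm (f - conjugate (exp k) a) \<le> (5 * s + 6 * s\<^sup>2) * \<eta>\<^sup>2 * norm a"
    using corrected_average_near_conjugate[OF D S T(1,2) \<eta> a] unfolding k_def s_def by blast
qed

definition newton_constant :: "'a :: star_banach set \<Rightarrow> 'a set \<Rightarrow> real \<Rightarrow> bool" where
  "newton_constant D\<^sub>0 S M \<longleftrightarrow> 1 \<le> M \<and>
     (\<forall>F \<delta>. star_subalgebra F \<longrightarrow> D\<^sub>0 \<subseteq> F \<longrightarrow> approximates F S \<delta> \<longrightarrow> 0 \<le> \<delta> \<longrightarrow> M * \<delta> \<le> 1 \<longrightarrow>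
       (\<exists>v. is_unitary v \<and> centralizes D\<^sub>0 v \<and> norm (v - 1) \<le> M * \<delta> \<and>
         approximates F (conjugate v ` S) (M * \<delta>\<^sup>2)))"

lemma newton_constant_ge_1: "newton_constant D\<^sub>0 S M \<Longrightarrow> 1 \<le> M"
  by (simp add: newton_constant_def)

lemma newton_constant_step:
  assumes "newton_constant D\<^sub>0 S M" "star_subalgebra F" "D\<^sub>0 \<subseteq> F" "approximates F S \<delta>" "0 \<le> \<delta>"
      "M * \<delta> \<le> 1"
  obtains v where "is_unitary v" "centralizes D\<^sub>0 v" "norm (v - 1) \<le> M * \<delta>"
    "approximates F (conjugate v ` S) (M * \<delta>\<^sup>2)"
  using assms unfolding newton_constant_def by blast

lemma approximates_conjugate_relative:
  assumes S: "finite S" and c: "0 \<le> c"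
    and near: "\<And>p. p \<in> S \<Longrightarrow> \<exists>f\<in>F. norm (f - conjugate v p) \<le> c * norm p"
  shows "approximates F (conjugate v ` S) (c * (\<Sum>p\<in>S. norm p))"
proof (rule approximatesI, clarify)
  fix p assume p: "p \<in> S"
  have "norm p \<le> (\<Sum>p\<in>S. norm p)" using p S by (intro member_le_sum) auto
  then have "c * norm p \<le> c * (\<Sum>p\<in>S. norm p)" using c by (rule mult_left_mono)
  then show "\<exists>f\<in>F. norm (f - conjugate v p) \<le> c * (\<Sum>p\<in>S. norm p)"
    using near[OF p] order_trans by blast
qed

lemma newton_constant_exists:
  fixes D D\<^sub>0 :: "'a :: star_banach set"
  assumes D: "fd_star_subalgebra D" and S: "casimir_frame D S \<phi>"
    and D\<^sub>0: "fd_star_subalgebra D\<^sub>0" "D\<^sub>0 \<subseteq> D"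
  obtains M where "newton_constant D\<^sub>0 S M"
proof -
  note frame = casimir_frame_imp_frame[OF S]
  obtain m where m: "0 \<le> m" and near: "\<And>F \<delta>. star_subalgebra F \<Longrightarrow> D\<^sub>0 \<subseteq> F \<Longrightarrow> approximates F S \<delta> \<Longrightarrow>
      \<exists>T. near_inclusion D F (m * \<delta>) T \<and> hermitian_on D T \<and> left_module_map D\<^sub>0 D T"
    using near_inclusion_module_map_exists[OF D frame D\<^sub>0] by metis
  define s where "s = sum_norm_squares S"
  define b where "b = (\<Sum>p\<in>S. norm p)"
  have nonneg: "0 \<le> s" "0 \<le> b" by (simp_all add: s_def sum_norm_squares_nonneg b_def sum_nonneg)
  define M where "M = 1 + m + 2 * (s * m) + (5 * s + 6 * s\<^sup>2) * m\<^sup>2 * b"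
  have M: "1 \<le> M" "m \<le> M" "2 * (s * m) \<le> M" "(5 * s + 6 * s\<^sup>2) * m\<^sup>2 * b \<le> M"
    using m nonneg by (simp_all add: M_def add_increasing)
  have "\<exists>v. is_unitary v \<and> centralizes D\<^sub>0 v \<and> norm (v - 1) \<le> M * \<delta> \<and>
      approximates F (conjugate v ` S) (M * \<delta>\<^sup>2)"
    if F: "star_subalgebra F" "D\<^sub>0 \<subseteq> F" "approximates F S \<delta>" and \<delta>: "0 \<le> \<delta>" "M * \<delta> \<le> 1" for F \<delta>
  proof -
    have M\<delta>: "m * \<delta> \<le> M * \<delta>" "2 * (s * m) * \<delta> \<le> M * \<delta>"
      using M \<delta>(1) by (simp_all add: mult_right_mono)
    obtain T where T: "near_inclusion D F (m * \<delta>) T" "hermitian_on D T" "left_module_map D\<^sub>0 D T"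
      using near[OF F] by blast
    have "0 \<le> m * \<delta>" "m * \<delta> \<le> 1" "s * (m * \<delta>) \<le> 1"
      using m \<delta> M\<delta> nonneg by (auto simp: mult.assoc)
    then obtain v where v: "is_unitary v" "centralizes D\<^sub>0 v" "norm (v - 1) \<le> 2 * (s * (m * \<delta>))"
        and near_v: "\<And>a. a \<in> D \<Longrightarrow>
            \<exists>f\<in>F. norm (f - conjugate v a) \<le> (5 * s + 6 * s\<^sup>2) * (m * \<delta>)\<^sup>2 * norm a"
      using newton_unitary[OF star_subalgebra_of_fd[OF D] S star_subalgebra_of_fd[OF D\<^sub>0(1)] D\<^sub>0(2)
          F(1) T]
      unfolding s_def by blast
    have "approximates F (conjugate v ` S) ((5 * s + 6 * s\<^sup>2) * (m * \<delta>)\<^sup>2 * b)"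
      unfolding b_def using near_v frame_subset[OF frame] nonneg
      by (intro approximates_conjugate_relative frame_finite[OF frame]) simp_all
    moreover have "(5 * s + 6 * s\<^sup>2) * (m * \<delta>)\<^sup>2 * b \<le> M * \<delta>\<^sup>2"
      using mult_right_mono[OF M(4), of "\<delta>\<^sup>2"] by (simp add: power_mult_distrib mult_ac)
    ultimately have "approximates F (conjugate v ` S) (M * \<delta>\<^sup>2)"
      using approximates_mono by blast
    moreover have "norm (v - 1) \<le> M * \<delta>" using v(3) M\<delta>(2) by (simp add: mult.assoc)
    ultimately show ?thesis using v(1,2) by blast
  qed
  then show thesis using M(1) that[of M] unfolding newton_constant_def by blast
qed

subsection \<open>Newton iteration\<close>

lemma convergent_near_one:
  fixes w :: "nat \<Rightarrow> 'a :: {real_normed_algebra_1, banach}"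
  assumes w_0: "w 0 = 1" and step: "\<And>n. norm (w (Suc n) - w n) \<le> t * (1/2) ^ n * norm (w n)"
    and t: "0 \<le> t" "4 * t \<le> 1"
  obtains u where "w \<longlonglongrightarrow> u" "norm (u - 1) \<le> 4 * t" "\<And>n. norm (w n - 1) \<le> 4 * t"
proof -
  have increment: "norm (w (Suc n) - w n) \<le> 2 * t * (1/2) ^ n" if "norm (w n - 1) \<le> 4 * t" for n
  proof -
    have "norm (w n) \<le> 2" using that t(2) by (intro norm_near_one_le_2) simp
    then have "t * (1/2) ^ n * norm (w n) \<le> t * (1/2) ^ n * 2"
      using t(1) by (intro mult_left_mono) simp_all
    then show ?thesis using step[of n] by simp
  qed
  have "norm (w n - 1) \<le> 4 * t * (1 - (1/2) ^ n)" for n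
  proof (induction n)
    case (Suc n)
    have "4 * t * (1 - (1/2) ^ n) \<le> 4 * t" using t(1) by (intro mult_left_le) simp_all
    then have "norm (w (Suc n) - w n) \<le> 2 * t * (1/2) ^ n" using Suc by (intro increment) simp
    then have "norm (w (Suc n) - 1) \<le> 2 * t * (1/2) ^ n + 4 * t * (1 - (1/2) ^ n)"
      using Suc norm_triangle_ineq[of "w (Suc n) - w n" "w n - 1"] by simp
    then show ?case by (simp add: algebra_simps)
  qed (simp add: w_0)
  moreover have "4 * t * (1 - (1/2) ^ n) \<le> 4 * t" for n using t(1) by (intro mult_left_le) simp_all
  ultimately have near: "norm (w n - 1) \<le> 4 * t" for n by (rule order_trans)
  have "summable (\<lambda>n. w (Suc n) - w n)"
    by (rule summable_comparison_test'[where N=0 and g="\<lambda>n. 2 * t * (1/2) ^ n"])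
       (auto intro!: increment near summable_mult summable_geometric)
  then obtain s where "(\<lambda>n. \<Sum>i<n. w (Suc i) - w i) \<longlonglongrightarrow> s"
    by (auto simp: summable_iff_convergent convergent_def)
  then have "(\<lambda>n. (\<Sum>i<n. w (Suc i) - w i) + w 0) \<longlonglongrightarrow> s + w 0"
    by (intro tendsto_add tendsto_const)
  then have lim: "w \<longlonglongrightarrow> s + w 0" by (simp add: sum_lessThan_telescope)
  moreover have "norm (s + w 0 - 1) \<le> 4 * t"
    using near by (intro Lim_bounded[OF tendsto_norm[OF tendsto_diff[OF lim tendsto_const]]]) auto
  ultimately show thesis using near by (rule that)
qed

definition newton_iterate :: "'a :: star_banach set \<Rightarrow> 'a set \<Rightarrow> 'a set \<Rightarrow> real \<Rightarrow> 'a \<Rightarrow> bool" where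
  "newton_iterate D\<^sub>0 F S \<delta> w \<longleftrightarrow>
      is_unitary w \<and> centralizes D\<^sub>0 w \<and> approximates (conjugate (adj w) ` F) S \<delta>"

lemma newton_iterate_step:
  assumes M: "newton_constant D\<^sub>0 S M" and F: "star_subalgebra F" "D\<^sub>0 \<subseteq> F"
    and \<delta>: "0 \<le> \<delta>" "8 * M * \<delta> \<le> 1"
    and w: "newton_iterate D\<^sub>0 F S \<delta> w"
  shows "\<exists>w'. newton_iterate D\<^sub>0 F S (\<delta> / 2) w' \<and> norm (w' - w) \<le> M * \<delta> * norm w"
proof -
  let ?F = "conjugate (adj w) ` F"
  have unitary: "is_unitary w" and central: "centralizes D\<^sub>0 w" and near: "approximates ?F S \<delta>"
    using w by (simp_all add: newton_iterate_def)
  have "D\<^sub>0 \<subseteq> ?F"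
  proof
    fix d assume d: "d \<in> D\<^sub>0"
    have "conjugate (adj w) d = d"
      using conjugate_adj_cancel(1)[OF unitary, of d]
        conjugate_fixes_centralized[OF unitary central d]
      by simp
    then show "d \<in> ?F" using d F(2) by force
  qed
  moreover have "M * \<delta> \<le> 1" using \<delta> newton_constant_ge_1[OF M] by simp
  ultimately obtain v where v: "is_unitary v" "centralizes D\<^sub>0 v" "norm (v - 1) \<le> M * \<delta>"
      and near_v: "approximates ?F (conjugate v ` S) (M * \<delta>\<^sup>2)"
    using newton_constant_step[OF M star_subalgebra_conjugate[OF is_unitary_adj[OF unitary] F(1)]
        _ near \<delta>(1)]
    by blast
  have "norm (adj v) \<le> 2"
    using v(3) \<open>M * \<delta> \<le> 1\<close> by (simp add: norm_adj norm_near_one_le_2)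
  from approximates_conjugate[OF this near_v]
  have "approximates (conjugate (adj (w * v)) ` F) S (4 * (M * \<delta>\<^sup>2))"
    using v(1) by (simp add: image_image conjugate_conjugate conjugate_one adj_mult is_unitary_def)
  moreover have "4 * (M * \<delta>\<^sup>2) \<le> \<delta> / 2"
    using mult_right_mono[OF \<delta>(2,1)] by (simp add: power2_eq_square mult.assoc)
  ultimately have "newton_iterate D\<^sub>0 F S (\<delta> / 2) (w * v)"
    unfolding newton_iterate_def
    using approximates_mono is_unitary_mult[OF unitary v(1)] centralizes_mult[OF central v(2)]
    by blast
  moreover have "norm (w * v - w) \<le> M * \<delta> * norm w"
  proof -
    have "norm (w * (v - 1)) \<le> norm w * (M * \<delta>)"
      by (intro order_trans[OF norm_mult_ineq] mult_left_mono v(3) norm_ge_zero)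
    then show ?thesis by (simp add: algebra_simps)
  qed
  ultimately show ?thesis by blast
qed

lemma conjugate_limit_mem:
  fixes F :: "'a :: star_banach set"
  assumes F: "closed F" and w: "w \<longlonglongrightarrow> u" "\<And>n. is_unitary (w n)" "\<And>n. norm (w n) \<le> 2"
    and \<delta>: "\<delta> \<longlonglongrightarrow> 0" "\<And>n. approximates (conjugate (adj (w n)) ` F) S (\<delta> n)" and p: "p \<in> S"
  shows "conjugate u p \<in> F"
proof -
  have "\<exists>f\<in>F. norm (f - conjugate (w n) p) \<le> 4 * \<delta> n" for n
    using approximates_conjugate[OF w(3) \<delta>(2), of n n] p
    by (auto simp: approximates_def image_image conjugate_adj_cancel[OF w(2)[of n]])
  then obtain f where f: "\<And>n. f n \<in> F" "\<And>n. norm (f n - conjugate (w n) p) \<le> 4 * \<delta> n" by metis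
  have "(\<lambda>n. 4 * \<delta> n) \<longlonglongrightarrow> 0" using tendsto_mult_right_zero[OF \<delta>(1)] .
  then have "(\<lambda>n. f n - conjugate (w n) p) \<longlonglongrightarrow> 0"
    by (rule Lim_null_comparison[OF always_eventually[OF allI[OF f(2)]]])
  moreover have "(\<lambda>n. conjugate (w n) p) \<longlonglongrightarrow> conjugate u p"
    unfolding conjugate_def
    by (intro tendsto_mult tendsto_const w(1) bounded_linear.tendsto[OF bounded_linear_adj])
  ultimately have "f \<longlonglongrightarrow> conjugate u p" by (rule Lim_transform[rotated])
  then show ?thesis using closed_sequentially[OF F] f(1) by blast
qed

lemma newton_sequence_exists:
  assumes M: "newton_constant D\<^sub>0 S M" and F: "star_subalgebra F" "D\<^sub>0 \<subseteq> F"
    and near: "approximates F S \<delta>" and \<delta>: "0 \<le> \<delta>" "8 * M * \<delta> \<le> 1"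
  obtains w where "w 0 = 1" "\<And>n. newton_iterate D\<^sub>0 F S (\<delta> * (1/2) ^ n) (w n)"
    "\<And>n. norm (w (Suc n) - w n) \<le> (M * \<delta>) * (1/2) ^ n * norm (w n)"
proof -
  define d where "d n = \<delta> * (1/2) ^ n" for n :: nat
  have d: "0 \<le> d n" "8 * M * d n \<le> 1" for n
  proof -
    show "0 \<le> d n" using \<delta>(1) by (simp add: d_def)
    have "d n \<le> \<delta>" using \<delta>(1) by (simp add: d_def mult_left_le power_le_one)
    then have "8 * M * d n \<le> 8 * M * \<delta>"
      using newton_constant_ge_1[OF M] by (intro mult_left_mono) simp_all
    then show "8 * M * d n \<le> 1" using \<delta>(2) by simp
  qed
  have "\<exists>w. \<forall>n. (newton_iterate D\<^sub>0 F S (d n) (w n) \<and> (n = 0 \<longrightarrow> w n = 1)) \<and>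
      norm (w (Suc n) - w n) \<le> M * d n * norm (w n)"
  proof (rule dependent_nat_choice)
    show "\<exists>w. newton_iterate D\<^sub>0 F S (d 0) w \<and> (0 = (0 :: nat) \<longrightarrow> w = 1)"
      using near
      by (auto simp: newton_iterate_def is_unitary_one centralizes_one d_def conjugate_one)
    fix w n assume "newton_iterate D\<^sub>0 F S (d n) w \<and> (n = 0 \<longrightarrow> w = 1)"
    then show "\<exists>w'. (newton_iterate D\<^sub>0 F S (d (Suc n)) w' \<and> (Suc n = 0 \<longrightarrow> w' = 1)) \<and>
        norm (w' - w) \<le> M * d n * norm w"
      using newton_iterate_step[OF M F d[of n]] by (simp add: d_def)
  qed
  then obtain w where "\<And>n. newton_iterate D\<^sub>0 F S (d n) (w n)" "w 0 = 1"
      "\<And>n. norm (w (Suc n) - w n) \<le> M * d n * norm (w n)"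
    by metis
  then show thesis by (intro that[of w]) (simp_all add: d_def mult.assoc)
qed

lemma newton_limit_exists:
  fixes F :: "'a :: star_banach set"
  assumes M: "newton_constant D\<^sub>0 S M" and F: "star_subalgebra F" "closed F" "D\<^sub>0 \<subseteq> F"
    and near: "approximates F S \<delta>" and \<delta>: "0 \<le> \<delta>" "8 * M * \<delta> \<le> 1"
  obtains u where "is_unitary u" "norm (u - 1) \<le> 4 * (M * \<delta>)" "centralizes D\<^sub>0 u"
      "conjugate u ` S \<subseteq> F"
proof -
  obtain w where w: "w 0 = 1" "\<And>n. newton_iterate D\<^sub>0 F S (\<delta> * (1/2) ^ n) (w n)"
      and step: "\<And>n. norm (w (Suc n) - w n) \<le> (M * \<delta>) * (1/2) ^ n * norm (w n)"
    using newton_sequence_exists[OF M F(1,3) near \<delta>] by metis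
  have "0 \<le> M * \<delta>" "4 * (M * \<delta>) \<le> 1" using newton_constant_ge_1[OF M] \<delta> by simp_all
  then obtain u where u: "w \<longlonglongrightarrow> u" "norm (u - 1) \<le> 4 * (M * \<delta>)"
      and w_near: "\<And>n. norm (w n - 1) \<le> 4 * (M * \<delta>)"
    using convergent_near_one[of w, OF w(1) step] by metis
  have "norm (w n) \<le> 2" for n
    using w_near[of n] \<open>4 * (M * \<delta>) \<le> 1\<close> by (intro norm_near_one_le_2) linarith
  moreover have "(\<lambda>n. \<delta> * (1/2) ^ n) \<longlonglongrightarrow> 0"
    by (intro tendsto_mult_right_zero LIMSEQ_power_zero) simp
  moreover have iterate: "is_unitary (w n)" "centralizes D\<^sub>0 (w n)"
      "approximates (conjugate (adj (w n)) ` F) S (\<delta> * (1/2) ^ n)" for n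
    using w(2)[of n] by (simp_all add: newton_iterate_def)
  ultimately have "conjugate u ` S \<subseteq> F"
    using conjugate_limit_mem[OF F(2) u(1)] by blast
  then show thesis
    using that u(2) is_unitary_limit[OF u(1) iterate(1)] centralizes_limit[OF u(1) iterate(2)]
    by blast
qed

lemma conjugate_frame_subset:
  assumes S: "frame D S \<phi>" and F: "star_subalgebra F" and mem: "conjugate u ` S \<subseteq> F"
  shows "conjugate u ` D \<subseteq> F"
proof
  fix y assume "y \<in> conjugate u ` D"
  then obtain a where a: "a \<in> D" "y = conjugate u a" by blast
  have "y = (\<Sum>p\<in>S. \<phi> p a *\<^sub>C conjugate u p)"
    unfolding a(2) by (subst frame_expansion[OF S a(1), symmetric])
       (simp add: conjugate_def sum_distrib_left sum_distrib_right star_simps)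
  also have "\<dots> \<in> F" using mem by (intro star_subalgebra_closed[OF F]) blast
  finally show "y \<in> F" .
qed

theorem unitary_perturbation:
  fixes D D\<^sub>0 :: "'a :: star_banach set"
  assumes D: "fd_star_subalgebra D" and D\<^sub>0: "fd_star_subalgebra D\<^sub>0" "D\<^sub>0 \<subseteq> D" and \<epsilon>: "0 < \<epsilon>"
  obtains S \<delta> where "finite S" "0 < \<delta>"
    "\<And>F. fd_star_subalgebra F \<Longrightarrow> D\<^sub>0 \<subseteq> F \<Longrightarrow> approximates F S \<delta> \<Longrightarrow>
      \<exists>u. is_unitary u \<and> norm (u - 1) < \<epsilon> \<and> centralizes D\<^sub>0 u \<and> conjugate u ` D \<subseteq> F"
proof -
  obtain S \<phi> where S: "casimir_frame D S \<phi>" by (rule casimir_frame_exists[OF D])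
  note frame = casimir_frame_imp_frame[OF S]
  obtain M where newton: "newton_constant D\<^sub>0 S M" by (rule newton_constant_exists[OF D S D\<^sub>0])
  define \<delta> where "\<delta> = min (1 / (8 * M)) (\<epsilon> / (8 * M))"
  have \<delta>: "0 < \<delta>" "8 * M * \<delta> \<le> 1" "8 * M * \<delta> \<le> \<epsilon>"
    using newton_constant_ge_1[OF newton] \<epsilon> by (auto simp: \<delta>_def min_def field_simps)
  show thesis
  proof (rule that[OF frame_finite[OF frame] \<delta>(1)])
    fix F assume F: "fd_star_subalgebra F" "D\<^sub>0 \<subseteq> F" and near: "approximates F S \<delta>"
    note subF = star_subalgebra_of_fd[OF F(1)]
    obtain u where u: "is_unitary u" "norm (u - 1) \<le> 4 * (M * \<delta>)" "centralizes D\<^sub>0 u"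
        "conjugate u ` S \<subseteq> F"
      by (rule newton_limit_exists[OF newton subF closed_fd_star_subalgebra[OF F(1)] F(2) near
            less_imp_le[OF \<delta>(1)] \<delta>(2)])
    moreover have "norm (u - 1) < \<epsilon>" using u(2) \<delta>(3) \<epsilon> by simp
    ultimately show "\<exists>u. is_unitary u \<and> norm (u - 1) < \<epsilon> \<and> centralizes D\<^sub>0 u \<and> conjugate u ` D \<subseteq> F"
      using conjugate_frame_subset[OF frame subF] by blast
  qed
qed

section \<open>Directed families in density at most aleph 1\<close>

definition locally_fd :: "'a :: star_banach itself \<Rightarrow> bool" where
  "locally_fd _ \<longleftrightarrow> (\<forall>(X :: 'a set) \<epsilon>. finite X \<longrightarrow> 0 < \<epsilon> \<longrightarrow>
      (\<exists>G. fd_star_subalgebra G \<and> approximates G X \<epsilon>))"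

lemma fd_star_subalgebra_scalars: "fd_star_subalgebra (cvs.span {1 :: 'a :: star_banach})"
proof -
  have "star_subalgebra (cvs.span {1 :: 'a})"
    unfolding star_subalgebra_def
  proof (intro conjI ballI)
    show "x * y \<in> cvs.span {1}" if "x \<in> cvs.span {1}" "y \<in> cvs.span {1}" for x y :: 'a
      using that by (auto simp: cvs.span_singleton star_simps scaleC_scaleC)
    show "adj x \<in> cvs.span {1}" if "x \<in> cvs.span {1}" for x :: 'a
      using that by (auto simp: cvs.span_singleton star_simps)
  qed (auto intro: cvs.span_base)
  then show ?thesis unfolding fd_star_subalgebra_def by blast
qed

lemma scalars_subset: "star_subalgebra F \<Longrightarrow> cvs.span {1} \<subseteq> F"
  by (rule cvs.span_minimal) (auto simp: star_subalgebra_def)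

lemma small_multiplier_exists:
  fixes X :: "'a :: real_normed_vector set"
  assumes X: "finite X" and \<epsilon>: "0 < \<epsilon>"
  obtains t :: real where "0 < t" "t \<le> 1" "\<And>x. x \<in> X \<Longrightarrow> t * norm x \<le> \<epsilon>"
proof -
  define b where "b = (\<Sum>x\<in>X. norm x)"
  have b: "0 \<le> b" by (simp add: b_def sum_nonneg)
  define t where "t = min 1 (\<epsilon> / (b + 1))"
  have t: "0 < t" using \<epsilon> b by (simp add: t_def)
  have "t * norm x \<le> \<epsilon>" if "x \<in> X" for x
  proof -
    have "norm x \<le> b" unfolding b_def using that X by (intro member_le_sum) auto
    then have "t * norm x \<le> t * (b + 1)" using t by (intro mult_left_mono) simp_all
    also have "\<dots> \<le> \<epsilon> / (b + 1) * (b + 1)" using b by (intro mult_right_mono) (simp_all add: t_def)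
    also have "\<dots> = \<epsilon>" using b by simp
    finally show ?thesis .
  qed
  then show thesis using that[of t] t by (simp add: t_def)
qed

lemma superalgebra_approximates:
  fixes D :: "'a :: star_banach set"
  assumes LF: "locally_fd TYPE('a)" and D: "fd_star_subalgebra D" and X: "finite X" and \<epsilon>: "0 < \<epsilon>"
  obtains H where "fd_star_subalgebra H" "D \<subseteq> H" "approximates H X \<epsilon>"
proof -
  have "0 < \<epsilon> / 6" using \<epsilon> by simp
  then obtain t where t: "0 < t" "t \<le> 1" and t_small: "\<And>x. x \<in> X \<Longrightarrow> t * norm x \<le> \<epsilon> / 6"
    using small_multiplier_exists[OF X] by metis
  obtain S \<delta> where S: "finite S" "0 < \<delta>"
      and perturb: "\<And>G. fd_star_subalgebra G \<Longrightarrow> cvs.span {1} \<subseteq> G \<Longrightarrow> approximates G S \<delta> \<Longrightarrow>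
        \<exists>u. is_unitary u \<and> norm (u - 1) < t \<and> centralizes (cvs.span {1}) u \<and> conjugate u ` D \<subseteq> G"
    using unitary_perturbation[OF D fd_star_subalgebra_scalars
        scalars_subset[OF star_subalgebra_of_fd[OF D]] t(1)]
    by blast
  obtain G where G: "fd_star_subalgebra G" "approximates G (S \<union> X) (min \<delta> (\<epsilon> / 8))"
    using LF[unfolded locally_fd_def, rule_format, of "S \<union> X" "min \<delta> (\<epsilon> / 8)"] S X \<epsilon> by auto
  obtain u where u: "is_unitary u" "norm (u - 1) < t" "conjugate u ` D \<subseteq> G"
    using perturb[OF G(1) scalars_subset[OF star_subalgebra_of_fd[OF G(1)]]]
      approximates_mono[OF G(2)]
    by auto
  show thesis
  proof (rule that)
    show "fd_star_subalgebra (conjugate (adj u) ` G)"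
      by (rule fd_star_subalgebra_conjugate[OF is_unitary_adj[OF u(1)] G(1)])
    show "D \<subseteq> conjugate (adj u) ` G"
      using u(3) conjugate_adj_cancel(1)[OF u(1)] by (metis image_subset_iff imageI subsetI)
    show "approximates (conjugate (adj u) ` G) X \<epsilon>"
    proof (rule approximatesI)
      fix x assume x: "x \<in> X"
      obtain g where g: "g \<in> G" "norm (g - x) \<le> \<epsilon> / 8"
        using approximatesE[OF G(2), of x] x by auto
      have "norm (conjugate (adj u) g - x) \<le> 4 * norm (g - x) + 3 * t * norm x"
        using u(2) t(2) by (intro norm_conjugate_near_le) (simp_all add: norm_adj_diff_one)
      also have "\<dots> \<le> \<epsilon>" using g(2) t_small[OF x] by (simp add: mult.assoc)
      finally show "\<exists>f\<in>conjugate (adj u) ` G. norm (f - x) \<le> \<epsilon>" using g(1) by blast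
    qed
  qed
qed

lemma extend_fd_subalgebra:
  fixes D D\<^sub>0 F :: "'a :: star_banach set"
  assumes LF: "locally_fd TYPE('a)" and D: "fd_star_subalgebra D" "D\<^sub>0 \<subseteq> D"
    and F: "fd_star_subalgebra F" "D\<^sub>0 \<subseteq> F" and D\<^sub>0: "fd_star_subalgebra D\<^sub>0" and X: "finite X"
    and \<epsilon>: "0 < \<epsilon>"
  obtains u H where "is_unitary u" "norm (u - 1) < \<epsilon>" "centralizes D\<^sub>0 u"
    "fd_star_subalgebra H" "D \<subseteq> H" "conjugate u ` F \<subseteq> H" "approximates H X \<epsilon>"
proof -
  obtain S \<delta> where S: "finite S" "0 < \<delta>"
      and perturb: "\<And>H. fd_star_subalgebra H \<Longrightarrow> D\<^sub>0 \<subseteq> H \<Longrightarrow> approximates H S \<delta> \<Longrightarrow>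
        \<exists>u. is_unitary u \<and> norm (u - 1) < \<epsilon> \<and> centralizes D\<^sub>0 u \<and> conjugate u ` F \<subseteq> H"
    using unitary_perturbation[OF F(1) D\<^sub>0 F(2) \<epsilon>] by blast
  obtain H where H: "fd_star_subalgebra H" "D \<subseteq> H" "approximates H (S \<union> X) (min \<delta> \<epsilon>)"
    using superalgebra_approximates[OF LF D(1), of "S \<union> X" "min \<delta> \<epsilon>"] S X \<epsilon> by auto
  have near: "approximates H S \<delta>" "approximates H X \<epsilon>"
    by (rule approximates_mono[OF H(3)]; simp)+
  then obtain u where "is_unitary u" "norm (u - 1) < \<epsilon>" "centralizes D\<^sub>0 u" "conjugate u ` F \<subseteq> H"
    using perturb[OF H(1)] D(2) H(2) by blast
  then show thesis using that H(1,2) near(2) by blast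
qed

primrec tail_product :: "(nat \<Rightarrow> 'a :: monoid_mult) \<Rightarrow> nat \<Rightarrow> nat \<Rightarrow> 'a" where
  "tail_product u n 0 = 1"
| "tail_product u n (Suc j) = u (n + j) * tail_product u n j"

lemma tail_product_shift: "tail_product u n (Suc j) = tail_product u (Suc n) j * u n"
  by (induction j) (simp_all add: mult.assoc)

lemma is_unitary_tail_product: "(\<And>n. is_unitary (u n)) \<Longrightarrow> is_unitary (tail_product u n j)"
  by (induction j) (simp_all add: is_unitary_one is_unitary_mult)

lemma centralizes_tail_product:
  "(\<And>j. centralizes D (u (n + j))) \<Longrightarrow> centralizes D (tail_product u n j)"
  by (induction j) (simp_all add: centralizes_one centralizes_mult)

lemma tail_product_convergent:
  fixes u :: "nat \<Rightarrow> 'a :: {real_normed_algebra_1, banach}"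
  assumes u: "\<And>n. norm (u n - 1) \<le> (1/2) ^ (n + 3)"
  shows "\<exists>w. tail_product u n \<longlonglongrightarrow> w \<and> norm (w - 1) \<le> (1/2) ^ (n + 1)"
proof -
  define t :: real where "t = (1/2) ^ (n + 3)"
  have t: "0 \<le> t" "4 * t = (1/2) ^ (n + 1)" by (simp_all add: t_def power_add power3_eq_cube)
  have step: "norm (tail_product u n (Suc j) - tail_product u n j)
      \<le> t * (1/2) ^ j * norm (tail_product u n j)" for j
  proof -
    have "tail_product u n (Suc j) - tail_product u n j = (u (n + j) - 1) * tail_product u n j"
      by (simp add: algebra_simps)
    also have "norm \<dots> \<le> (1/2) ^ (n + j + 3) * norm (tail_product u n j)"
      by (intro order_trans[OF norm_mult_ineq] mult_right_mono u norm_ge_zero)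
    finally show ?thesis by (simp add: t_def power_add mult_ac)
  qed
  have "4 * t \<le> 1" unfolding t(2) by (rule power_le_one) simp_all
  then obtain w where "tail_product u n \<longlonglongrightarrow> w" "norm (w - 1) \<le> 4 * t"
    using convergent_near_one[of "tail_product u n", OF tail_product.simps(1) step t(1)] by metis
  then show ?thesis unfolding t(2) by blast
qed

lemma unitary_tail_products:
  fixes u :: "nat \<Rightarrow> 'a :: star_banach"
  assumes u: "\<And>n. is_unitary (u n)" and near: "\<And>n. norm (u n - 1) \<le> (1/2) ^ (n + 3)"
    and central: "\<And>n j. centralizes (D n) (u (n + j))"
  obtains w where "\<And>n. is_unitary (w n)" "\<And>n. w n = w (Suc n) * u n"
    "\<And>n. norm (w n - 1) \<le> (1/2) ^ (n + 1)" "\<And>n. centralizes (D n) (w n)"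
proof -
  obtain w where lim: "\<And>n. tail_product u n \<longlonglongrightarrow> w n"
      and w_near: "\<And>n. norm (w n - 1) \<le> (1/2) ^ (n + 1)"
    using tail_product_convergent[OF near] by metis
  have "w n = w (Suc n) * u n" for n
  proof (rule LIMSEQ_unique)
    show "(\<lambda>j. tail_product u n (Suc j)) \<longlonglongrightarrow> w n" using LIMSEQ_Suc[OF lim] .
    show "(\<lambda>j. tail_product u n (Suc j)) \<longlonglongrightarrow> w (Suc n) * u n"
      unfolding tail_product_shift by (intro tendsto_mult tendsto_const lim)
  qed
  moreover have "is_unitary (w n)" for n
    by (rule is_unitary_limit[OF lim is_unitary_tail_product[OF u]])
  moreover have "centralizes (D n) (w n)" for n
    using centralizes_limit[OF lim centralizes_tail_product] central by blast
  ultimately show thesis using that w_near by blast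
qed

lemma conjugated_tower_dense:
  fixes F :: "nat \<Rightarrow> 'a :: star_banach set"
  assumes w: "\<And>n. norm (w n - 1) \<le> (1/2) ^ (n + 1)"
    and near: "\<And>n. i \<le> n \<Longrightarrow> approximates (F (Suc n)) {x} ((1/2) ^ (n + 3))"
  shows "x \<in> closure (\<Union>n. conjugate (w n) ` F n)"
  unfolding closure_approachable
proof (intro allI impI)
  fix e :: real assume "0 < e"
  define c where "c = 1 + norm x"
  have "(\<lambda>n. c * (1/2) ^ n) \<longlonglongrightarrow> 0" by (intro tendsto_mult_right_zero LIMSEQ_power_zero) simp
  then have "\<forall>\<^sub>F n in sequentially. c * (1/2) ^ n < e" using \<open>0 < e\<close> by (rule order_tendstoD)
  then obtain n where n: "i \<le> n" "c * (1/2) ^ n < e"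
    using eventually_happens'[OF sequentially_bot eventually_conj[OF eventually_ge_at_top]] by blast
  obtain g where g: "g \<in> F (Suc n)" "norm (g - x) \<le> (1/2) ^ (n + 3)"
    using near[OF n(1)] by (auto simp: approximates_def)
  have "norm (w (Suc n) - 1) \<le> (1/2) ^ (n + 2)" using w[of "Suc n"] by simp
  moreover have "(1/2 :: real) ^ (n + 2) \<le> 1" by (rule power_le_one) simp_all
  ultimately have "norm (conjugate (w (Suc n)) g - x)
      \<le> 4 * norm (g - x) + 3 * (1/2) ^ (n + 2) * norm x"
    by (rule norm_conjugate_near_le)
  also have "\<dots> \<le> (1/2) ^ n + (1/2) ^ n * norm x"
  proof (rule add_mono)
    have "8 * norm (g - x) \<le> (1/2) ^ n" using g(2) by (simp add: power_add power3_eq_cube)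
    then show "4 * norm (g - x) \<le> (1/2) ^ n" using norm_ge_zero[of "g - x"] by linarith
  qed (simp add: mult_right_mono)
  also have "\<dots> < e" using n(2) by (simp add: c_def algebra_simps)
  finally have "dist (conjugate (w (Suc n)) g) x < e" by (simp add: dist_norm)
  then show "\<exists>y\<in>\<Union>n. conjugate (w n) ` F n. dist y x < e" using g(1) by blast
qed

definition perturbed_inclusion :: "'a :: star_banach set \<Rightarrow> real \<Rightarrow> 'a set \<Rightarrow> 'a set \<Rightarrow> 'a \<Rightarrow> bool" where
  "perturbed_inclusion D \<epsilon> F F' u \<longleftrightarrow>
     is_unitary u \<and> norm (u - 1) \<le> \<epsilon> \<and> centralizes D u \<and> conjugate u ` F \<subseteq> F'"

lemma perturbed_tower_exists:
  fixes D :: "nat \<Rightarrow> 'a :: star_banach set" and x :: "nat \<Rightarrow> 'a"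
  assumes LF: "locally_fd TYPE('a)"
    and D: "\<And>n. fd_star_subalgebra (D n)" and incr: "\<And>n. D n \<subseteq> D (Suc n)"
  obtains F u where "\<And>n. fd_star_subalgebra (F n)" "\<And>n. D n \<subseteq> F n"
    "\<And>n. perturbed_inclusion (D n) ((1/2) ^ (n + 3)) (F n) (F (Suc n)) (u n)"
    "\<And>n. approximates (F (Suc n)) (x ` {..n}) ((1/2) ^ (n + 3))"
proof -
  have "\<exists>F. \<forall>n. (fd_star_subalgebra (F n) \<and> D n \<subseteq> F n) \<and>
      ((\<exists>u. perturbed_inclusion (D n) ((1/2) ^ (n + 3)) (F n) (F (Suc n)) u) \<and>
        approximates (F (Suc n)) (x ` {..n}) ((1/2) ^ (n + 3)))"
  proof (rule dependent_nat_choice)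
    show "\<exists>F. fd_star_subalgebra F \<and> D 0 \<subseteq> F" using D by blast
    fix F n assume F: "fd_star_subalgebra F \<and> D n \<subseteq> F"
    obtain u H where "is_unitary u" "norm (u - 1) < (1/2) ^ (n + 3)" "centralizes (D n) u"
        "fd_star_subalgebra H"
        "D (Suc n) \<subseteq> H" "conjugate u ` F \<subseteq> H" "approximates H (x ` {..n}) ((1/2) ^ (n + 3))"
      by (rule extend_fd_subalgebra[OF LF D[of "Suc n"] incr[of n] conjunct1[OF F] conjunct2[OF F]
            D[of n], of "x ` {..n}" "(1/2) ^ (n + 3)"]) simp_all
    then show "\<exists>F'. (fd_star_subalgebra F' \<and> D (Suc n) \<subseteq> F') \<and>
        ((\<exists>u. perturbed_inclusion (D n) ((1/2) ^ (n + 3)) F F' u) \<and>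
          approximates F' (x ` {..n}) ((1/2) ^ (n + 3)))"
      unfolding perturbed_inclusion_def using less_imp_le by blast
  qed
  then obtain F where "\<And>n. fd_star_subalgebra (F n)" "\<And>n. D n \<subseteq> F n"
      "\<And>n. approximates (F (Suc n)) (x ` {..n}) ((1/2) ^ (n + 3))"
      and "\<forall>n. \<exists>u. perturbed_inclusion (D n) ((1/2) ^ (n + 3)) (F n) (F (Suc n)) u"
    by blast
  then show thesis using that by metis
qed

theorem extend_tower:
  fixes D :: "nat \<Rightarrow> 'a :: star_banach set" and x :: "nat \<Rightarrow> 'a"
  assumes LF: "locally_fd TYPE('a)"
    and D: "\<And>n. fd_star_subalgebra (D n)" and incr: "\<And>n. D n \<subseteq> D (Suc n)"
  obtains E where "\<And>n. fd_star_subalgebra (E n)" "\<And>n. E n \<subseteq> E (Suc n)" "\<And>n. D n \<subseteq> E n"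
    "\<And>i. x i \<in> closure (\<Union>n. E n)"
proof -
  obtain F u where F: "\<And>n. fd_star_subalgebra (F n)" "\<And>n. D n \<subseteq> F n"
      and perturbed: "\<And>n. perturbed_inclusion (D n) ((1/2) ^ (n + 3)) (F n) (F (Suc n)) (u n)"
      and near: "\<And>n. approximates (F (Suc n)) (x ` {..n}) ((1/2) ^ (n + 3))"
    using perturbed_tower_exists[where D=D and x=x, OF LF D incr] by blast
  have u: "is_unitary (u n)" "norm (u n - 1) \<le> (1/2) ^ (n + 3)" "conjugate (u n) ` F n \<subseteq> F (Suc n)"
      for n
    using perturbed[of n] by (simp_all add: perturbed_inclusion_def)
  have mono: "D n \<subseteq> D (n + j)" for n j by (induction j) (use incr in auto)
  have "centralizes (D n) (u (n + j))" for n j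
    using perturbed[of "n + j"] mono[of n j] by (auto simp: perturbed_inclusion_def centralizes_def)
  with u(1,2) obtain w where w: "\<And>n. is_unitary (w n)" "\<And>n. w n = w (Suc n) * u n"
      "\<And>n. norm (w n - 1) \<le> (1/2) ^ (n + 1)" "\<And>n. centralizes (D n) (w n)"
    using unitary_tail_products[of u D] by metis
  define E where "E n = conjugate (w n) ` F n" for n
  show thesis
  proof (rule that[of E])
    show "fd_star_subalgebra (E n)" for n
      unfolding E_def by (rule fd_star_subalgebra_conjugate[OF w(1) F(1)])
    show "E n \<subseteq> E (Suc n)" for n
    proof -
      have "E n = conjugate (w (Suc n)) ` conjugate (u n) ` F n"
        by (simp add: E_def w(2)[of n] image_image conjugate_conjugate)
      then show ?thesis using u(3)[of n] by (auto simp: E_def)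
    qed
    show "D n \<subseteq> E n" for n
      using F(2)[of n] conjugate_fixes_centralized[OF w(1,4)] by (force simp: E_def)
    show "x i \<in> closure (\<Union>n. E n)" for i
      unfolding E_def
    proof (rule conjugated_tower_dense[OF w(3)])
      show "approximates (F (Suc n)) {x i} ((1/2) ^ (n + 3))" if "i \<le> n" for n
        using near[of n] that by (auto intro: approximates_mono)
    qed
  qed
qed

definition directed_fd :: "'a :: star_banach set set \<Rightarrow> bool" where
  "directed_fd \<C> \<longleftrightarrow> \<C> \<noteq> {} \<and> (\<forall>D\<in>\<C>. fd_star_subalgebra D) \<and>
      (\<forall>D\<^sub>1\<in>\<C>. \<forall>D\<^sub>2\<in>\<C>. \<exists>D\<^sub>3\<in>\<C>. D\<^sub>1 \<union> D\<^sub>2 \<subseteq> D\<^sub>3)"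

lemma directed_fd_cofinal_tower:
  assumes C: "directed_fd \<C>" and countable: "countable \<C>"
  obtains D where "\<And>n. D n \<in> \<C>" "\<And>n. D n \<subseteq> D (Suc n)" "\<And>X. X \<in> \<C> \<Longrightarrow> \<exists>n. X \<subseteq> D n"
proof -
  have nonempty: "\<C> \<noteq> {}" using C by (simp add: directed_fd_def)
  have "\<exists>D. \<forall>n. D n \<in> \<C> \<and> (D n \<union> from_nat_into \<C> n \<subseteq> D (Suc n))"
  proof (rule dependent_nat_choice)
    show "\<exists>D. D \<in> \<C>" using nonempty by blast
    show "\<exists>D'. D' \<in> \<C> \<and> D \<union> from_nat_into \<C> n \<subseteq> D'" if "D \<in> \<C>" for D n
      using that from_nat_into[OF nonempty, of n] C unfolding directed_fd_def by blast
  qed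
  then obtain D where D: "\<And>n. D n \<in> \<C>" "\<And>n. D n \<union> from_nat_into \<C> n \<subseteq> D (Suc n)" by blast
  show thesis
  proof (rule that[of D])
    show "\<exists>n. X \<subseteq> D n" if "X \<in> \<C>" for X
      using D(2) from_nat_into_surj[OF countable that] by blast
  qed (use D in auto)
qed

lemma extend_countable_directed_fd:
  fixes \<C> :: "'a :: star_banach set set"
  assumes LF: "locally_fd TYPE('a)" and C: "directed_fd \<C>" and countable: "countable \<C>"
  shows "\<exists>\<C>'. directed_fd \<C>' \<and> countable \<C>' \<and> \<C> \<subseteq> \<C>' \<and> x \<in> closure (\<Union>\<C>')"
proof -
  obtain D where D: "\<And>n. D n \<in> \<C>" "\<And>n. D n \<subseteq> D (Suc n)" and cofinal: "\<And>X. X \<in> \<C> \<Longrightarrow> \<exists>n. X \<subseteq> D n"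
    using directed_fd_cofinal_tower[OF C countable] by blast
  have fd: "fd_star_subalgebra (D n)" for n using D(1) C by (auto simp: directed_fd_def)
  obtain E where E: "\<And>n. fd_star_subalgebra (E n)" "\<And>n. E n \<subseteq> E (Suc n)" "\<And>n. D n \<subseteq> E n"
      and dense: "\<And>i::nat. x \<in> closure (\<Union>n. E n)"
    using extend_tower[where D=D and x="\<lambda>_. x", OF LF fd D(2)] by blast
  have mono: "E m \<subseteq> E n" if "m \<le> n" for m n using that E(2) by (rule lift_Suc_mono_le[rotated])
  have below: "\<exists>n. X \<subseteq> E n" if "X \<in> \<C> \<union> range E" for X
    using that cofinal E(3) by blast
  have "directed_fd (\<C> \<union> range E)"
    unfolding directed_fd_def
  proof (intro conjI ballI)
    show "\<C> \<union> range E \<noteq> {}" by blast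
    show "fd_star_subalgebra X" if "X \<in> \<C> \<union> range E" for X
      using that E(1) C by (auto simp: directed_fd_def)
    fix D\<^sub>1 D\<^sub>2 assume "D\<^sub>1 \<in> \<C> \<union> range E" "D\<^sub>2 \<in> \<C> \<union> range E"
    then obtain m n where "D\<^sub>1 \<subseteq> E m" "D\<^sub>2 \<subseteq> E n" using below by meson
    then have "D\<^sub>1 \<union> D\<^sub>2 \<subseteq> E (max m n)" using mono[of m "max m n"] mono[of n "max m n"] by auto
    then show "\<exists>D\<^sub>3\<in>\<C> \<union> range E. D\<^sub>1 \<union> D\<^sub>2 \<subseteq> D\<^sub>3" by blast
  qed
  moreover have "x \<in> closure (\<Union>(\<C> \<union> range E))"
    using dense closure_mono[of "\<Union>n. E n" "\<Union>(\<C> \<union> range E)"] by auto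
  ultimately show ?thesis using countable by (intro exI[of _ "\<C> \<union> range E"]) auto
qed

lemma directed_fd_Union_chain:
  assumes directed: "\<And>t. t \<in> I \<Longrightarrow> directed_fd (C t)"
    and chain: "\<And>s t. s \<in> I \<Longrightarrow> t \<in> I \<Longrightarrow> C s \<subseteq> C t \<or> C t \<subseteq> C s"
  shows "directed_fd (insert (cvs.span {1}) (\<Union>t\<in>I. C t))" (is "directed_fd ?U")
  unfolding directed_fd_def
proof (intro conjI ballI)
  show "?U \<noteq> {}" by blast
  show fd: "fd_star_subalgebra X" if "X \<in> ?U" for X
    using that directed fd_star_subalgebra_scalars by (auto simp: directed_fd_def)
  fix D\<^sub>1 D\<^sub>2 assume D: "D\<^sub>1 \<in> ?U" "D\<^sub>2 \<in> ?U"
  have scalars: "cvs.span {1} \<subseteq> X" if "X \<in> ?U" for X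
    using scalars_subset[OF star_subalgebra_of_fd[OF fd[OF that]]] .
  consider (left) "D\<^sub>1 = cvs.span {1}" | (right) "D\<^sub>2 = cvs.span {1}"
    | (both) s t where "s \<in> I" "t \<in> I" "D\<^sub>1 \<in> C s" "D\<^sub>2 \<in> C t"
    using D by blast
  then show "\<exists>D\<^sub>3\<in>?U. D\<^sub>1 \<union> D\<^sub>2 \<subseteq> D\<^sub>3"
  proof cases
    case (both s t)
    then obtain r where "r \<in> I" "D\<^sub>1 \<in> C r" "D\<^sub>2 \<in> C r" using chain[of s t] by blast
    then show ?thesis using directed[of r] unfolding directed_fd_def by blast
  qed (use scalars D in blast)+
qed

lemma countable_underS_aleph1:
  assumes "(card_of S, aleph1) \<in> ordLeq" "s \<in> S"
  shows "countable (underS (card_of S) s)"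
proof -
  have "(card_of (underS (card_of S) s), card_of S) \<in> ordLess"
    using card_of_underS[OF card_of_Card_order, of s S] assms(2) by (simp add: Field_card_of)
  then have "(card_of (underS (card_of S) s), aleph1) \<in> ordLess"
    using assms(1) ordLess_ordLeq_trans by blast
  then have "(card_of (underS (card_of S) s), natLeq) \<in> ordLeq"
    by (simp add: cardSuc_ordLeq_ordLess[OF natLeq_Card_order card_of_Card_order])
  then show ?thesis
    by (metis card_of_ordLeq card_of_nat countable_def ordIso_symmetric ordLeq_ordIso_trans)
qed

theorem directed_fd_dense_exists:
  fixes S :: "'a :: star_banach set"
  assumes LF: "locally_fd TYPE('a)" and dense: "closure S = UNIV"
    and card: "(card_of S, aleph1) \<in> ordLeq"
  obtains \<D> :: "'a set set" where "directed_fd \<D>" "closure (\<Union>\<D>) = UNIV"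
proof -
  define r where "r = card_of S"
  have r: "Well_order r" "Field r = S" by (simp_all add: r_def card_of_well_order_on Field_card_of)
  define good where "good C s \<C> \<longleftrightarrow> (s \<in> S \<longrightarrow> directed_fd \<C> \<and> countable \<C> \<and> s \<in> closure (\<Union>\<C>) \<and>
      (\<forall>t\<in>underS r s. C t \<subseteq> \<C>))" for C s and \<C> :: "'a set set"
  have comparable: "s = t \<or> s \<in> underS r t \<or> t \<in> underS r s" if "s \<in> S" "t \<in> S" for s t
    using that r by (auto simp: order_on_defs total_on_def underS_def)
  have underS: "underS r s \<subseteq> S" for s using r(2) by (auto simp: underS_def Field_def)
  have chain: "C s \<subseteq> C t \<or> C t \<subseteq> C s" if "s \<in> S" "t \<in> S" "good C s (C s)" "good C t (C t)" for C s t
    using that comparable[of s t] by (auto simp: good_def)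
  have "\<exists>C. \<forall>s. good C s (C s)"
  proof (rule dependent_wf_choice)
    show "wf (r - Id)" using r(1) by (simp add: well_order_on_def)
    show "good f s \<C> = good g s \<C>" if "\<And>t. (t, s) \<in> r - Id \<Longrightarrow> f t = g t" for f g s \<C>
      using that by (auto simp: good_def underS_def)
    fix s C assume "\<And>t. (t, s) \<in> r - Id \<Longrightarrow> good C t (C t)"
    then have IH: "t \<in> S \<and> good C t (C t)" if "t \<in> underS r s" for t
      using that underS by (auto simp: underS_def)
    let ?U = "insert (cvs.span {1}) (\<Union>t\<in>underS r s. C t)"
    have "directed_fd ?U"
      using IH chain by (intro directed_fd_Union_chain) (auto simp: good_def)
    moreover have "countable ?U" if "s \<in> S"
      using IH countable_underS_aleph1[OF card that] by (auto simp: good_def r_def)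
    ultimately show "\<exists>\<C>. good C s \<C>"
      unfolding good_def using extend_countable_directed_fd[OF LF, of ?U s] by (cases "s \<in> S") auto
  qed
  then obtain C where C: "\<And>s. s \<in> S \<Longrightarrow> good C s (C s)" by blast
  define \<D> where "\<D> = insert (cvs.span {1}) (\<Union>s\<in>S. C s)"
  have "directed_fd \<D>"
    unfolding \<D>_def using C chain by (intro directed_fd_Union_chain) (auto simp: good_def)
  moreover have "S \<subseteq> closure (\<Union>\<D>)"
  proof
    fix s assume s: "s \<in> S"
    have "\<Union>(C s) \<subseteq> \<Union>\<D>" using s by (auto simp: \<D>_def)
    from closure_mono[OF this] show "s \<in> closure (\<Union>\<D>)" using C[OF s] s by (auto simp: good_def)
  qed
  then have "closure (\<Union>\<D>) = UNIV"
    using dense closure_minimal[of S "closure (\<Union>\<D>)"] by auto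
  ultimately show thesis by (rule that)
qed

lemma countable_ordLess_aleph1: "countable X \<Longrightarrow> (card_of X, aleph1) \<in> ordLess"
  by (metis cardSuc_greater card_of_nat card_of_ordLeq countable_def natLeq_Card_order
      ordLeq_ordIso_trans ordLeq_ordLess_trans subset_UNIV)

lemma infinite_Field_aleph1: "infinite (Field aleph1)"
  using cardSuc_finite[OF natLeq_Card_order] by (simp add: Field_natLeq)

section \<open>C*-algebras as unital star-algebras\<close>

locale cstar =
  fixes A :: "'a cstar_struct"
  assumes cstar: "cstar_algebra A"
begin

lemma
  shows zer_closed [simp]: "zer A \<in> carrier A"
    and add_mul_closed [rule_format, simp]:
      "\<forall>x\<in>carrier A. \<forall>y\<in>carrier A. add A x y \<in> carrier A \<and> mul A x y \<in> carrier A"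
    and smul_closed [rule_format, simp]: "\<forall>c. \<forall>x\<in>carrier A. smul A c x \<in> carrier A"
    and star_closed [rule_format, simp]: "\<forall>x\<in>carrier A. star A x \<in> carrier A"
    and add_assoc [rule_format]:
      "\<forall>x\<in>carrier A. \<forall>y\<in>carrier A. \<forall>z\<in>carrier A. add A (add A x y) z = add A x (add A y z)"
    and add_comm [rule_format]: "\<forall>x\<in>carrier A. \<forall>y\<in>carrier A. add A x y = add A y x"
    and add_zer [rule_format]: "\<forall>x\<in>carrier A. add A (zer A) x = x"
    and add_neg [rule_format]: "\<forall>x\<in>carrier A. add A x (smul A (-1) x) = zer A"
    and smul_one [rule_format]: "\<forall>x\<in>carrier A. smul A 1 x = x"
    and smul_smul [rule_format]: "\<forall>a b. \<forall>x\<in>carrier A. smul A a (smul A b x) = smul A (a * b) x"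
    and smul_add_left [rule_format]:
      "\<forall>a b. \<forall>x\<in>carrier A. smul A (a + b) x = add A (smul A a x) (smul A b x)"
    and smul_add_right [rule_format]:
      "\<forall>a. \<forall>x\<in>carrier A. \<forall>y\<in>carrier A. smul A a (add A x y) = add A (smul A a x) (smul A a y)"
    and mul_assoc [rule_format]:
      "\<forall>x\<in>carrier A. \<forall>y\<in>carrier A. \<forall>z\<in>carrier A. mul A (mul A x y) z = mul A x (mul A y z)"
    and mul_add_left [rule_format]:
      "\<forall>x\<in>carrier A. \<forall>y\<in>carrier A. \<forall>z\<in>carrier A.
        mul A (add A x y) z = add A (mul A x z) (mul A y z)"
    and mul_add_right [rule_format]:
      "\<forall>x\<in>carrier A. \<forall>y\<in>carrier A. \<forall>z\<in>carrier A.
        mul A x (add A y z) = add A (mul A x y) (mul A x z)"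
    and mul_smul_left [rule_format]:
      "\<forall>a. \<forall>x\<in>carrier A. \<forall>y\<in>carrier A. mul A (smul A a x) y = smul A a (mul A x y)"
    and mul_smul_right [rule_format]:
      "\<forall>a. \<forall>x\<in>carrier A. \<forall>y\<in>carrier A. mul A x (smul A a y) = smul A a (mul A x y)"
    and star_star [rule_format]: "\<forall>x\<in>carrier A. star A (star A x) = x"
    and star_add [rule_format]:
      "\<forall>x\<in>carrier A. \<forall>y\<in>carrier A. star A (add A x y) = add A (star A x) (star A y)"
    and star_smul [rule_format]: "\<forall>a. \<forall>x\<in>carrier A. star A (smul A a x) = smul A (cnj a) (star A x)"
    and star_mul [rule_format]:
      "\<forall>x\<in>carrier A. \<forall>y\<in>carrier A. star A (mul A x y) = mul A (star A y) (star A x)"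
    and nrm_eq_0 [rule_format]: "\<forall>x\<in>carrier A. nrm A x = 0 \<longleftrightarrow> x = zer A"
    and nrm_triangle [rule_format]:
      "\<forall>x\<in>carrier A. \<forall>y\<in>carrier A. nrm A (add A x y) \<le> nrm A x + nrm A y"
    and nrm_smul [rule_format]: "\<forall>a. \<forall>x\<in>carrier A. nrm A (smul A a x) = cmod a * nrm A x"
    and nrm_mul [rule_format]: "\<forall>x\<in>carrier A. \<forall>y\<in>carrier A. nrm A (mul A x y) \<le> nrm A x * nrm A y"
    and nrm_star_mul [rule_format]: "\<forall>x\<in>carrier A. nrm A (mul A (star A x) x) = (nrm A x)\<^sup>2"
    and complete [rule_format]: "\<forall>f :: nat \<Rightarrow> 'a. (\<forall>n. f n \<in> carrier A) \<longrightarrow>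
      (\<forall>e>0. \<exists>N. \<forall>m\<ge>N. \<forall>n\<ge>N. cdist A (f m) (f n) < e) \<longrightarrow>
      (\<exists>x\<in>carrier A. \<forall>e>0. \<exists>N. \<forall>n\<ge>N. cdist A (f n) x < e)"
  by (insert cstar[unfolded cstar_algebra_def]) (elim conjE, assumption)+

lemma add_left_comm:
  "\<lbrakk>x \<in> carrier A; y \<in> carrier A; z \<in> carrier A\<rbrakk> \<Longrightarrow> add A x (add A y z) = add A y (add A x z)"
  by (metis add_assoc add_comm)

lemma add_zer_right: "x \<in> carrier A \<Longrightarrow> add A x (zer A) = x"
  by (metis add_comm add_zer zer_closed)

lemma smul_zero: "x \<in> carrier A \<Longrightarrow> smul A 0 x = zer A"
  using smul_add_left[of x 1 "-1"] by (simp add: smul_one add_neg)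

lemma smul_zer: "smul A c (zer A) = zer A"
  using smul_smul[of "zer A" c 0] by (simp add: smul_zero)

lemma mul_zer_right: "x \<in> carrier A \<Longrightarrow> mul A x (zer A) = zer A"
  using mul_smul_right[of x "zer A" 0] by (simp add: smul_zero)

lemma mul_zer_left: "x \<in> carrier A \<Longrightarrow> mul A (zer A) x = zer A"
  using mul_smul_left[of "zer A" x 0] by (simp add: smul_zero)

lemma star_zer: "star A (zer A) = zer A"
  using star_smul[of "zer A" 0] by (simp add: smul_zero)

lemma nrm_zer: "nrm A (zer A) = 0"
  by (simp add: nrm_eq_0)

lemma nrm_nonneg: "x \<in> carrier A \<Longrightarrow> 0 \<le> nrm A x"
  using nrm_triangle[of x "smul A (-1) x"] by (simp add: add_neg nrm_zer nrm_smul)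

lemma nrm_le_nrm_star:
  assumes x: "x \<in> carrier A"
  shows "nrm A x \<le> nrm A (star A x)"
proof -
  have "nrm A x * nrm A x \<le> nrm A (star A x) * nrm A x"
    using nrm_star_mul[OF x] nrm_mul[of "star A x" x] x by (simp add: power2_eq_square)
  then show ?thesis
    using nrm_nonneg[OF x] nrm_nonneg[of "star A x"] x by (cases "nrm A x = 0") auto
qed

lemma nrm_star: "x \<in> carrier A \<Longrightarrow> nrm A (star A x) = nrm A x"
  using nrm_le_nrm_star[of x] nrm_le_nrm_star[of "star A x"] by (simp add: star_star)

lemmas cstar_simps = add_assoc add_comm add_left_comm add_zer add_zer_right add_neg
  smul_one smul_smul smul_add_left smul_add_right mul_assoc mul_add_left mul_add_right
  mul_smul_left mul_smul_right star_star star_add star_smul star_mul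
  smul_zero smul_zer mul_zer_left mul_zer_right star_zer

end

lemma dense_inD: "dense_in A S \<Longrightarrow> x \<in> carrier A \<Longrightarrow> 0 < e \<Longrightarrow> \<exists>y\<in>S. cdist A x y < e"
  unfolding dense_in_def by blast

lemma approx_subset_mono: "approx_subset A e F D \<Longrightarrow> D \<subseteq> D' \<Longrightarrow> approx_subset A e F D'"
  unfolding approx_subset_def by blast

lemma is_AF_imp_is_LF:
  assumes "is_AF A"
  shows "is_LF A"
proof -
  obtain \<D> where D: "\<D> \<noteq> {}" "\<And>D. D \<in> \<D> \<Longrightarrow> fd_subalgebra A D"
      and directed: "\<And>D\<^sub>1 D\<^sub>2. D\<^sub>1 \<in> \<D> \<Longrightarrow> D\<^sub>2 \<in> \<D> \<Longrightarrow> \<exists>D\<^sub>3\<in>\<D>. D\<^sub>1 \<union> D\<^sub>2 \<subseteq> D\<^sub>3"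
      and dense: "dense_in A (\<Union>\<D>)"
    using assms unfolding is_AF_def by metis
  have "\<exists>D\<in>\<D>. approx_subset A e F D" if "finite F" "F \<subseteq> carrier A" "0 < e" for F e
    using that(1,2)
  proof (induction F)
    case empty
    then show ?case using D(1) by (auto simp: approx_subset_def)
  next
    case (insert x F)
    then obtain D\<^sub>1 where D\<^sub>1: "D\<^sub>1 \<in> \<D>" "approx_subset A e F D\<^sub>1" by auto
    have "\<exists>y\<in>\<Union>\<D>. cdist A x y < e"
      using dense insert.prems \<open>0 < e\<close> by (simp add: dense_in_def)
    then obtain D\<^sub>2 where D\<^sub>2: "D\<^sub>2 \<in> \<D>" "approx_subset A e {x} D\<^sub>2"
      by (auto simp: approx_subset_def)
    obtain D\<^sub>3 where D\<^sub>3: "D\<^sub>3 \<in> \<D>" "D\<^sub>1 \<union> D\<^sub>2 \<subseteq> D\<^sub>3" using directed[OF D\<^sub>1(1) D\<^sub>2(1)] by blast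
    then have "approx_subset A e F D\<^sub>3" "approx_subset A e {x} D\<^sub>3"
      using approx_subset_mono[OF D\<^sub>1(2)] approx_subset_mono[OF D\<^sub>2(2)] by auto
    then have "approx_subset A e (insert x F) D\<^sub>3" by (simp add: approx_subset_def)
    then show ?case using D\<^sub>3(1) by (rule bexI)
  qed
  then show ?thesis unfolding is_LF_def using D(2) by blast
qed

definition small_LF_not_AF :: "'a cstar_struct \<Rightarrow> bool" where
  "small_LF_not_AF A \<longleftrightarrow> cstar_algebra A \<and> density_le A aleph1 \<and> is_LF A \<and> \<not> is_AF A"

definition zero_struct :: "'a cstar_struct" where
  "zero_struct =
     \<lparr>carrier = {undefined}, zer = undefined, add = (\<lambda>_ _. undefined), smul = (\<lambda>_ _. undefined),
      mul = (\<lambda>_ _. undefined), star = (\<lambda>_. undefined), nrm = (\<lambda>_. 0)\<rparr>"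

lemma cstar_algebra_zero_struct: "cstar_algebra zero_struct"
  by (simp add: cstar_algebra_def zero_struct_def cdist_def)

text \<open>A type cannot depend on an algebra given as a term. The unitization is therefore formed for
  one fixed algebra on each type: a counterexample to the implication from LF to AF in density at
  most aleph 1, if there is one. To show that it is no counterexample settles all algebras at
  once.\<close>

definition generic :: "'a cstar_struct" where
  "generic = (if \<exists>A :: 'a cstar_struct. small_LF_not_AF A then SOME A. small_LF_not_AF A
     else zero_struct)"

lemma small_LF_not_AF_generic:
  fixes A :: "'a cstar_struct"
  assumes "small_LF_not_AF A"
  shows "small_LF_not_AF (generic :: 'a cstar_struct)"
proof -
  have ex: "\<exists>A :: 'a cstar_struct. small_LF_not_AF A" using assms by blast
  then show ?thesis using someI_ex[OF ex] by (simp add: generic_def)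
qed

lemma cstar_algebra_generic: "cstar_algebra (generic :: 'a cstar_struct)"
proof (cases "\<exists>A :: 'a cstar_struct. small_LF_not_AF A")
  case True
  then show ?thesis using small_LF_not_AF_generic by (auto simp: small_LF_not_AF_def)
next
  case False
  then show ?thesis by (simp add: generic_def cstar_algebra_zero_struct)
qed

interpretation gen: cstar "generic :: 'a cstar_struct"
  by unfold_locales (rule cstar_algebra_generic)

typedef 'a unitization = "carrier (generic :: 'a cstar_struct) \<times> (UNIV :: complex set)"
  using gen.zer_closed by blast

definition alg_part :: "'a unitization \<Rightarrow> 'a" where "alg_part u = fst (Rep_unitization u)"
definition scalar_part :: "'a unitization \<Rightarrow> complex" where "scalar_part u = snd (Rep_unitization u)"
definition unitize :: "'a \<Rightarrow> complex \<Rightarrow> 'a unitization" where "unitize x c = Abs_unitization (x, c)"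

lemma alg_part_closed [simp]: "alg_part u \<in> carrier generic"
  using Rep_unitization[of u] by (auto simp: alg_part_def)

lemma alg_part_unitize [simp]: "x \<in> carrier generic \<Longrightarrow> alg_part (unitize x c) = x"
  and scalar_part_unitize [simp]: "x \<in> carrier generic \<Longrightarrow> scalar_part (unitize x c) = c"
  by (simp_all add: alg_part_def scalar_part_def unitize_def Abs_unitization_inverse)

lemma unitization_eq_iff: "u = v \<longleftrightarrow> alg_part u = alg_part v \<and> scalar_part u = scalar_part v"
  by (metis Rep_unitization_inject prod_eqI alg_part_def scalar_part_def)

instantiation unitization :: (type) real_normed_algebra_1
begin

definition zero_unitization where "0 = unitize (zer generic) 0"
definition one_unitization where "1 = unitize (zer generic) 1"
definition plus_unitization where
  "u + v = unitize (add generic (alg_part u) (alg_part v)) (scalar_part u + scalar_part v)"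
definition uminus_unitization where
  "- u = unitize (smul generic (-1) (alg_part u)) (- scalar_part u)"
  for u :: "'a unitization"
definition minus_unitization where "u - v = u + - v" for u :: "'a unitization"
definition times_unitization where "u * v =
  unitize (add generic (mul generic (alg_part u) (alg_part v))
        (add generic (smul generic (scalar_part u) (alg_part v))
          (smul generic (scalar_part v) (alg_part u))))
      (scalar_part u * scalar_part v)"
definition scaleR_unitization where
  "r *\<^sub>R u = unitize (smul generic (of_real r) (alg_part u)) (of_real r * scalar_part u)"
  for u :: "'a unitization"
definition norm_unitization where "norm u = nrm generic (alg_part u) + cmod (scalar_part u)"
definition dist_unitization where "dist u v = norm (u - v)" for u v :: "'a unitization"
definition sgn_unitization where "sgn u = inverse (norm u) *\<^sub>R u" for u :: "'a unitization"
definition uniformity_unitization where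
  "(uniformity :: ('a unitization \<times> 'a unitization) filter)
      = (INF e\<in>{0 <..}. principal {(x, y). dist x y < e})"
definition open_unitization where
  "open (U :: 'a unitization set) \<longleftrightarrow> (\<forall>x\<in>U. eventually (\<lambda>(x', y). x' = x \<longrightarrow> y \<in> U) uniformity)"

lemma unitization_parts_simps:
  "alg_part (0 :: 'a unitization) = zer generic" "scalar_part (0 :: 'a unitization) = 0"
  "alg_part (1 :: 'a unitization) = zer generic" "scalar_part (1 :: 'a unitization) = 1"
  "alg_part (u + v) = add generic (alg_part u) (alg_part v)"
  "scalar_part (u + v) = scalar_part u + scalar_part v"
  "alg_part (- u) = smul generic (-1) (alg_part u)" "scalar_part (- u) = - scalar_part u"
  "alg_part (u - v) = add generic (alg_part u) (smul generic (-1) (alg_part v))"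
  "scalar_part (u - v) = scalar_part u - scalar_part v"
  "alg_part (u * v) = add generic (mul generic (alg_part u) (alg_part v))
        (add generic (smul generic (scalar_part u) (alg_part v))
          (smul generic (scalar_part v) (alg_part u)))"
  "scalar_part (u * v) = scalar_part u * scalar_part v"
  "alg_part (r *\<^sub>R u) = smul generic (of_real r) (alg_part u)"
  "scalar_part (r *\<^sub>R u) = of_real r * scalar_part u"
  for u v :: "'a unitization"
  by (simp_all add: zero_unitization_def one_unitization_def plus_unitization_def
      uminus_unitization_def minus_unitization_def times_unitization_def scaleR_unitization_def)

lemma norm_mult_unitization_le:
  fixes a b :: "'a unitization"
  shows "norm (a * b) \<le> norm a * norm b"
proof -
  let ?ab = "mul generic (alg_part a) (alg_part b)"
      and ?sb = "smul generic (scalar_part a) (alg_part b)"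
    and ?sa = "smul generic (scalar_part b) (alg_part a)"
  have "nrm generic (add generic ?ab (add generic ?sb ?sa))
      \<le> nrm generic ?ab + nrm generic (add generic ?sb ?sa)"
    by (rule gen.nrm_triangle) simp_all
  also have "\<dots> \<le> nrm generic (alg_part a) * nrm generic (alg_part b) +
      (cmod (scalar_part a) * nrm generic (alg_part b) +
        cmod (scalar_part b) * nrm generic (alg_part a))"
    using gen.nrm_mul[of "alg_part a" "alg_part b"] gen.nrm_triangle[of ?sb ?sa]
    by (simp add: gen.nrm_smul)
  finally show ?thesis
    by (simp add: norm_unitization_def unitization_parts_simps norm_mult algebra_simps)
qed

instance
proof
  fix a b c :: "'a unitization" and x y :: real
  show "a + b + c = a + (b + c)" "a + b = b + a" "0 + a = a" "- a + a = 0"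
      "x *\<^sub>R (a + b) = x *\<^sub>R a + x *\<^sub>R b" "(x + y) *\<^sub>R a = x *\<^sub>R a + y *\<^sub>R a"
      "x *\<^sub>R y *\<^sub>R a = (x * y) *\<^sub>R a" "1 *\<^sub>R a = a"
      "a * b * c = a * (b * c)" "(a + b) * c = a * c + b * c" "a * (b + c) = a * b + a * c"
      "1 * a = a" "a * 1 = a"
      "x *\<^sub>R a * b = x *\<^sub>R (a * b)" "a * x *\<^sub>R b = x *\<^sub>R (a * b)"
    by (simp_all add: unitization_eq_iff unitization_parts_simps gen.cstar_simps algebra_simps)
  show "(0 :: 'a unitization) \<noteq> 1" by (simp add: unitization_eq_iff unitization_parts_simps)
  show "a - b = a + - b" by (rule minus_unitization_def)
  show "dist a b = norm (a - b)" by (rule dist_unitization_def)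
  show "sgn a = inverse (norm a) *\<^sub>R a" by (rule sgn_unitization_def)
  show "(uniformity :: ('a unitization \<times> 'a unitization) filter)
      = (INF e\<in>{0 <..}. principal {(x, y). dist x y < e})"
    by (rule uniformity_unitization_def)
  show "open U \<longleftrightarrow> (\<forall>x\<in>U. eventually (\<lambda>(x', y). x' = x \<longrightarrow> y \<in> U) uniformity)"
      for U :: "'a unitization set"
    by (rule open_unitization_def)
  show "norm a = 0 \<longleftrightarrow> a = 0"
    using gen.nrm_nonneg[of "alg_part a"]
    by (auto simp: norm_unitization_def unitization_eq_iff unitization_parts_simps gen.nrm_eq_0
        add_nonneg_eq_0_iff)
  show "norm (a + b) \<le> norm a + norm b"
    using gen.nrm_triangle[of "alg_part a" "alg_part b"]
      norm_triangle_ineq[of "scalar_part a" "scalar_part b"]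
    by (simp add: norm_unitization_def unitization_parts_simps)
  show "norm (x *\<^sub>R a) = \<bar>x\<bar> * norm a" "norm (1 :: 'a unitization) = 1"
    by (simp_all add: norm_unitization_def unitization_parts_simps gen.nrm_smul gen.nrm_zer
        norm_mult distrib_left)
  show "norm (a * b) \<le> norm a * norm b" by (rule norm_mult_unitization_le)
qed

end

lemma norm_diff_unitization:
  "norm (u - v) = cdist generic (alg_part u) (alg_part v) + cmod (scalar_part u - scalar_part v)"
  for u v :: "'a unitization"
  by (simp add: norm_unitization_def unitization_parts_simps cdist_def)

lemma Cauchy_unitization_convergent:
  fixes X :: "nat \<Rightarrow> 'a unitization"
  assumes X: "Cauchy X"
  shows "convergent X"
proof -
  have parts: "cdist generic (alg_part u) (alg_part v) \<le> dist u v"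
      "dist (scalar_part u) (scalar_part v) \<le> dist u v"
    for u v :: "'a unitization"
    by (simp_all add: dist_norm norm_diff_unitization cdist_def gen.nrm_nonneg)
  have "\<exists>N. \<forall>m\<ge>N. \<forall>n\<ge>N. cdist generic (alg_part (X m)) (alg_part (X n)) < e" if "0 < e" for e
    using metric_CauchyD[OF X that] parts(1) by (meson le_less_trans)
  then obtain a where a: "a \<in> carrier generic"
      "\<And>e. e > 0 \<Longrightarrow> \<exists>N. \<forall>n\<ge>N. cdist generic (alg_part (X n)) a < e"
    using gen.complete[of "\<lambda>n. alg_part (X n)"] by (meson alg_part_closed)
  have "Cauchy (\<lambda>n. scalar_part (X n))"
    by (rule metric_CauchyI) (use metric_CauchyD[OF X] parts(2) in \<open>meson le_less_trans\<close>)
  then obtain c where c: "(\<lambda>n. scalar_part (X n)) \<longlonglongrightarrow> c"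
    using Cauchy_convergent convergent_def by blast
  have "X \<longlonglongrightarrow> unitize a c"
  proof (rule metric_LIMSEQ_I)
    fix e :: real assume "0 < e"
    then have half: "0 < e / 2" by simp
    obtain N\<^sub>1 where N\<^sub>1: "\<And>n. n \<ge> N\<^sub>1 \<Longrightarrow> cdist generic (alg_part (X n)) a < e / 2"
      using a(2)[OF half] by blast
    obtain N\<^sub>2 where N\<^sub>2: "\<And>n. n \<ge> N\<^sub>2 \<Longrightarrow> cmod (scalar_part (X n) - c) < e / 2"
      using LIMSEQ_D[OF c half] by blast
    have "dist (X n) (unitize a c) < e" if "n \<ge> max N\<^sub>1 N\<^sub>2" for n
      using N\<^sub>1[of n] N\<^sub>2[of n] that a(1) by (simp add: dist_norm norm_diff_unitization)
    then show "\<exists>N. \<forall>n\<ge>N. dist (X n) (unitize a c) < e" by blast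
  qed
  then show ?thesis by (auto simp: convergent_def)
qed

instantiation unitization :: (type) star_banach
begin

definition scaleC_unitization where
  "c *\<^sub>C u = unitize (smul generic c (alg_part u)) (c * scalar_part u)"
  for u :: "'a unitization"
definition adj_unitization where "adj u = unitize (star generic (alg_part u)) (cnj (scalar_part u))"

lemma unitization_star_parts_simps:
  "alg_part (c *\<^sub>C u) = smul generic c (alg_part u)" "scalar_part (c *\<^sub>C u) = c * scalar_part u"
  "alg_part (adj u) = star generic (alg_part u)" "scalar_part (adj u) = cnj (scalar_part u)"
  for u :: "'a unitization"
  by (simp_all add: scaleC_unitization_def adj_unitization_def)

lemmas unitization_simps = unitization_parts_simps unitization_star_parts_simps

lemma adj_mult_self_unitization_eq_0:
  fixes a :: "'a unitization"
  assumes "adj a * a = 0"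
  shows "a = 0"
proof -
  have "cnj (scalar_part a) * scalar_part a = 0"
    using assms
    by (simp add: unitization_eq_iff unitization_simps)
  then have scalar: "scalar_part a = 0" by simp
  then have "mul generic (star generic (alg_part a)) (alg_part a) = zer generic"
    using assms
    by (simp add: unitization_eq_iff unitization_simps gen.cstar_simps)
  then have "nrm generic (alg_part a) = 0"
    using gen.nrm_star_mul[of "alg_part a"] by (simp add: gen.nrm_zer)
  then show ?thesis
    using scalar
    by (simp add: unitization_eq_iff unitization_simps gen.nrm_eq_0)
qed

instance
proof
  fix a b :: "'a unitization" and x :: real and k l :: complex
  show "k *\<^sub>C (a + b) = k *\<^sub>C a + k *\<^sub>C b" "(k + l) *\<^sub>C a = k *\<^sub>C a + l *\<^sub>C a"
      "k *\<^sub>C (l *\<^sub>C a) = (k * l) *\<^sub>C a"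
      "of_real x *\<^sub>C a = x *\<^sub>R a" "(k *\<^sub>C a) * b = k *\<^sub>C (a * b)" "a * (k *\<^sub>C b) = k *\<^sub>C (a * b)"
      "adj (adj a) = a" "adj (a + b) = adj a + adj b" "adj (a * b) = adj b * adj a"
      "adj (k *\<^sub>C a) = cnj k *\<^sub>C adj a"
    by (simp_all add: unitization_eq_iff unitization_simps gen.cstar_simps algebra_simps)
  show "norm (k *\<^sub>C a) = cmod k * norm a" "norm (adj a) = norm a"
    by (simp_all add: norm_unitization_def unitization_simps gen.nrm_smul gen.nrm_star norm_mult
        distrib_left)
  show "adj a * a = 0 \<Longrightarrow> a = 0" by (rule adj_mult_self_unitization_eq_0)
qed (rule Cauchy_unitization_convergent)

end

lemma cdist_alg_part_le: "cdist generic (alg_part u) (alg_part v) \<le> norm (u - v)"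
  by (simp add: norm_diff_unitization)

lemma unitization_split: "u = unitize (alg_part u) 0 + scalar_part u *\<^sub>C 1"
  by (simp add: unitization_eq_iff unitization_simps gen.cstar_simps)

lemma lin_span_closed:
  assumes "B \<subseteq> carrier generic" "x \<in> lin_span generic B"
  shows "x \<in> carrier generic"
  using assms(2,1) by induction auto

lemma unitize_lin_span:
  fixes B :: "'a set"
  assumes B: "B \<subseteq> carrier generic" and x: "x \<in> lin_span generic B"
  shows "unitize x 0 \<in> cvs.span ((\<lambda>b. unitize b 0) ` B)"
  using x
proof induction
  case span_zero
  have "unitize (zer (generic :: 'a cstar_struct)) 0 = 0" by (simp add: zero_unitization_def)
  then show ?case by (simp add: cvs.span_zero)
next
  case (span_base x)
  then show ?case by (intro cvs.span_base) auto
next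
  case (span_add x y)
  have "unitize (add generic x y) 0 = unitize x 0 + unitize y 0"
    using span_add lin_span_closed[OF B]
    by (simp add: unitization_eq_iff unitization_simps)
  then show ?case using span_add cvs.span_add by simp
next
  case (span_smul x c)
  have "unitize (smul generic c x) 0 = c *\<^sub>C unitize x 0"
    using span_smul lin_span_closed[OF B]
    by (simp add: unitization_eq_iff unitization_simps)
  then show ?case using span_smul cvs.span_scale by simp
qed

lemma fd_star_subalgebra_unitization:
  assumes D: "fd_subalgebra generic D"
  shows "fd_star_subalgebra {u. alg_part u \<in> D}" (is "fd_star_subalgebra ?D")
proof -
  have D_carrier: "D \<subseteq> carrier generic" using D by (simp add: fd_subalgebra_def)
  have sub: "star_subalgebra ?D"
    using D unfolding star_subalgebra_def cvs.subspace_def fd_subalgebra_def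
    by (simp add: unitization_simps)
  obtain B where B: "finite B" "B \<subseteq> D" "D \<subseteq> lin_span generic B"
    using D by (auto simp: fd_subalgebra_def)
  let ?B = "insert 1 ((\<lambda>b. unitize b 0) ` B)"
  have "?D = cvs.span ?B"
  proof
    show "?D \<subseteq> cvs.span ?B"
    proof
      fix u :: "'a unitization" assume "u \<in> ?D"
      then have "unitize (alg_part u) 0 \<in> cvs.span ((\<lambda>b. unitize b 0) ` B)"
        using B D_carrier by (intro unitize_lin_span) auto
      then have "unitize (alg_part u) 0 \<in> cvs.span ?B"
        using cvs.span_mono[of "(\<lambda>b. unitize b 0) ` B" ?B] by blast
      moreover have "scalar_part u *\<^sub>C 1 \<in> cvs.span ?B" by (intro cvs.span_scale cvs.span_base) simp
      ultimately have "unitize (alg_part u) 0 + scalar_part u *\<^sub>C 1 \<in> cvs.span ?B"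
        by (rule cvs.span_add)
      then show "u \<in> cvs.span ?B" by (simp flip: unitization_split)
    qed
    have "1 \<in> ?D" using sub by (simp add: star_subalgebra_def)
    then have "?B \<subseteq> ?D" using B(2) D_carrier by (auto simp: subset_iff)
    then show "cvs.span ?B \<subseteq> ?D" by (rule cvs.span_minimal[OF _ star_subalgebra_subspace[OF sub]])
  qed
  then show ?thesis
    unfolding fd_star_subalgebra_def using sub B(1) by (intro conjI exI[of _ ?B]) simp_all
qed

lemma locally_fd_unitization:
  assumes LF: "is_LF (generic :: 'a cstar_struct)"
  shows "locally_fd TYPE('a unitization)"
  unfolding locally_fd_def
proof (intro allI impI)
  fix X :: "'a unitization set" and \<epsilon> :: real assume X: "finite X" and \<epsilon>: "0 < \<epsilon>"
  have "finite (alg_part ` X) \<and> alg_part ` X \<subseteq> carrier generic \<and> 0 < \<epsilon>" using X \<epsilon> by auto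
  then obtain D where D: "fd_subalgebra generic D" "approx_subset generic \<epsilon> (alg_part ` X) D"
    using LF unfolding is_LF_def by meson
  have "approximates {u. alg_part u \<in> D} X \<epsilon>"
  proof (rule approximatesI)
    fix x assume x: "x \<in> X"
    obtain y where y: "y \<in> D" "cdist generic (alg_part x) y < \<epsilon>"
      using D(2) x by (auto simp: approx_subset_def)
    have "y \<in> carrier generic" using y(1) D(1) by (auto simp: fd_subalgebra_def)
    then have "norm (x - unitize y (scalar_part x)) \<le> \<epsilon>" "alg_part (unitize y (scalar_part x)) \<in> D"
      using y by (simp_all add: norm_diff_unitization)
    then show "\<exists>g\<in>{u. alg_part u \<in> D}. norm (g - x) \<le> \<epsilon>"
      by (metis mem_Collect_eq norm_minus_commute)
  qed
  then show "\<exists>G. fd_star_subalgebra G \<and> approximates G X \<epsilon>"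
    using fd_star_subalgebra_unitization[OF D(1)] by blast
qed

lemma density_unitization:
  assumes "density_le (generic :: 'a cstar_struct) aleph1"
  obtains S :: "'a unitization set" where "closure S = UNIV" "(card_of S, aleph1) \<in> ordLeq"
proof -
  obtain S where S: "dense_in (generic :: 'a cstar_struct) S" "(card_of S, aleph1) \<in> ordLeq"
    using assms by (auto simp: density_le_def)
  have S_carrier: "S \<subseteq> carrier generic" using S(1) by (simp add: dense_in_def)
  obtain Q :: "complex set" where Q: "countable Q" "\<And>U. open U \<Longrightarrow> U \<noteq> {} \<Longrightarrow> \<exists>d\<in>Q. d \<in> U"
    using countable_dense_exists by metis
  define S' where "S' = (\<lambda>(s, q). unitize s q) ` (S \<times> Q)"
  have "u \<in> closure S'" for u
    unfolding closure_approachable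
  proof (intro allI impI)
    fix e :: real assume "0 < e"
    then have half: "0 < e / 2" by simp
    obtain s where s: "s \<in> S" "cdist generic (alg_part u) s < e / 2"
      using S(1) half alg_part_closed[of u] unfolding dense_in_def by meson
    obtain q where q: "q \<in> Q" "q \<in> ball (scalar_part u) (e / 2)"
      using Q(2)[of "ball (scalar_part u) (e / 2)"] half by auto
    have "norm (u - unitize s q) < e"
      using S_carrier s q(2) by (simp add: norm_diff_unitization dist_norm subset_iff)
    then have "dist (unitize s q) u < e" by (simp add: dist_norm norm_minus_commute)
    then show "\<exists>y\<in>S'. dist y u < e" using s(1) q(1) by (auto simp: S'_def)
  qed
  then have "closure S' = UNIV" by blast
  moreover have "(card_of S', aleph1) \<in> ordLeq"
  proof -
    have "(card_of (S \<times> Q), aleph1) \<in> ordLeq"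
      using S(2) countable_ordLess_aleph1[OF Q(1)] infinite_Field_aleph1
        cardSuc_Card_order[OF natLeq_Card_order]
      by (intro card_of_Times_ordLeq_infinite_Field) (auto intro: ordLess_imp_ordLeq)
    then show ?thesis unfolding S'_def using card_of_image ordLeq_transitive by blast
  qed
  ultimately show thesis by (rule that)
qed

lemma alg_part_mem_lin_span:
  assumes "u \<in> cvs.span B"
  shows "alg_part u \<in> lin_span generic (alg_part ` B)"
  using assms
proof (induction rule: cvs.span_induct_alt)
  case base
  then show ?case
    by (simp add: unitization_simps lin_span.span_zero)
next
  case (step c x y)
  then show ?case
    unfolding unitization_simps
    by (blast intro: lin_span.span_add lin_span.span_smul lin_span.span_base)
qed

lemma fd_subalgebra_alg_part:
  assumes D: "fd_star_subalgebra D"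
  shows "fd_subalgebra generic (alg_part ` D)"
proof -
  note closed = star_subalgebra_closed[OF star_subalgebra_of_fd[OF D]]
  have alg: "unitize (alg_part u) 0 \<in> D" if "u \<in> D" for u
  proof -
    have "unitize (alg_part u) 0 = u - scalar_part u *\<^sub>C 1"
      using unitization_split[of u] by (simp add: algebra_simps)
    then show ?thesis using that closed(2,4,6) by simp
  qed
  obtain B where B: "finite B" "D = cvs.span B" using D by (auto simp: fd_star_subalgebra_def)
  have span: "\<exists>B. finite B \<and> B \<subseteq> alg_part ` D \<and> alg_part ` D \<subseteq> lin_span generic B"
    using B cvs.span_superset[of B] alg_part_mem_lin_span
    by (intro exI[of _ "alg_part ` B"]) auto
  have ops: "zer generic \<in> alg_part ` D" "add generic (alg_part u) (alg_part v) \<in> alg_part ` D"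
      "mul generic (alg_part u) (alg_part v) \<in> alg_part ` D"
      "smul generic c (alg_part u) \<in> alg_part ` D"
      "star generic (alg_part u) \<in> alg_part ` D"
    if "u \<in> D" "v \<in> D" for u v c
  proof -
    have "alg_part 0 \<in> alg_part ` D" "alg_part (u + v) \<in> alg_part ` D"
        "alg_part (unitize (alg_part u) 0 * unitize (alg_part v) 0) \<in> alg_part ` D"
        "alg_part (c *\<^sub>C u) \<in> alg_part ` D" "alg_part (adj u) \<in> alg_part ` D"
      by (intro imageI closed alg that)+
    then show "zer generic \<in> alg_part ` D" "add generic (alg_part u) (alg_part v) \<in> alg_part ` D"
        "mul generic (alg_part u) (alg_part v) \<in> alg_part ` D"
        "smul generic c (alg_part u) \<in> alg_part ` D"
        "star generic (alg_part u) \<in> alg_part ` D"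
      by (simp_all add: unitization_simps gen.smul_zero gen.add_zer_right)
  qed
  show ?thesis
    unfolding fd_subalgebra_def using ops closed(1) span by (auto simp del: image_subset_iff)
qed

lemma dense_in_alg_part:
  assumes "closure S = UNIV"
  shows "dense_in generic (alg_part ` S)"
  unfolding dense_in_def
proof (intro conjI ballI allI impI)
  show "alg_part ` S \<subseteq> carrier generic" by auto
  fix x :: 'a and e :: real assume x: "x \<in> carrier generic" and "0 < e"
  then obtain u where u: "u \<in> S" "dist u (unitize x 0) < e"
    using assms unfolding closure_approachable[of _ S, symmetric]
    by (metis UNIV_I closure_approachable)
  have "cdist generic x (alg_part u) < e"
    using cdist_alg_part_le[of "unitize x 0" u] x u(2) by (simp add: dist_norm norm_minus_commute)
  then show "\<exists>y\<in>alg_part ` S. cdist generic x y < e" using u(1) by blast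
qed

lemma is_AF_generic:
  assumes "density_le (generic :: 'a cstar_struct) aleph1" "is_LF (generic :: 'a cstar_struct)"
  shows "is_AF (generic :: 'a cstar_struct)"
proof -
  obtain S :: "'a unitization set" where S: "closure S = UNIV" "(card_of S, aleph1) \<in> ordLeq"
    using density_unitization[OF assms(1)] by blast
  obtain \<D> :: "'a unitization set set" where D: "directed_fd \<D>" "closure (\<Union>\<D>) = UNIV"
    using directed_fd_dense_exists[OF locally_fd_unitization[OF assms(2)] S] by blast
  have "\<exists>E\<in>(`) alg_part ` \<D>. alg_part ` D\<^sub>1 \<union> alg_part ` D\<^sub>2 \<subseteq> E"
      if D12: "D\<^sub>1 \<in> \<D>" "D\<^sub>2 \<in> \<D>" for D\<^sub>1 D\<^sub>2
  proof -
    obtain D\<^sub>3 where "D\<^sub>3 \<in> \<D>" "D\<^sub>1 \<union> D\<^sub>2 \<subseteq> D\<^sub>3" using D(1) D12 unfolding directed_fd_def by meson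
    then show ?thesis by (intro bexI[of _ "alg_part ` D\<^sub>3"]) auto
  qed
  moreover have "dense_in generic (\<Union>((`) alg_part ` \<D>))"
    using dense_in_alg_part[OF D(2)] by (simp add: image_Union)
  moreover have "fd_subalgebra generic (alg_part ` D)" if "D \<in> \<D>" for D
    using D(1) that by (intro fd_subalgebra_alg_part) (simp add: directed_fd_def)
  ultimately show ?thesis
    unfolding is_AF_def using D(1)
    by (intro exI[of _ "(`) alg_part ` \<D>"]) (simp add: directed_fd_def)
qed

theorem is_AF_iff_is_LF:
  fixes A :: "'a cstar_struct"
  assumes "cstar_algebra A" "density_le A aleph1"
  shows "is_AF A \<longleftrightarrow> is_LF A"
  using is_AF_imp_is_LF[of A] small_LF_not_AF_generic[of A] is_AF_generic assms
  unfolding small_LF_not_AF_def by blast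

section \<open>Complex matrices with the operator norm\<close>

definition opnorm :: "complex^'n^'m \<Rightarrow> real" where
  "opnorm M = onorm ((*v) M)"

definition mat_adj :: "complex^'n^'m \<Rightarrow> complex^'m^'n" where
  "mat_adj M = (\<chi> i j. cnj (M $ j $ i))"

definition mat_scale :: "complex \<Rightarrow> complex^'n^'m \<Rightarrow> complex^'n^'m" where
  "mat_scale c M = (\<chi> i j. c * M $ i $ j)"

lemma norm_matrix_vector_le: "norm (M *v v) \<le> opnorm M * norm v"
  unfolding opnorm_def by (rule onorm[OF matrix_vector_mul_bounded_linear])

lemma opnorm_leI: "(\<And>v. norm (M *v v) \<le> b * norm v) \<Longrightarrow> opnorm M \<le> b"
  unfolding opnorm_def by (rule onorm_le)

lemma opnorm_nonneg [simp]: "0 \<le> opnorm M"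
  unfolding opnorm_def by (rule onorm_pos_le[OF matrix_vector_mul_bounded_linear])

lemma opnorm_eq_0 [simp]: "opnorm M = 0 \<longleftrightarrow> M = 0"
  unfolding opnorm_def onorm_eq_0[OF matrix_vector_mul_bounded_linear]
  using matrix_eq[of M 0] by simp

lemma opnorm_zero [simp]: "opnorm 0 = 0"
  by simp

lemma opnorm_triangle: "opnorm (M + N) \<le> opnorm M + opnorm N"
proof (rule opnorm_leI)
  fix v
  show "norm ((M + N) *v v) \<le> (opnorm M + opnorm N) * norm v"
    using norm_triangle_ineq[of "M *v v" "N *v v"] norm_matrix_vector_le[of M v]
      norm_matrix_vector_le[of N v]
    by (simp add: matrix_vector_mult_add_rdistrib distrib_right)
qed

lemma matrix_ring_simps:
  "mat_scale c (M + N) = mat_scale c M + mat_scale c N"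
  "mat_scale (c + d) M = mat_scale c M + mat_scale d M"
  "mat_scale c (mat_scale d M) = mat_scale (c * d) M" "mat_scale 1 M = M" "mat_scale 0 M = 0"
  "mat_scale c 0 = 0"
  "mat_scale (- c) M = - mat_scale c M"
  "P ** (Q + R) = P ** Q + P ** R" "(P + Q) ** R = P ** R + Q ** R"
  "P ** (Q - R) = P ** Q - P ** R" "(P - Q) ** R = P ** R - Q ** R"
  "mat_scale c P ** Q = mat_scale c (P ** Q)" "P ** mat_scale c Q = mat_scale c (P ** Q)"
  "P ** 0 = 0" "0 ** P = 0"
  "mat_adj (M + N) = mat_adj M + mat_adj N"
  "mat_adj (P ** Q) = mat_adj Q ** mat_adj P"
  "mat_adj (mat_scale c M) = mat_scale (cnj c) (mat_adj M)" "mat_adj (mat_adj M) = M"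
  "mat_adj 0 = 0"
  by (simp_all add: Finite_Cartesian_Product.vec_eq_iff mat_scale_def mat_adj_def
      matrix_matrix_mult_def sum.distrib sum_subtractf sum_distrib_left algebra_simps)

lemma mat_scale_diff_right: "mat_scale c (M - N) = mat_scale c M - mat_scale c N"
  and mat_scale_diff_left: "mat_scale (c - d) M = mat_scale c M - mat_scale d M"
  and mat_adj_diff: "mat_adj (M - N) = mat_adj M - mat_adj N"
  by (simp_all add: Finite_Cartesian_Product.vec_eq_iff mat_scale_def mat_adj_def algebra_simps)

lemmas matrix_simps = matrix_ring_simps mat_scale_diff_right mat_scale_diff_left mat_adj_diff

lemma norm_mat_scale_vector: "norm (mat_scale c M *v v) = cmod c * norm (M *v v)"
proof -
  have "mat_scale c M *v v = c *s (M *v v)"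
    by (simp add: Finite_Cartesian_Product.vec_eq_iff mat_scale_def matrix_vector_mult_def
        sum_distrib_left mult.assoc)
  then show ?thesis
    by (simp add: norm_vec_def L2_set_def norm_mult power_mult_distrib real_sqrt_mult
        flip: sum_distrib_left)
qed

lemma opnorm_scale: "opnorm (mat_scale c M) = cmod c * opnorm M"
proof -
  have upper: "opnorm (mat_scale c M) \<le> cmod c * opnorm M" for c M
    by (rule opnorm_leI)
       (simp add: norm_mat_scale_vector norm_matrix_vector_le mult_left_mono mult.assoc)
  show ?thesis
  proof (cases "c = 0")
    case False
    then have "opnorm M \<le> inverse (cmod c) * opnorm (mat_scale c M)"
      using upper[of "inverse c" "mat_scale c M"] by (simp add: matrix_simps norm_inverse)
    then show ?thesis using upper[of c M] False by (simp add: field_simps)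
  qed (simp add: matrix_simps)
qed

lemma opnorm_minus: "opnorm (- M) = opnorm M"
  using opnorm_scale[of "-1" M] by (simp add: matrix_simps)

lemma opnorm_diff_commute: "opnorm (M - N) = opnorm (N - M)"
  using opnorm_minus[of "M - N"] by simp

lemma opnorm_diff_triangle: "opnorm (M - L) \<le> opnorm (M - N) + opnorm (N - L)"
  using opnorm_triangle[of "M - N" "N - L"] by simp

lemma opnorm_mult: "opnorm (M ** N) \<le> opnorm M * opnorm N"
proof (rule opnorm_leI)
  fix v
  have "norm ((M ** N) *v v) \<le> opnorm M * norm (N *v v)"
    using norm_matrix_vector_le[of M "N *v v"] by (simp add: matrix_vector_mul_assoc)
  also have "\<dots> \<le> opnorm M * (opnorm N * norm v)"
    by (intro mult_left_mono norm_matrix_vector_le opnorm_nonneg)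
  finally show "norm ((M ** N) *v v) \<le> opnorm M * opnorm N * norm v" by (simp add: mult.assoc)
qed

lemma inner_matrix_vector: "(M *v v) \<bullet> w = v \<bullet> (mat_adj M *v w)"
proof -
  have "(M *v v) \<bullet> w = (\<Sum>i\<in>UNIV. \<Sum>j\<in>UNIV. (M $ i $ j * v $ j) \<bullet> w $ i)"
    by (simp add: inner_vec_def matrix_vector_mult_def inner_sum_left)
  also have "\<dots> = (\<Sum>j\<in>UNIV. \<Sum>i\<in>UNIV. v $ j \<bullet> (cnj (M $ i $ j) * w $ i))"
    by (subst sum.swap) (simp add: inner_complex_def algebra_simps)
  also have "\<dots> = v \<bullet> (mat_adj M *v w)"
    by (simp add: inner_vec_def matrix_vector_mult_def mat_adj_def inner_sum_right)
  finally show ?thesis .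
qed

lemma opnorm_square_le: "(opnorm M)\<^sup>2 \<le> opnorm (mat_adj M ** M)"
proof -
  have "opnorm M \<le> sqrt (opnorm (mat_adj M ** M))"
  proof (rule opnorm_leI)
    fix v
    have "(norm (M *v v))\<^sup>2 = v \<bullet> ((mat_adj M ** M) *v v)"
      by (simp add: power2_norm_eq_inner inner_matrix_vector matrix_vector_mul_assoc)
    also have "\<dots> \<le> norm v * (opnorm (mat_adj M ** M) * norm v)"
      by (rule order_trans[OF norm_cauchy_schwarz])
         (intro mult_left_mono norm_matrix_vector_le norm_ge_zero)
    also have "\<dots> = (sqrt (opnorm (mat_adj M ** M)) * norm v)\<^sup>2"
      by (simp add: power_mult_distrib power2_eq_square)
    finally show "norm (M *v v) \<le> sqrt (opnorm (mat_adj M ** M)) * norm v"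
      by (rule power2_le_imp_le) simp
  qed
  then show ?thesis using power_mono[of "opnorm M" "sqrt (opnorm (mat_adj M ** M))" 2] by simp
qed

lemma opnorm_le_opnorm_adj: "opnorm M \<le> opnorm (mat_adj M)"
proof -
  have "opnorm M * opnorm M \<le> opnorm (mat_adj M) * opnorm M"
    using opnorm_square_le[of M] opnorm_mult[of "mat_adj M" M] by (simp add: power2_eq_square)
  then show ?thesis
    using opnorm_nonneg[of M] opnorm_nonneg[of "mat_adj M"] by (cases "opnorm M = 0") auto
qed

lemma opnorm_adj: "opnorm (mat_adj M) = opnorm M"
  using opnorm_le_opnorm_adj[of M] opnorm_le_opnorm_adj[of "mat_adj M"] by (simp add: matrix_simps)

lemma opnorm_adj_mult: "opnorm (mat_adj M ** M) = (opnorm M)\<^sup>2"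
  using opnorm_square_le[of M] opnorm_mult[of "mat_adj M" M]
  by (simp add: opnorm_adj power2_eq_square)

lemma entry_le_opnorm: "cmod (M $ i $ j) \<le> opnorm M"
proof -
  have "(M *v axis j 1) $ i = M $ i $ j"
    by (simp add: matrix_vector_mult_def axis_def if_distrib[of "\<lambda>x. _ * x"] cong: if_cong)
  then have "cmod (M $ i $ j) \<le> norm (M *v axis j 1)"
    using Finite_Cartesian_Product.norm_nth_le[of "M *v axis j 1" i] by simp
  also have "\<dots> \<le> opnorm M" using norm_matrix_vector_le[of M "axis j 1"] by simp
  finally show ?thesis .
qed

lemma opnorm_le_sum_entries: "opnorm M \<le> (\<Sum>i\<in>UNIV. \<Sum>j\<in>UNIV. cmod (M $ i $ j))"
proof (rule opnorm_leI)
  fix v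
  have "norm (M *v v) \<le> (\<Sum>i\<in>UNIV. cmod ((M *v v) $ i))"
    unfolding norm_vec_def by (rule L2_set_le_sum) simp
  also have "\<dots> \<le> (\<Sum>i\<in>UNIV. \<Sum>j\<in>UNIV. cmod (M $ i $ j) * norm v)"
    unfolding matrix_vector_mult_def vec_lambda_beta
    by (intro sum_mono sum_norm_le)
       (simp add: norm_mult Finite_Cartesian_Product.norm_nth_le mult_left_mono)
  finally show "norm (M *v v) \<le> (\<Sum>i\<in>UNIV. \<Sum>j\<in>UNIV. cmod (M $ i $ j)) * norm v"
    by (simp add: sum_distrib_right)
qed

lemma opnorm_le_norm: "opnorm (M :: complex^'n^'m) \<le> real (CARD('m) * CARD('n)) * norm M"
proof -
  have "cmod (M $ i $ j) \<le> norm M" for i j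
    using Finite_Cartesian_Product.norm_nth_le[of "M $ i" j]
      Finite_Cartesian_Product.norm_nth_le[of M i]
    by linarith
  then have "(\<Sum>i\<in>UNIV. \<Sum>j\<in>UNIV. cmod (M $ i $ j))
      \<le> (\<Sum>i\<in>(UNIV :: 'm set). \<Sum>j\<in>(UNIV :: 'n set). norm M)"
    by (intro sum_mono)
  then show ?thesis using opnorm_le_sum_entries[of M] by (simp add: mult.assoc)
qed

lemma cmod_trace_le: "cmod (trace M) \<le> real CARD('n) * opnorm M" for M :: "complex^'n^'n"
  using sum_norm_le[of UNIV "\<lambda>i. M $ i $ i" "\<lambda>_. opnorm M"] by (simp add: trace_def entry_le_opnorm)

lemma abs_opnorm_diff_le: "\<bar>opnorm M - opnorm N\<bar> \<le> opnorm (M - N)"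
proof -
  have "opnorm M \<le> opnorm (M - N) + opnorm N" "opnorm N \<le> opnorm (N - M) + opnorm M"
    using opnorm_triangle[of "M - N" N] opnorm_triangle[of "N - M" M] by simp_all
  then show ?thesis unfolding opnorm_diff_commute[of N M] by linarith
qed

lemma tendsto_opnorm:
  fixes X :: "nat \<Rightarrow> complex^'n^'m"
  assumes "X \<longlonglongrightarrow> M"
  shows "(\<lambda>k. opnorm (X k)) \<longlonglongrightarrow> opnorm M"
proof -
  let ?C = "real (CARD('m) * CARD('n))"
  have "(\<lambda>k. ?C * norm (X k - M)) \<longlonglongrightarrow> 0"
    by (intro tendsto_mult_right_zero tendsto_norm_zero LIM_zero assms)
  moreover have "\<forall>k. norm (opnorm (X k) - opnorm M) \<le> ?C * norm (X k - M)"
    unfolding real_norm_def using order_trans[OF abs_opnorm_diff_le opnorm_le_norm] by blast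
  ultimately have "(\<lambda>k. opnorm (X k) - opnorm M) \<longlonglongrightarrow> 0"
    by (rule Lim_null_comparison[OF always_eventually, rotated])
  then show ?thesis by (rule LIM_zero_cancel)
qed

lemma opnorm_Cauchy_limit:
  fixes X :: "nat \<Rightarrow> complex^'n^'m"
  assumes Cauchy: "\<And>e. 0 < e \<Longrightarrow> \<exists>N. \<forall>k\<ge>N. \<forall>l\<ge>N. opnorm (X k - X l) < e"
  obtains M where "X \<longlonglongrightarrow> M"
proof -
  have "convergent (\<lambda>k. X k $ i $ j)" for i j
  proof -
    have "Cauchy (\<lambda>k. X k $ i $ j)"
    proof (rule metric_CauchyI)
      fix e :: real assume "0 < e"
      then obtain N where N: "\<And>k l. k \<ge> N \<Longrightarrow> l \<ge> N \<Longrightarrow> opnorm (X k - X l) < e" using Cauchy by blast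
      have "dist (X k $ i $ j) (X l $ i $ j) < e" if "k \<ge> N" "l \<ge> N" for k l
        using N[OF that] entry_le_opnorm[of "X k - X l" i j] by (simp add: dist_norm)
      then show "\<exists>N. \<forall>k\<ge>N. \<forall>l\<ge>N. dist (X k $ i $ j) (X l $ i $ j) < e" by blast
    qed
    then show ?thesis by (simp add: Cauchy_convergent_iff)
  qed
  then obtain m where m: "\<And>i j. (\<lambda>k. X k $ i $ j) \<longlonglongrightarrow> m i j" unfolding convergent_def by metis
  have "X \<longlonglongrightarrow> (\<chi> i j. m i j)" by (intro vec_tendstoI) (simp add: m)
  then show thesis by (rule that)
qed

lemma opnorm_one_le: "opnorm (mat 1 :: complex^'n^'n) \<le> 1"
  by (rule opnorm_leI) simp

definition rank1 :: "real^'n \<Rightarrow> complex^'n^'n" where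
  "rank1 v = (\<chi> i j. of_real (v $ i * v $ j))"

lemma rank1_mult: "rank1 v ** rank1 w
    = mat_scale (of_real (v \<bullet> w)) (\<chi> i j. of_real (v $ i * w $ j))"
  by (simp add: rank1_def mat_scale_def matrix_matrix_mult_def inner_vec_def
      Finite_Cartesian_Product.vec_eq_iff sum_distrib_left sum_distrib_right mult_ac)

lemma mat_adj_rank1: "mat_adj (rank1 v) = rank1 v"
  by (simp add: rank1_def mat_adj_def Finite_Cartesian_Product.vec_eq_iff mult.commute)

lemma rank1_idempotent: "norm v = 1 \<Longrightarrow> rank1 v ** rank1 v = rank1 v"
  by (simp add: rank1_mult norm_eq_1 matrix_simps) (simp add: rank1_def)

lemma rank1_orthogonal: "v \<bullet> w = 0 \<Longrightarrow> rank1 v ** rank1 w = 0"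
  by (simp add: rank1_mult matrix_simps)

lemma trace_rank1: "norm v = 1 \<Longrightarrow> trace (rank1 v) = 1"
  by (simp add: trace_def rank1_def norm_eq_1 inner_vec_def flip: of_real_mult of_real_sum)

lemma opnorm_rank1:
  assumes v: "norm v = 1"
  shows "opnorm (rank1 v) = 1"
proof -
  have "(opnorm (rank1 v))\<^sup>2 = opnorm (rank1 v)"
    by (metis mat_adj_rank1 opnorm_adj_mult rank1_idempotent[OF v])
  moreover have "rank1 v \<noteq> 0" using trace_rank1[OF v] by (auto simp: trace_def)
  ultimately show ?thesis by (simp add: power2_eq_square)
qed

subsection \<open>Projections at a small angle\<close>

definition angle_sin :: "nat \<Rightarrow> real" where "angle_sin n = 1 / (real n + 2)"
definition angle_cos :: "nat \<Rightarrow> real" where "angle_cos n = sqrt (1 - (angle_sin n)\<^sup>2)"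

lemma angle_sin_pos: "0 < angle_sin n"
  by (simp add: angle_sin_def)

lemma angle_sin_cos: "angle_sin n * angle_sin n + angle_cos n * angle_cos n = 1"
proof -
  have "(angle_sin n)\<^sup>2 \<le> 1" by (simp add: angle_sin_def power_le_one)
  then show ?thesis by (simp add: angle_cos_def power2_eq_square)
qed

lemma angle_sin_tendsto: "angle_sin \<longlonglongrightarrow> 0"
  using LIMSEQ_ignore_initial_segment[OF lim_inverse_n, of 2]
  by (simp add: angle_sin_def[abs_def] inverse_eq_divide add.commute)

lemma inj_angle_sin: "inj angle_sin"
  by (auto simp: inj_def angle_sin_def)

definition proj_E :: "complex^2^2" where "proj_E = rank1 (vector [1, 0])"
definition proj_Q :: "nat \<Rightarrow> complex^2^2" where
  "proj_Q n = rank1 (vector [angle_sin n, angle_cos n])"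
definition proj_R :: "nat \<Rightarrow> complex^2^2" where
  "proj_R n = rank1 (vector [angle_cos n, - angle_sin n])"

lemma proj_vectors_unit:
  "norm (vector [1, 0] :: real^2) = 1" "norm (vector [angle_sin n, angle_cos n] :: real^2) = 1"
  "norm (vector [angle_cos n, - angle_sin n] :: real^2) = 1"
  using angle_sin_cos[of n] by (simp_all add: norm_eq_1 inner_vec_def sum_2)

lemma proj_simps:
  "proj_E ** proj_E = proj_E" "proj_Q n ** proj_Q n = proj_Q n" "proj_R n ** proj_R n = proj_R n"
  "mat_adj proj_E = proj_E" "mat_adj (proj_Q n) = proj_Q n" "mat_adj (proj_R n) = proj_R n"
  "opnorm proj_E = 1" "opnorm (proj_Q n) = 1" "trace proj_E = 1" "trace (proj_Q n) = 1"
  unfolding proj_E_def proj_Q_def proj_R_def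
  by (simp_all add: rank1_idempotent mat_adj_rank1 opnorm_rank1 trace_rank1 proj_vectors_unit)

lemma proj_Q_R_orthogonal: "proj_Q n ** proj_R n = 0" "proj_R n ** proj_Q n = 0"
  unfolding proj_Q_def proj_R_def by (simp_all add: rank1_orthogonal inner_vec_def sum_2)

lemma proj_E_Q_E: "proj_E ** proj_Q n ** proj_E = mat_scale (of_real ((angle_sin n)\<^sup>2)) proj_E"
  by (simp add: proj_E_def proj_Q_def rank1_def mat_scale_def matrix_matrix_mult_def
      Finite_Cartesian_Product.vec_eq_iff sum_2 power2_eq_square forall_2)

lemma opnorm_proj_Q_E: "opnorm (proj_Q n ** proj_E) = angle_sin n"
proof -
  have "mat_adj (proj_Q n ** proj_E) ** (proj_Q n ** proj_E) = proj_E ** proj_Q n ** proj_E"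
    by (simp add: matrix_simps proj_simps) (metis matrix_mul_assoc proj_simps(2))
  then have "(opnorm (proj_Q n ** proj_E))\<^sup>2 = (angle_sin n)\<^sup>2"
    using opnorm_adj_mult[of "proj_Q n ** proj_E"]
    by (simp add: proj_E_Q_E opnorm_scale proj_simps norm_power flip: of_real_power)
  then show ?thesis using angle_sin_pos[of n] by (simp add: power2_eq_iff_nonneg)
qed

lemma opnorm_proj_E_Q: "opnorm (proj_E ** proj_Q n) = angle_sin n"
  using opnorm_proj_Q_E[of n] opnorm_adj[of "proj_Q n ** proj_E"]
  by (simp add: matrix_simps proj_simps)

lemma opnorm_proj_R_minus_E: "opnorm (proj_R n - proj_E) \<le> angle_sin n"
proof -
  define s c where "s = complex_of_real (angle_sin n)" and "c = complex_of_real (angle_cos n)"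
  have sc: "s * s + c * c = 1"
    using angle_sin_cos[of n] unfolding s_def c_def by (metis of_real_1 of_real_add of_real_mult)
  define K :: "complex^2^2" where "K = vector [vector [- s, - c], vector [- c, s]]"
  have "mat_adj K = K"
    by (simp add: K_def mat_adj_def Finite_Cartesian_Product.vec_eq_iff forall_2 s_def c_def)
  moreover have "K ** K = mat 1"
    using sc
    by (simp add: K_def matrix_matrix_mult_def mat_def Finite_Cartesian_Product.vec_eq_iff forall_2
        sum_2 mult.commute add.commute)
  ultimately have "(opnorm K)\<^sup>2 \<le> 1"
    using opnorm_adj_mult[of K] opnorm_one_le[where ?'n=2] by simp
  then have K: "opnorm K \<le> 1" by (simp add: abs_square_le_1)
  have "c * c - 1 = - (s * s)" using sc by (simp add: algebra_simps)
  then have "proj_R n - proj_E = mat_scale s K"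
    by (simp add: K_def proj_R_def proj_E_def rank1_def mat_scale_def
        Finite_Cartesian_Product.vec_eq_iff forall_2 mult.commute flip: s_def c_def)
  then show ?thesis
    using K angle_sin_pos[of n] by (simp add: opnorm_scale s_def mult_left_le)
qed

section \<open>An LF algebra that is not AF\<close>

type_synonym 'k index = "'k \<times> 'k \<times> nat"

text \<open>\<open>proj_comb {} l\<close> is the combination \<open>\<Sum>\<^sub>\<xi> l(\<xi>) p\<^sub>\<xi>\<close> of projections \<open>p\<^sub>\<xi>\<close>, where \<open>p\<^sub>\<xi>\<close> takes
  the value \<open>proj_E\<close> at \<open>(\<xi>, \<eta>, n)\<close>, the value \<open>proj_Q n\<close> at \<open>(\<eta>, \<xi>, n)\<close> and \<open>0\<close> elsewhere.
  Distinct \<open>p\<^sub>\<xi>\<close>, \<open>p\<^sub>\<eta>\<close> are asymptotically orthogonal, but together they generate an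
  infinite-dimensional algebra. For \<open>\<xi>\<close>, \<open>\<eta>\<close> in a finite set \<open>K\<close>, replacing \<open>proj_E\<close> by the
  complement \<open>proj_R n\<close> of \<open>proj_Q n\<close> makes them exactly orthogonal, at the cost of a perturbation
  that vanishes as \<open>n\<close> grows.\<close>

definition proj_comb :: "'k set \<Rightarrow> ('k \<Rightarrow> complex) \<Rightarrow> 'k index \<Rightarrow> complex^2^2" where
  "proj_comb K l = (\<lambda>(x, y, n). if x = y then 0
     else mat_scale (l x) (if x \<in> K \<and> y \<in> K then proj_R n else proj_E) + mat_scale (l y) (proj_Q n))"

lemma proj_comb_add: "proj_comb K (\<lambda>x. l x + m x) i = proj_comb K l i + proj_comb K m i"
  and proj_comb_diff: "proj_comb K (\<lambda>x. l x - m x) i = proj_comb K l i - proj_comb K m i"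
  and proj_comb_scale: "proj_comb K (\<lambda>x. c * l x) i = mat_scale c (proj_comb K l i)"
  and proj_comb_cnj: "proj_comb K (\<lambda>x. cnj (l x)) i = mat_adj (proj_comb K l i)"
  and proj_comb_zero: "proj_comb K (\<lambda>x. 0) i = 0"
  by (cases i, simp add: proj_comb_def matrix_simps proj_simps)+

lemma proj_comb_mult:
  assumes "\<And>x. x \<notin> K \<Longrightarrow> l x = 0" "\<And>x. x \<notin> K \<Longrightarrow> m x = 0"
  shows "proj_comb K (\<lambda>x. l x * m x) i = proj_comb K l i ** proj_comb K m i"
proof -
  obtain x y n where i: "i = (x, y, n)" by (cases i)
  consider "x = y" | "x \<noteq> y" "x \<in> K" "y \<in> K" | "x \<noteq> y" "x \<notin> K" | "x \<noteq> y" "y \<notin> K" by blast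
  then show ?thesis
    by cases
       (use assms in \<open>simp_all add: i proj_comb_def matrix_simps proj_simps proj_Q_R_orthogonal
         mult_ac\<close>)
qed

lemma opnorm_proj_comb_le:
  assumes l: "\<And>x. cmod (l x) \<le> b"
  shows "opnorm (proj_comb {} l i) \<le> 2 * b"
proof -
  obtain x y n where i: "i = (x, y, n)" by (cases i)
  have "0 \<le> b" using l[of x] norm_ge_zero order_trans by blast
  then show ?thesis
    using opnorm_triangle[of "mat_scale (l x) proj_E" "mat_scale (l y) (proj_Q n)"] l[of x] l[of y]
    by (auto simp: i proj_comb_def opnorm_scale proj_simps)
qed

lemma finite_support_bounded:
  assumes "finite {x. l x \<noteq> (0 :: complex)}"
  obtains b where "0 \<le> b" "\<And>x. cmod (l x) \<le> b"
proof -
  have "cmod (l x) \<le> (\<Sum>x\<in>{x. l x \<noteq> 0}. cmod (l x))" for x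
  proof (cases "l x = 0")
    case False
    then show ?thesis using assms by (intro member_le_sum) auto
  qed (auto intro: sum_nonneg)
  then show thesis by (intro that[of "\<Sum>x\<in>{x. l x \<noteq> 0}. cmod (l x)"]) (auto intro: sum_nonneg)
qed

lemma eventually_angle_small:
  assumes K: "finite K" and e: "0 < e"
  shows "\<forall>\<^sub>F (x, y, n) in cofinite. x \<in> K \<and> y \<in> K \<longrightarrow> b * angle_sin n \<le> e"
proof -
  have "(\<lambda>n. b * angle_sin n) \<longlonglongrightarrow> 0" by (rule tendsto_mult_right_zero[OF angle_sin_tendsto])
  then have "\<forall>\<^sub>F n in sequentially. b * angle_sin n < e" using e by (rule order_tendstoD)
  then obtain N where "\<And>n. n \<ge> N \<Longrightarrow> b * angle_sin n < e" by (auto simp: eventually_sequentially)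
  then have "{i. \<not> (case i of (x, y, n) \<Rightarrow> x \<in> K \<and> y \<in> K \<longrightarrow> b * angle_sin n \<le> e)} \<subseteq> K \<times> K \<times> {..<N}"
    by (auto simp: not_le) (meson less_asym not_le)
  then show ?thesis
    unfolding eventually_cofinite using K by (elim finite_subset) simp
qed

lemma proj_comb_mult_near:
  assumes l: "finite {x. l x \<noteq> 0}" and m: "finite {x. m x \<noteq> 0}" and e: "0 < e"
  shows "\<forall>\<^sub>F i in cofinite.
    opnorm (proj_comb {} l i ** proj_comb {} m i - proj_comb {} (\<lambda>x. l x * m x) i) \<le> e"
proof -
  obtain b where b: "0 \<le> b" "\<And>x. cmod (l x) \<le> b" using finite_support_bounded[OF l] by blast
  obtain c where c: "0 \<le> c" "\<And>x. cmod (m x) \<le> c" using finite_support_bounded[OF m] by blast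
  define K where "K = {x. l x \<noteq> 0} \<union> {x. m x \<noteq> 0}"
  have "finite K" using l m by (simp add: K_def)
  from eventually_angle_small[OF this e, of "2 * (b * c)"] show ?thesis
  proof (rule eventually_mono)
    fix i :: "'a index"
    assume small: "case i of (x, y, n) \<Rightarrow> x \<in> K \<and> y \<in> K \<longrightarrow> 2 * (b * c) * angle_sin n \<le> e"
    obtain x y n where i: "i = (x, y, n)" by (cases i)
    define d where "d = proj_comb {} l i ** proj_comb {} m i - proj_comb {} (\<lambda>x. l x * m x) i"
    have d: "d = mat_scale (l x * m y) (proj_E ** proj_Q n)
        + mat_scale (l y * m x) (proj_Q n ** proj_E)" if "x \<noteq> y"
      using that by (simp add: d_def i proj_comb_def matrix_simps proj_simps mult_ac)
    consider "x = y" | "x \<noteq> y" "x \<in> K" "y \<in> K" | "x \<noteq> y" "x \<notin> K \<or> y \<notin> K" by blast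
    then have "opnorm d \<le> e"
    proof cases
      case 1
      then show ?thesis using e by (simp add: d_def i proj_comb_def)
    next
      case 2
      have "opnorm d \<le> cmod (l x) * cmod (m y) * angle_sin n
          + cmod (l y) * cmod (m x) * angle_sin n"
        using opnorm_triangle[of "mat_scale (l x * m y) (proj_E ** proj_Q n)"
            "mat_scale (l y * m x) (proj_Q n ** proj_E)"]
        by (simp add: d[OF 2(1)] opnorm_scale opnorm_proj_E_Q opnorm_proj_Q_E norm_mult)
      also have "\<dots> \<le> b * c * angle_sin n + b * c * angle_sin n"
        using b c angle_sin_pos[of n] by (intro add_mono mult_mono) (auto intro: less_imp_le)
      also have "\<dots> \<le> e" using small 2 by (simp add: i algebra_simps)
      finally show ?thesis .
    next
      case 3
      then have zero: "l x * m y = 0" "l y * m x = 0" by (auto simp: K_def)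
      have "d = 0" unfolding d[OF 3(1)] zero by (simp add: matrix_simps)
      then show ?thesis using e by simp
    qed
    then show "opnorm (proj_comb {} l i ** proj_comb {} m i - proj_comb {} (\<lambda>x. l x * m x) i) \<le> e"
      by (simp add: d_def)
  qed
qed

lemma proj_comb_near:
  assumes K: "finite K" and l: "\<And>x. cmod (l x) \<le> b" and e: "0 < e"
  shows "\<forall>\<^sub>F i in cofinite. opnorm (proj_comb K l i - proj_comb {} l i) \<le> e"
  using eventually_angle_small[OF K e, of b]
proof (rule eventually_mono)
  fix i assume small: "case i of (x, y, n) \<Rightarrow> x \<in> K \<and> y \<in> K \<longrightarrow> b * angle_sin n \<le> e"
  obtain x y n where i: "i = (x, y, n)" by (cases i)
  show "opnorm (proj_comb K l i - proj_comb {} l i) \<le> e"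
  proof (cases "x \<noteq> y \<and> x \<in> K \<and> y \<in> K")
    case True
    then have "proj_comb K l i - proj_comb {} l i = mat_scale (l x) (proj_R n - proj_E)"
      by (simp add: i proj_comb_def matrix_simps)
    also have "opnorm \<dots> \<le> b * angle_sin n"
      unfolding opnorm_scale using l[of x]
      by (intro mult_mono opnorm_proj_R_minus_E) (auto intro: order_trans[OF norm_ge_zero])
    also have "\<dots> \<le> e" using small True by (simp add: i)
    finally show ?thesis .
  next
    case False
    then have "proj_comb K l i = proj_comb {} l i" by (auto simp: i proj_comb_def)
    then show ?thesis using e by simp
  qed
qed

subsection \<open>The C*-algebra\<close>

definition approx_comb :: "('k index \<Rightarrow> complex^2^2) \<Rightarrow> real \<Rightarrow> ('k \<Rightarrow> complex) \<Rightarrow> bool" where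
  "approx_comb a e l \<longleftrightarrow> finite {x. l x \<noteq> 0} \<and>
      (\<forall>\<^sub>F i in cofinite. opnorm (a i - proj_comb {} l i) \<le> e)"

definition twisted_c0_carrier :: "('k index \<Rightarrow> complex^2^2) set" where
  "twisted_c0_carrier = {a. \<forall>e>0. \<exists>l. approx_comb a e l}"

definition supnorm :: "('i \<Rightarrow> complex^'n^'m) \<Rightarrow> real" where
  "supnorm a = (SUP i. opnorm (a i))"

definition twisted_c0 :: "('k index \<Rightarrow> complex^2^2) cstar_struct" where
  "twisted_c0 =
     \<lparr>carrier = twisted_c0_carrier, zer = 0, add = (+), smul = (\<lambda>c a i. mat_scale c (a i)),
      mul = (\<lambda>a b i. a i ** b i), star = (\<lambda>a i. mat_adj (a i)), nrm = supnorm\<rparr>"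

lemma twisted_c0_sel [simp]:
  "carrier twisted_c0 = twisted_c0_carrier" "zer twisted_c0 = 0" "add twisted_c0 a b = a + b"
  "smul twisted_c0 c a = (\<lambda>i. mat_scale c (a i))" "mul twisted_c0 a b = (\<lambda>i. a i ** b i)"
  "star twisted_c0 a = (\<lambda>i. mat_adj (a i))" "nrm twisted_c0 a = supnorm a"
  by (simp_all add: twisted_c0_def)

lemma twisted_c0_carrierD: "a \<in> twisted_c0_carrier \<Longrightarrow> 0 < e \<Longrightarrow> \<exists>l. approx_comb a e l"
  and twisted_c0_carrierI: "(\<And>e. 0 < e \<Longrightarrow> \<exists>l. approx_comb a e l) \<Longrightarrow> a \<in> twisted_c0_carrier"
  by (simp_all add: twisted_c0_carrier_def)

lemma approx_comb_finite_support: "approx_comb a e l \<Longrightarrow> finite {x. l x \<noteq> 0}"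
  by (simp add: approx_comb_def)

lemma approx_comb_mono: "approx_comb a d l \<Longrightarrow> d \<le> e \<Longrightarrow> approx_comb a e l"
  by (auto simp: approx_comb_def elim: eventually_mono)

lemma approx_comb_perturb:
  assumes a: "approx_comb a e l" and b: "\<forall>\<^sub>F i in cofinite. opnorm (b i - a i) \<le> d"
  shows "approx_comb b (d + e) l"
proof -
  have "\<forall>\<^sub>F i in cofinite. opnorm (a i - proj_comb {} l i) \<le> e"
    using a by (simp add: approx_comb_def)
  with b have "\<forall>\<^sub>F i in cofinite. opnorm (b i - proj_comb {} l i) \<le> d + e"
    by eventually_elim (meson add_mono opnorm_diff_triangle order_trans)
  then show ?thesis using a by (simp add: approx_comb_def)
qed

lemma approx_comb_proj_comb: "finite {x. l x \<noteq> 0} \<Longrightarrow> 0 \<le> e \<Longrightarrow> approx_comb (proj_comb {} l) e l"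
  by (simp add: approx_comb_def)

lemma approx_comb_add:
  assumes "approx_comb a d l" "approx_comb b e m"
  shows "approx_comb (a + b) (d + e) (\<lambda>x. l x + m x)"
proof -
  have "finite {x. l x + m x \<noteq> 0}"
    by (rule finite_subset[of _ "{x. l x \<noteq> 0} \<union> {x. m x \<noteq> 0}"])
       (use assms in \<open>auto simp: approx_comb_def\<close>)
  moreover have "\<forall>\<^sub>F i in cofinite. opnorm (a i - proj_comb {} l i) \<le> d"
      "\<forall>\<^sub>F i in cofinite. opnorm (b i - proj_comb {} m i) \<le> e"
    using assms by (simp_all add: approx_comb_def)
  then have "\<forall>\<^sub>F i in cofinite. opnorm ((a + b) i - proj_comb {} (\<lambda>x. l x + m x) i) \<le> d + e"
  proof eventually_elim
    case (elim i)
    then show ?case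
      using opnorm_triangle[of "a i - proj_comb {} l i" "b i - proj_comb {} m i"]
      by (simp add: proj_comb_add algebra_simps)
  qed
  ultimately show ?thesis by (simp add: approx_comb_def)
qed

lemma approx_comb_scale:
  assumes "approx_comb a e l"
  shows "approx_comb (\<lambda>i. mat_scale c (a i)) (cmod c * e) (\<lambda>x. c * l x)"
proof -
  have "finite {x. c * l x \<noteq> 0}"
    by (rule finite_subset[OF _ approx_comb_finite_support[OF assms]]) auto
  moreover have "opnorm (mat_scale c (a i) - proj_comb {} (\<lambda>x. c * l x) i)
      = cmod c * opnorm (a i - proj_comb {} l i)" for i
    by (simp add: proj_comb_scale opnorm_scale flip: mat_scale_diff_right)
  ultimately show ?thesis
    using assms by (auto simp: approx_comb_def elim!: eventually_mono intro: mult_left_mono)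
qed

lemma approx_comb_star:
  assumes "approx_comb a e l"
  shows "approx_comb (\<lambda>i. mat_adj (a i)) e (\<lambda>x. cnj (l x))"
proof -
  have "opnorm (mat_adj (a i) - proj_comb {} (\<lambda>x. cnj (l x)) i) = opnorm (a i - proj_comb {} l i)"
      for i
    unfolding proj_comb_cnj mat_adj_diff[symmetric] by (rule opnorm_adj)
  then show ?thesis using assms by (simp add: approx_comb_def)
qed

lemma approx_comb_mult:
  assumes a: "approx_comb a d l" and b: "approx_comb b e m" and pos: "0 \<le> d" "0 \<le> e" "0 < f"
    and B: "\<And>i. opnorm (b i) \<le> B" and c: "\<And>x. cmod (l x) \<le> c"
  shows "approx_comb (\<lambda>i. a i ** b i) (d * B + 2 * c * e + f) (\<lambda>x. l x * m x)"
proof -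
  have "finite {x. l x * m x \<noteq> 0}"
    by (rule finite_subset[OF _ approx_comb_finite_support[OF a]]) auto
  moreover have "\<forall>\<^sub>F i in cofinite. opnorm (a i - proj_comb {} l i) \<le> d"
      "\<forall>\<^sub>F i in cofinite. opnorm (b i - proj_comb {} m i) \<le> e"
    using a b by (simp_all add: approx_comb_def)
  with proj_comb_mult_near[OF approx_comb_finite_support[OF a] approx_comb_finite_support[OF b]
      pos(3)]
  have "\<forall>\<^sub>F i in cofinite. opnorm (a i ** b i - proj_comb {} (\<lambda>x. l x * m x) i)
      \<le> d * B + 2 * c * e + f"
  proof eventually_elim
    case (elim i)
    let ?l = "proj_comb {} l i" and ?m = "proj_comb {} m i"
    have "opnorm (a i ** b i - ?l ** ?m) \<le> opnorm ((a i - ?l) ** b i) + opnorm (?l ** (b i - ?m))"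
      using opnorm_triangle[of "(a i - ?l) ** b i" "?l ** (b i - ?m)"] by (simp add: matrix_simps)
    also have "opnorm ((a i - ?l) ** b i) \<le> d * B"
      using elim B pos by (intro order_trans[OF opnorm_mult] mult_mono) simp_all
    also have "opnorm (?l ** (b i - ?m)) \<le> 2 * c * e"
      using elim opnorm_proj_comb_le[OF c] order_trans[OF norm_ge_zero c]
      by (intro order_trans[OF opnorm_mult] mult_mono) simp_all
    finally show ?case
      using elim opnorm_diff_triangle[of "a i ** b i" "proj_comb {} (\<lambda>x. l x * m x) i" "?l ** ?m"]
      by simp
  qed
  ultimately show ?thesis by (simp add: approx_comb_def)
qed

lemma twisted_c0_bounded:
  assumes "a \<in> twisted_c0_carrier"
  obtains b where "0 \<le> b" "\<And>i. opnorm (a i) \<le> b"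
proof -
  obtain l where l: "approx_comb a 1 l" using twisted_c0_carrierD[OF assms, of 1] by auto
  obtain c where c: "0 \<le> c" "\<And>x. cmod (l x) \<le> c"
    using finite_support_bounded[OF approx_comb_finite_support[OF l]] by blast
  define L where "L = {i. \<not> opnorm (a i - proj_comb {} l i) \<le> 1}"
  have L: "finite L" using l by (simp add: L_def approx_comb_def eventually_cofinite)
  define s where "s = (\<Sum>i\<in>L. opnorm (a i))"
  have s: "0 \<le> s" by (simp add: s_def sum_nonneg)
  have "opnorm (a i) \<le> s + (1 + 2 * c)" for i
  proof (cases "i \<in> L")
    case True
    then have "opnorm (a i) \<le> s" unfolding s_def using L by (intro member_le_sum) auto
    then show ?thesis using c(1) by linarith
  next
    case False
    have "opnorm (a i) \<le> opnorm (a i - proj_comb {} l i) + opnorm (proj_comb {} l i)"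
      using opnorm_triangle[of "a i - proj_comb {} l i" "proj_comb {} l i"] by simp
    then show ?thesis using False opnorm_proj_comb_le[of l c i, OF c(2)] s by (simp add: L_def)
  qed
  then show thesis using that[of "s + (1 + 2 * c)"] s c(1) by auto
qed

lemma twisted_c0_carrier_zero: "0 \<in> twisted_c0_carrier"
  by (rule twisted_c0_carrierI, rule exI[of _ "\<lambda>_. 0"]) (simp add: approx_comb_def proj_comb_zero)

lemma twisted_c0_carrier_add:
  assumes "a \<in> twisted_c0_carrier" "b \<in> twisted_c0_carrier"
  shows "a + b \<in> twisted_c0_carrier"
proof (rule twisted_c0_carrierI)
  fix e :: real assume "0 < e"
  then obtain l m where "approx_comb a (e / 2) l" "approx_comb b (e / 2) m"
    using twisted_c0_carrierD[OF assms(1), of "e / 2"] twisted_c0_carrierD[OF assms(2), of "e / 2"]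
    by auto
  from approx_comb_add[OF this] show "\<exists>l. approx_comb (a + b) e l" by auto
qed

lemma twisted_c0_carrier_scale:
  assumes "a \<in> twisted_c0_carrier"
  shows "(\<lambda>i. mat_scale c (a i)) \<in> twisted_c0_carrier"
proof (cases "c = 0")
  case True
  then show ?thesis using twisted_c0_carrier_zero by (simp add: matrix_simps zero_fun_def)
next
  case False
  show ?thesis
  proof (rule twisted_c0_carrierI)
    fix e :: real assume "0 < e"
    then obtain l where "approx_comb a (e / cmod c) l"
      using twisted_c0_carrierD[OF assms, of "e / cmod c"] False by auto
    from approx_comb_scale[OF this, of c] show "\<exists>l. approx_comb (\<lambda>i. mat_scale c (a i)) e l"
      using False by auto
  qed
qed

lemma twisted_c0_carrier_diff:
  assumes "a \<in> twisted_c0_carrier" "b \<in> twisted_c0_carrier"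
  shows "a - b \<in> twisted_c0_carrier"
proof -
  have eq: "a - b = a + (\<lambda>i. mat_scale (-1) (b i))" by (simp add: fun_eq_iff matrix_simps)
  show ?thesis unfolding eq by (intro twisted_c0_carrier_add twisted_c0_carrier_scale assms)
qed

lemma twisted_c0_carrier_star: "a \<in> twisted_c0_carrier \<Longrightarrow> (\<lambda>i. mat_adj (a i)) \<in> twisted_c0_carrier"
  by (intro twisted_c0_carrierI) (metis approx_comb_star twisted_c0_carrierD)

lemma twisted_c0_carrier_mult:
  assumes "a \<in> twisted_c0_carrier" "b \<in> twisted_c0_carrier"
  shows "(\<lambda>i. a i ** b i) \<in> twisted_c0_carrier"
proof (rule twisted_c0_carrierI)
  fix e :: real assume e: "0 < e"
  have cancel: "e / (3 * s) * s = e / 3" if "s \<noteq> 0" for s :: real using that by simp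
  have third: "0 \<le> e / (3 * (t + 1))" "e / (3 * (t + 1)) * t \<le> e / 3"
      "t * (e / (3 * (t + 1))) \<le> e / 3"
    if "0 \<le> t" for t
  proof -
    show nonneg: "0 \<le> e / (3 * (t + 1))" using e that by simp
    have "e / (3 * (t + 1)) * t \<le> e / (3 * (t + 1)) * (t + 1)"
      using nonneg by (intro mult_left_mono) simp_all
    also have "\<dots> = e / 3" using that by (intro cancel) simp
    finally show "e / (3 * (t + 1)) * t \<le> e / 3" .
    then show "t * (e / (3 * (t + 1))) \<le> e / 3" by (subst mult.commute)
  qed
  obtain B where B: "0 \<le> B" "\<And>i. opnorm (b i) \<le> B" using twisted_c0_bounded[OF assms(2)] by blast
  obtain l where l: "approx_comb a (e / (3 * (B + 1))) l"
    using twisted_c0_carrierD[OF assms(1), of "e / (3 * (B + 1))"] e B(1) by auto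
  obtain c where c: "0 \<le> c" "\<And>x. cmod (l x) \<le> c"
    using finite_support_bounded[OF approx_comb_finite_support[OF l]] by blast
  obtain m where m: "approx_comb b (e / (3 * (2 * c + 1))) m"
    using twisted_c0_carrierD[OF assms(2), of "e / (3 * (2 * c + 1))"] e c(1) by auto
  have "approx_comb (\<lambda>i. a i ** b i)
      (e / (3 * (B + 1)) * B + 2 * c * (e / (3 * (2 * c + 1))) + e / 3) (\<lambda>x. l x * m x)"
    using third(1) e B(1) c(1) by (intro approx_comb_mult[OF l m _ _ _ B(2) c(2)]) simp_all
  moreover have "e / (3 * (B + 1)) * B + 2 * c * (e / (3 * (2 * c + 1))) + e / 3 \<le> e"
    using third(2)[OF B(1)] third(3)[of "2 * c"] c(1) by linarith
  ultimately have "approx_comb (\<lambda>i. a i ** b i) e (\<lambda>x. l x * m x)" by (rule approx_comb_mono)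
  then show "\<exists>l. approx_comb (\<lambda>i. a i ** b i) e l" by blast
qed

lemma supnorm_leI: "(\<And>i. opnorm (a i) \<le> e) \<Longrightarrow> supnorm a \<le> e"
  by (auto simp: supnorm_def intro: cSUP_least)

lemma opnorm_le_supnorm: "a \<in> twisted_c0_carrier \<Longrightarrow> opnorm (a i) \<le> supnorm a"
  unfolding supnorm_def by (rule cSUP_upper[OF UNIV_I]) (metis twisted_c0_bounded bdd_aboveI2)

lemma supnorm_nonneg: "a \<in> twisted_c0_carrier \<Longrightarrow> 0 \<le> supnorm a"
  using order_trans[OF opnorm_nonneg opnorm_le_supnorm[of a undefined]] by simp

lemma supnorm_eq_0:
  assumes a: "a \<in> twisted_c0_carrier"
  shows "supnorm a = 0 \<longleftrightarrow> a = 0"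
proof
  assume "supnorm a = 0"
  then have "opnorm (a i) = 0" for i
    using opnorm_le_supnorm[OF a, of i] opnorm_nonneg[of "a i"] by linarith
  then show "a = 0" by (simp add: fun_eq_iff)
qed (simp add: supnorm_def)

lemma supnorm_triangle:
  assumes "a \<in> twisted_c0_carrier" "b \<in> twisted_c0_carrier"
  shows "supnorm (a + b) \<le> supnorm a + supnorm b"
proof (rule supnorm_leI)
  show "opnorm ((a + b) i) \<le> supnorm a + supnorm b" for i
    using opnorm_triangle[of "a i" "b i"] opnorm_le_supnorm[OF assms(1), of i]
      opnorm_le_supnorm[OF assms(2), of i]
    by simp
qed

lemma supnorm_scale:
  assumes a: "a \<in> twisted_c0_carrier"
  shows "supnorm (\<lambda>i. mat_scale c (a i)) = cmod c * supnorm a"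
proof (rule antisym)
  show "supnorm (\<lambda>i. mat_scale c (a i)) \<le> cmod c * supnorm a"
    using opnorm_le_supnorm[OF a] by (intro supnorm_leI) (simp add: opnorm_scale mult_left_mono)
  show "cmod c * supnorm a \<le> supnorm (\<lambda>i. mat_scale c (a i))"
  proof (cases "c = 0")
    case False
    have "supnorm a \<le> supnorm (\<lambda>i. mat_scale c (a i)) / cmod c"
      using opnorm_le_supnorm[OF twisted_c0_carrier_scale[OF a], of c] False
      by (intro supnorm_leI) (simp add: opnorm_scale field_simps)
    then show ?thesis using False by (simp add: field_simps)
  qed (simp add: matrix_simps supnorm_def)
qed

lemma supnorm_mult:
  assumes "a \<in> twisted_c0_carrier" "b \<in> twisted_c0_carrier"
  shows "supnorm (\<lambda>i. a i ** b i) \<le> supnorm a * supnorm b"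
  using opnorm_le_supnorm[OF assms(1)] opnorm_le_supnorm[OF assms(2)] supnorm_nonneg[OF assms(1)]
  by (intro supnorm_leI order_trans[OF opnorm_mult] mult_mono) simp_all

lemma supnorm_star_mult:
  assumes a: "a \<in> twisted_c0_carrier"
  shows "supnorm (\<lambda>i. mat_adj (a i) ** a i) = (supnorm a)\<^sup>2"
proof (rule antisym)
  let ?aa = "\<lambda>i. mat_adj (a i) ** a i"
  have aa: "?aa \<in> twisted_c0_carrier"
    by (intro twisted_c0_carrier_mult twisted_c0_carrier_star a)
  show "supnorm ?aa \<le> (supnorm a)\<^sup>2"
    using opnorm_le_supnorm[OF a] by (intro supnorm_leI) (simp add: opnorm_adj_mult power_mono)
  have "supnorm a \<le> sqrt (supnorm ?aa)"
    using opnorm_le_supnorm[OF aa] by (intro supnorm_leI) (simp add: opnorm_adj_mult real_le_rsqrt)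
  then have "(supnorm a)\<^sup>2 \<le> (sqrt (supnorm ?aa))\<^sup>2" using supnorm_nonneg[OF a] by (rule power_mono)
  then show "(supnorm a)\<^sup>2 \<le> supnorm ?aa" using supnorm_nonneg[OF aa] by simp
qed

lemma cdist_twisted_c0: "cdist twisted_c0 a b = supnorm (a - b)"
  by (simp add: cdist_def matrix_simps plus_fun_def fun_diff_def)

lemma opnorm_le_cdist: "a \<in> twisted_c0_carrier \<Longrightarrow> b \<in> twisted_c0_carrier \<Longrightarrow>
    opnorm (a i - b i) \<le> cdist twisted_c0 a b"
  using opnorm_le_supnorm[OF twisted_c0_carrier_diff, of a b i] by (simp add: cdist_twisted_c0)

lemma cdist_twisted_c0_leI: "(\<And>i. opnorm (a i - b i) \<le> e) \<Longrightarrow> cdist twisted_c0 a b \<le> e"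
  by (simp add: cdist_twisted_c0 supnorm_leI)

lemma twisted_c0_uniform_limit:
  fixes f :: "nat \<Rightarrow> 'k index \<Rightarrow> complex^2^2"
  assumes f: "\<And>n. f n \<in> twisted_c0_carrier" and lim: "\<And>e. 0 < e \<Longrightarrow> \<exists>n. \<forall>i. opnorm (f n i - a i) \<le> e"
  shows "a \<in> twisted_c0_carrier"
proof (rule twisted_c0_carrierI)
  fix e :: real assume "0 < e"
  then have e: "0 < e / 2" by simp
  obtain n where n: "\<And>i. opnorm (f n i - a i) \<le> e / 2" using lim[OF e] by blast
  obtain l where "approx_comb (f n) (e / 2) l" using twisted_c0_carrierD[OF f e] by blast
  moreover have "opnorm (a i - f n i) \<le> e / 2" for i by (subst opnorm_diff_commute) (rule n)
  ultimately have "approx_comb a (e / 2 + e / 2) l"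
    by (intro approx_comb_perturb always_eventually allI)
  then show "\<exists>l. approx_comb a e l" by auto
qed

lemma twisted_c0_complete:
  fixes f :: "nat \<Rightarrow> 'k index \<Rightarrow> complex^2^2"
  assumes f: "\<And>n. f n \<in> twisted_c0_carrier"
    and Cauchy: "\<And>e. 0 < e \<Longrightarrow> \<exists>N. \<forall>m\<ge>N. \<forall>n\<ge>N. cdist twisted_c0 (f m) (f n) < e"
  shows "\<exists>a\<in>twisted_c0_carrier. \<forall>e>0. \<exists>N. \<forall>n\<ge>N. cdist twisted_c0 (f n) a < e"
proof -
  have "\<exists>M. (\<lambda>n. f n i) \<longlonglongrightarrow> M" for i
  proof -
    have pointwise: "\<exists>N. \<forall>m\<ge>N. \<forall>n\<ge>N. opnorm (f m i - f n i) < e" if "0 < e" for e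
      using Cauchy[OF that] opnorm_le_cdist[OF f f] by (meson le_less_trans)
    show ?thesis using opnorm_Cauchy_limit[OF pointwise] by blast
  qed
  then obtain a where a: "\<And>i. (\<lambda>n. f n i) \<longlonglongrightarrow> a i" by metis
  have near: "\<exists>N. \<forall>n\<ge>N. \<forall>i. opnorm (f n i - a i) \<le> e" if e: "0 < e" for e
  proof -
    obtain N where N: "\<And>m n. m \<ge> N \<Longrightarrow> n \<ge> N \<Longrightarrow> cdist twisted_c0 (f m) (f n) < e"
      using Cauchy[OF e] by blast
    have "opnorm (f n i - a i) \<le> e" if "n \<ge> N" for n i
    proof (rule Lim_bounded)
      show "(\<lambda>m. opnorm (f n i - f m i)) \<longlonglongrightarrow> opnorm (f n i - a i)"
        by (intro tendsto_opnorm tendsto_diff tendsto_const a)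
      show "\<forall>m\<ge>N. opnorm (f n i - f m i) \<le> e"
        using N[OF that] opnorm_le_cdist[OF f f, of n i] by (meson less_imp_le order_trans)
    qed
    then show ?thesis by blast
  qed
  have "a \<in> twisted_c0_carrier"
    by (rule twisted_c0_uniform_limit[of f]) (use f near order_refl in metis)+
  moreover have "\<exists>N. \<forall>n\<ge>N. cdist twisted_c0 (f n) a < e" if "0 < e" for e
  proof -
    have "0 < e / 2" using that by simp
    then obtain N where N: "\<And>n i. n \<ge> N \<Longrightarrow> opnorm (f n i - a i) \<le> e / 2" using near by blast
    have "cdist twisted_c0 (f n) a < e" if "n \<ge> N" for n
      using cdist_twisted_c0_leI[of "f n" a "e / 2"] N[OF that] \<open>0 < e\<close> by fastforce
    then show ?thesis by blast
  qed
  ultimately show ?thesis by blast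
qed

theorem cstar_algebra_twisted_c0:
  "cstar_algebra (twisted_c0 :: ('k index \<Rightarrow> complex^2^2) cstar_struct)"
proof -
  have complete: "\<forall>f :: nat \<Rightarrow> 'k index \<Rightarrow> complex^2^2. (\<forall>n. f n \<in> twisted_c0_carrier) \<longrightarrow>
      (\<forall>e>0. \<exists>N. \<forall>m\<ge>N. \<forall>n\<ge>N. cdist twisted_c0 (f m) (f n) < e) \<longrightarrow>
      (\<exists>a\<in>twisted_c0_carrier. \<forall>e>0. \<exists>N. \<forall>n\<ge>N. cdist twisted_c0 (f n) a < e)"
    using twisted_c0_complete by blast
  show ?thesis
    unfolding cstar_algebra_def twisted_c0_sel
    by (intro complete conjI ballI allI)
       (simp_all add: twisted_c0_carrier_zero twisted_c0_carrier_add twisted_c0_carrier_mult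
         twisted_c0_carrier_scale twisted_c0_carrier_star supnorm_eq_0 supnorm_triangle
         supnorm_scale supnorm_mult supnorm_star_mult,
        simp_all add: fun_eq_iff matrix_simps matrix_mul_assoc add_ac)
qed

subsection \<open>Local finite-dimensionality\<close>

global_interpretation families: vector_space "\<lambda>c (a :: 'i \<Rightarrow> complex^'n^'m) i. mat_scale c (a i)"
  by unfold_locales (simp_all add: fun_eq_iff matrix_simps)

lemma lin_span_twisted_c0: "lin_span twisted_c0 B = families.span B"
proof
  show "lin_span twisted_c0 B \<subseteq> families.span B"
  proof
    fix a assume "a \<in> lin_span twisted_c0 B"
    then show "a \<in> families.span B"
    proof induction
      case span_zero
      show ?case unfolding twisted_c0_sel by (rule families.span_zero)
    next
      case (span_base a)
      then show ?case by (rule families.span_base)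
    next
      case (span_add a b)
      then show ?case unfolding twisted_c0_sel by (intro families.span_add)
    next
      case (span_smul a c)
      then show ?case unfolding twisted_c0_sel by (intro families.span_scale)
    qed
  qed
  show "families.span B \<subseteq> lin_span twisted_c0 B"
  proof
    fix a assume "a \<in> families.span B"
    then show "a \<in> lin_span twisted_c0 B"
    proof (induction rule: families.span_induct_alt)
      case base
      show ?case using lin_span.span_zero[of twisted_c0 B] by (simp add: zero_fun_def)
    next
      case (step c a b)
      then show ?case
        using lin_span.span_add[OF lin_span.span_smul[OF lin_span.span_base, of a B twisted_c0 c], of b]
        by (simp add: plus_fun_def)
    qed
  qed
qed

lemma sum_family_apply: "(\<Sum>x\<in>X. f x) i = (\<Sum>x\<in>X. f x i)" for f :: "'x \<Rightarrow> 'i \<Rightarrow> complex^'n^'m"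
  by (induction X rule: infinite_finite_induct) simp_all

definition mat_unit :: "'m \<Rightarrow> 'n \<Rightarrow> complex^'n^'m" where
  "mat_unit p q = (\<chi> r s. if r = p \<and> s = q then 1 else 0)"

lemma matrix_eq_sum_mat_unit: "M = (\<Sum>p\<in>UNIV. \<Sum>q\<in>UNIV. mat_scale (M $ p $ q) (mat_unit p q))"
proof -
  have "(\<Sum>p\<in>UNIV. \<Sum>q\<in>UNIV. mat_scale (M $ p $ q) (mat_unit p q)) $ r $ s
      = (\<Sum>p\<in>UNIV. \<Sum>q\<in>UNIV. if s = q then if r = p then M $ p $ q else 0 else 0)" for r s
    unfolding sum_component mat_scale_def mat_unit_def vec_lambda_beta
    by (intro sum.cong refl) simp
  then show ?thesis by (simp add: Finite_Cartesian_Product.vec_eq_iff)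
qed

definition single_family :: "'i \<Rightarrow> complex^'n^'m \<Rightarrow> 'i \<Rightarrow> complex^'n^'m" where
  "single_family i M = (\<lambda>j. if j = i then M else 0)"

definition unit_families :: "'i set \<Rightarrow> ('i \<Rightarrow> complex^'n^'m) set" where
  "unit_families L = (\<lambda>(i, p, q). single_family i (mat_unit p q)) ` (L \<times> UNIV)"

lemma finite_unit_families: "finite L \<Longrightarrow> finite (unit_families L)"
  by (simp add: unit_families_def)

lemma finite_support_in_span_unit_families:
  fixes a :: "'i \<Rightarrow> complex^'n^'m"
  assumes L: "finite L" and a: "\<And>i. i \<notin> L \<Longrightarrow> a i = 0"
  shows "a \<in> families.span (unit_families L)"
proof -
  have single: "single_family i M \<in> families.span (unit_families L)"
    if "i \<in> L" for i and M :: "complex^'n^'m"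
  proof -
    have "single_family i M =
        (\<Sum>p\<in>UNIV. \<Sum>q\<in>UNIV. (\<lambda>j. mat_scale (M $ p $ q) (single_family i (mat_unit p q) j)))"
      using matrix_eq_sum_mat_unit[of M]
      by (auto simp: single_family_def fun_eq_iff sum_family_apply matrix_simps)
    moreover have "single_family i (mat_unit p q) \<in> families.span (unit_families L)" for p q
      using that
      by (intro families.span_base)
         (auto simp: unit_families_def intro!: image_eqI[of _ _ "(i, p, q)"])
    ultimately show ?thesis by (simp only:) (intro families.span_sum families.span_scale)
  qed
  have "a = (\<Sum>i\<in>L. single_family i (a i))"
    using L a by (simp add: fun_eq_iff sum_family_apply single_family_def)
  also have "\<dots> \<in> families.span (unit_families L)" by (intro families.span_sum single)
  finally show ?thesis .
qed

lemma proj_comb_sum: "proj_comb K (\<lambda>x. \<Sum>y\<in>Y. f y x) i = (\<Sum>y\<in>Y. proj_comb K (f y) i)"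
  by (induction Y rule: infinite_finite_induct) (simp_all add: proj_comb_zero proj_comb_add)

lemma proj_comb_eq_sum_units:
  assumes "finite K" "\<And>x. x \<notin> K \<Longrightarrow> l x = 0"
  shows "proj_comb K l i = (\<Sum>y\<in>K. mat_scale (l y) (proj_comb K (\<lambda>x. of_bool (x = y)) i))"
proof -
  have "l x = (\<Sum>y\<in>K. l y * of_bool (x = y))" for x using assms by (cases "x \<in> K") simp_all
  then have "proj_comb K l i = proj_comb K (\<lambda>x. \<Sum>y\<in>K. l y * of_bool (x = y)) i"
    by (intro arg_cong[where f="\<lambda>l. proj_comb K l i"] ext)
  also have "\<dots> = (\<Sum>y\<in>K. mat_scale (l y) (proj_comb K (\<lambda>x. of_bool (x = y)) i))"
    by (simp add: proj_comb_sum proj_comb_scale)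
  finally show ?thesis .
qed

definition twisted_fd :: "'k set \<Rightarrow> 'k index set \<Rightarrow> ('k index \<Rightarrow> complex^2^2) set" where
  "twisted_fd K L = {a. \<exists>l. (\<forall>x. x \<notin> K \<longrightarrow> l x = 0) \<and> (\<forall>i. i \<notin> L \<longrightarrow> a i = proj_comb K l i)}"

lemma twisted_fdI: "(\<And>x. x \<notin> K \<Longrightarrow> l x = 0) \<Longrightarrow> (\<And>i. i \<notin> L \<Longrightarrow> a i = proj_comb K l i) \<Longrightarrow>
    a \<in> twisted_fd K L"
  unfolding twisted_fd_def by blast

lemma twisted_fdE:
  assumes "a \<in> twisted_fd K L"
  obtains l where "\<And>x. x \<notin> K \<Longrightarrow> l x = 0" "\<And>i. i \<notin> L \<Longrightarrow> a i = proj_comb K l i"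
  using assms unfolding twisted_fd_def by blast

definition twisted_fd_generators :: "'k set \<Rightarrow> 'k index set \<Rightarrow> ('k index \<Rightarrow> complex^2^2) set" where
  "twisted_fd_generators K L =
     (\<lambda>x i. if i \<in> L then 0 else proj_comb K (\<lambda>z. of_bool (z = x)) i) ` K \<union> unit_families L"

lemma twisted_fd_generators_subset: "twisted_fd_generators K L \<subseteq> twisted_fd K L"
proof -
  have "(\<lambda>i. if i \<in> L then 0 else proj_comb K (\<lambda>z. of_bool (z = x)) i) \<in> twisted_fd K L"
      if "x \<in> K" for x
    using that by (intro twisted_fdI[of K "\<lambda>z. of_bool (z = x)"]) auto
  moreover have "single_family i M \<in> twisted_fd K L" if "i \<in> L" for i M
    using that by (intro twisted_fdI[of K "\<lambda>_. 0"]) (auto simp: single_family_def proj_comb_zero)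
  ultimately show ?thesis by (auto simp: twisted_fd_generators_def unit_families_def)
qed

lemma twisted_fd_subset_span:
  assumes K: "finite K" and L: "finite L"
  shows "twisted_fd K L \<subseteq> families.span (twisted_fd_generators K L)"
proof
  fix a assume "a \<in> twisted_fd K L"
  then obtain l where l: "\<And>x. x \<notin> K \<Longrightarrow> l x = 0" "\<And>i. i \<notin> L \<Longrightarrow> a i = proj_comb K l i"
    by (rule twisted_fdE) blast
  let ?span = "families.span (twisted_fd_generators K L)"
  let ?v = "\<lambda>x i. if i \<in> L then 0 else proj_comb K (\<lambda>z. of_bool (z = x)) i"
  have "(\<lambda>i. if i \<in> L then a i else 0) \<in> families.span (unit_families L)"
    by (rule finite_support_in_span_unit_families[OF L]) simp
  then have on_L: "(\<lambda>i. if i \<in> L then a i else 0) \<in> ?span"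
    using families.span_mono[of "unit_families L" "twisted_fd_generators K L"]
    by (auto simp: twisted_fd_generators_def)
  have "(\<lambda>i. if i \<in> L then 0 else a i) = (\<Sum>x\<in>K. (\<lambda>i. mat_scale (l x) (?v x i)))"
    using proj_comb_eq_sum_units[OF K l(1)] l(2)
    by (simp add: fun_eq_iff sum_family_apply matrix_simps)
  also have "\<dots> \<in> ?span"
    by (intro families.span_sum families.span_scale families.span_base)
       (auto simp: twisted_fd_generators_def)
  finally have off_L: "(\<lambda>i. if i \<in> L then 0 else a i) \<in> ?span" .
  have "a = (\<lambda>i. if i \<in> L then a i else 0) + (\<lambda>i. if i \<in> L then 0 else a i)"
    by (simp add: fun_eq_iff)
  also have "\<dots> \<in> ?span" by (rule families.span_add[OF on_L off_L])
  finally show "a \<in> ?span" .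
qed

lemma twisted_fd_subset_carrier:
  assumes K: "finite K" and L: "finite L"
  shows "twisted_fd K L \<subseteq> twisted_c0_carrier"
proof
  fix a assume "a \<in> twisted_fd K L"
  then obtain l where l: "\<And>x. x \<notin> K \<Longrightarrow> l x = 0" "\<And>i. i \<notin> L \<Longrightarrow> a i = proj_comb K l i"
    by (rule twisted_fdE) blast
  have fin: "finite {x. l x \<noteq> 0}" by (rule finite_subset[OF _ K]) (use l(1) in blast)
  obtain b where b: "\<And>x. cmod (l x) \<le> b" using finite_support_bounded[OF fin] by blast
  have a: "\<forall>\<^sub>F i in cofinite. a i = proj_comb K l i"
    unfolding eventually_cofinite by (rule finite_subset[OF _ L]) (use l(2) in blast)
  show "a \<in> twisted_c0_carrier"
  proof (rule twisted_c0_carrierI)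
    fix e :: real assume "0 < e"
    from proj_comb_near[OF K b this] a have "\<forall>\<^sub>F i in cofinite. opnorm (a i - proj_comb {} l i) \<le> e"
      by eventually_elim simp
    then show "\<exists>l. approx_comb a e l" using fin by (auto simp: approx_comb_def)
  qed
qed

lemma fd_subalgebra_twisted_fd:
  assumes K: "finite K" and L: "finite L"
  shows "fd_subalgebra twisted_c0 (twisted_fd K L)"
proof -
  have zero: "0 \<in> twisted_fd K L"
    by (rule twisted_fdI[of K "\<lambda>_. 0"]) (simp_all add: proj_comb_zero)
  have add: "a + b \<in> twisted_fd K L" and mult: "(\<lambda>i. a i ** b i) \<in> twisted_fd K L"
    if a: "a \<in> twisted_fd K L" and b: "b \<in> twisted_fd K L" for a b
  proof -
    obtain l where l: "\<And>x. x \<notin> K \<Longrightarrow> l x = 0" "\<And>i. i \<notin> L \<Longrightarrow> a i = proj_comb K l i"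
      by (rule twisted_fdE[OF a]) blast
    obtain m where m: "\<And>x. x \<notin> K \<Longrightarrow> m x = 0" "\<And>i. i \<notin> L \<Longrightarrow> b i = proj_comb K m i"
      by (rule twisted_fdE[OF b]) blast
    show "a + b \<in> twisted_fd K L"
      by (rule twisted_fdI[of K "\<lambda>x. l x + m x"]) (simp_all add: l m proj_comb_add)
    show "(\<lambda>i. a i ** b i) \<in> twisted_fd K L"
      by (rule twisted_fdI[of K "\<lambda>x. l x * m x"]) (simp_all add: l m proj_comb_mult[of K l m])
  qed
  have scale: "(\<lambda>i. mat_scale c (a i)) \<in> twisted_fd K L"
      and star: "(\<lambda>i. mat_adj (a i)) \<in> twisted_fd K L"
    if a: "a \<in> twisted_fd K L" for a c
  proof -
    obtain l where l: "\<And>x. x \<notin> K \<Longrightarrow> l x = 0" "\<And>i. i \<notin> L \<Longrightarrow> a i = proj_comb K l i"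
      by (rule twisted_fdE[OF a]) blast
    show "(\<lambda>i. mat_scale c (a i)) \<in> twisted_fd K L"
      by (rule twisted_fdI[of K "\<lambda>x. c * l x"]) (simp_all add: l proj_comb_scale)
    show "(\<lambda>i. mat_adj (a i)) \<in> twisted_fd K L"
      by (rule twisted_fdI[of K "\<lambda>x. cnj (l x)"]) (simp_all add: l proj_comb_cnj)
  qed
  have "finite (twisted_fd_generators K L)"
    using K L by (simp add: twisted_fd_generators_def finite_unit_families)
  then have "\<exists>B. finite B \<and> B \<subseteq> twisted_fd K L \<and> twisted_fd K L \<subseteq> lin_span twisted_c0 B"
    unfolding lin_span_twisted_c0 using twisted_fd_generators_subset twisted_fd_subset_span[OF K L]
    by blast
  then show ?thesis
    unfolding fd_subalgebra_def twisted_c0_sel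
    by (intro conjI ballI allI zero add mult scale star twisted_fd_subset_carrier[OF K L])
qed

lemma is_LF_twisted_c0: "is_LF (twisted_c0 :: ('k index \<Rightarrow> complex^2^2) cstar_struct)"
  unfolding is_LF_def twisted_c0_sel
proof (intro allI impI, elim conjE)
  fix F :: "('k index \<Rightarrow> complex^2^2) set" and e :: real
  assume F: "finite F" "F \<subseteq> twisted_c0_carrier" and "0 < e"
  then have third: "0 < e / 3" by simp
  have "\<forall>a\<in>F. \<exists>l. approx_comb a (e / 3) l" using F(2) twisted_c0_carrierD[OF _ third] by blast
  then obtain l where l: "\<And>a. a \<in> F \<Longrightarrow> approx_comb a (e / 3) (l a)" by metis
  define K where "K = (\<Union>a\<in>F. {x. l a x \<noteq> 0})"
  define L where "L = (\<Union>a\<in>F. {i. \<not> opnorm (a i - proj_comb K (l a) i) \<le> e / 3 + e / 3})"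
  have K: "finite K" using F(1) approx_comb_finite_support[OF l] by (simp add: K_def)
  have L: "finite L" unfolding L_def
  proof (intro finite_UN_I F(1))
    fix a assume a: "a \<in> F"
    obtain b where b: "\<And>x. cmod (l a x) \<le> b"
      using finite_support_bounded[OF approx_comb_finite_support[OF l[OF a]]] by blast
    have "\<forall>\<^sub>F i in cofinite. opnorm (a i - proj_comb {} (l a) i) \<le> e / 3"
      using l[OF a] by (simp add: approx_comb_def)
    with proj_comb_near[of K "l a", OF K b third]
    have "\<forall>\<^sub>F i in cofinite. opnorm (a i - proj_comb K (l a) i) \<le> e / 3 + e / 3"
    proof eventually_elim
      case (elim i)
      then show ?case
        using opnorm_diff_triangle[of "a i" "proj_comb K (l a) i" "proj_comb {} (l a) i"]
          opnorm_diff_commute[of "proj_comb K (l a) i" "proj_comb {} (l a) i"] by linarith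
    qed
    then show "finite {i. \<not> opnorm (a i - proj_comb K (l a) i) \<le> e / 3 + e / 3}"
      by (simp add: eventually_cofinite)
  qed
  have "\<exists>b\<in>twisted_fd K L. cdist twisted_c0 a b < e" if a: "a \<in> F" for a
  proof (rule bexI)
    let ?b = "\<lambda>i. if i \<in> L then a i else proj_comb K (l a) i"
    show "?b \<in> twisted_fd K L" using a by (intro twisted_fdI[of K "l a"]) (auto simp: K_def)
    have "cdist twisted_c0 a ?b \<le> e / 3 + e / 3"
      using a \<open>0 < e\<close> by (intro cdist_twisted_c0_leI) (auto simp: L_def)
    then show "cdist twisted_c0 a ?b < e" using \<open>0 < e\<close> by linarith
  qed
  then show "\<exists>D. fd_subalgebra twisted_c0 D \<and> approx_subset twisted_c0 e F D"
    using fd_subalgebra_twisted_fd[OF K L] unfolding approx_subset_def by blast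
qed

subsection \<open>Failure of AF\<close>

definition generator :: "'k \<Rightarrow> 'k index \<Rightarrow> complex^2^2" where
  "generator x = proj_comb {} (\<lambda>z. of_bool (z = x))"

lemma generator_carrier: "generator x \<in> twisted_c0_carrier"
  unfolding generator_def
  by (intro twisted_c0_carrierI exI[of _ "\<lambda>z. of_bool (z = x)"] approx_comb_proj_comb) simp_all

lemma generator_left: "x \<noteq> y \<Longrightarrow> generator x (x, y, n) = proj_E"
  and generator_right: "x \<noteq> y \<Longrightarrow> generator y (x, y, n) = proj_Q n"
  and generator_other: "z \<noteq> x \<Longrightarrow> z \<noteq> y \<Longrightarrow> generator z (x, y, n) = 0"
  by (auto simp: generator_def proj_comb_def matrix_simps)

lemma trace_mat_scale: "trace (mat_scale c M) = c * trace M"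
  by (simp add: trace_def mat_scale_def sum_distrib_left)

lemma mat_scale_sum_left: "mat_scale (\<Sum>x\<in>X. f x) M = (\<Sum>x\<in>X. mat_scale (f x) M)"
  by (induction X rule: infinite_finite_induct) (simp_all add: matrix_simps)

lemma near_multiples_imp_multiple:
  fixes X P :: "'i \<Rightarrow> complex^'n^'n"
  assumes P: "\<And>i. trace (P i) = 1" "\<And>i. opnorm (P i) = 1"
    and near: "\<And>e. 0 < e \<Longrightarrow> \<exists>c. \<forall>i. opnorm (X i - mat_scale c (P i)) \<le> e"
  shows "\<exists>c. \<forall>i. X i = mat_scale c (P i)"
proof -
  define c where "c = trace (X undefined)"
  have "opnorm (X i - mat_scale c (P i)) \<le> 0 + e" if "0 < e" for i e
  proof -
    define d where "d = e / (1 + real CARD('n))"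
    have d_pos: "0 < d" using that by (simp add: d_def add_pos_nonneg)
    have "d + real CARD('n) * d = d * (1 + real CARD('n))" by (simp add: algebra_simps)
    also have "\<dots> = e" by (simp add: d_def add_nonneg_eq_0_iff)
    finally have d_sum: "d + real CARD('n) * d = e" .
    obtain c' where c': "\<And>i. opnorm (X i - mat_scale c' (P i)) \<le> d" using near[OF d_pos] by blast
    have "cmod (c - c') = cmod (trace (X undefined - mat_scale c' (P undefined)))"
      by (simp add: c_def trace_sub trace_mat_scale P)
    also have "\<dots> \<le> real CARD('n) * d"
      using c'[of undefined] by (intro order_trans[OF cmod_trace_le] mult_left_mono) simp_all
    finally have "opnorm (mat_scale c' (P i) - mat_scale c (P i)) \<le> real CARD('n) * d"
      by (simp add: opnorm_scale P norm_minus_commute flip: mat_scale_diff_left)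
    then show ?thesis
      using opnorm_diff_triangle[of "X i" "mat_scale c (P i)" "mat_scale c' (P i)"] c'[of i] d_sum
      by simp
  qed
  then have "opnorm (X i - mat_scale c (P i)) \<le> 0" for i by (rule field_le_epsilon)
  then have "opnorm (X i - mat_scale c (P i)) = 0" for i by (meson antisym opnorm_nonneg)
  then show ?thesis by auto
qed

definition supported_on :: "('k index \<Rightarrow> complex^2^2) \<Rightarrow> 'k set \<Rightarrow> bool" where
  "supported_on a C \<longleftrightarrow> (\<forall>x y. x \<noteq> y \<longrightarrow>
     (y \<notin> C \<longrightarrow> (\<exists>c. \<forall>n. a (x, y, n) = mat_scale c proj_E)) \<and>
     (x \<notin> C \<longrightarrow> (\<exists>c. \<forall>n. a (x, y, n) = mat_scale c (proj_Q n))))"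

lemma supported_onD:
  assumes "supported_on a C" "x \<noteq> y"
  shows "y \<notin> C \<Longrightarrow> \<exists>c. \<forall>n. a (x, y, n) = mat_scale c proj_E"
    and "x \<notin> C \<Longrightarrow> \<exists>c. \<forall>n. a (x, y, n) = mat_scale c (proj_Q n)"
  using assms unfolding supported_on_def by simp_all

lemma countable_support_exists:
  fixes a :: "'k index \<Rightarrow> complex^2^2"
  assumes a: "a \<in> twisted_c0_carrier"
  shows "\<exists>C. countable C \<and> supported_on a C"
proof -
  have "\<forall>k. \<exists>l. approx_comb a (1 / real (Suc k)) l" using twisted_c0_carrierD[OF a] by simp
  then obtain l where l: "\<And>k. approx_comb a (1 / real (Suc k)) (l k)" by metis
  define L where "L k = {i. \<not> opnorm (a i - proj_comb {} (l k) i) \<le> 1 / real (Suc k)}" for k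
  define C where "C = (\<Union>k. {x. l k x \<noteq> 0} \<union> fst ` L k \<union> (fst \<circ> snd) ` L k)"
  have L: "finite (L k)" for k
    using l[of k] by (simp add: L_def approx_comb_def eventually_cofinite)
  have near: "\<exists>m. (x \<notin> C \<longrightarrow> m x = 0) \<and> (y \<notin> C \<longrightarrow> m y = 0) \<and>
      (\<forall>n. opnorm (a (x, y, n) - proj_comb {} m (x, y, n)) \<le> e)"
    if xy: "x \<notin> C \<or> y \<notin> C" and "0 < e" for x y e
  proof -
    obtain k where k: "1 / real (Suc k) < e" using nat_approx_posE[OF \<open>0 < e\<close>] by blast
    have "(x, y, n) \<notin> L k" for n using xy by (force simp: C_def)
    then have "opnorm (a (x, y, n) - proj_comb {} (l k) (x, y, n)) \<le> e" for n
      using k unfolding L_def by (metis (mono_tags, lifting) less_imp_le mem_Collect_eq order_trans)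
    then show ?thesis by (intro exI[of _ "l k"]) (auto simp: C_def)
  qed
  show ?thesis
    unfolding supported_on_def
  proof (intro exI[of _ C] conjI allI impI)
    show "countable C"
      unfolding C_def using L approx_comb_finite_support[OF l]
      by (intro countable_UN) (simp_all add: countable_finite)
    show "\<exists>c. \<forall>n. a (x, y, n) = mat_scale c proj_E" if xy: "x \<noteq> y" "y \<notin> C" for x y
    proof (rule near_multiples_imp_multiple)
      fix e :: real assume "0 < e"
      then obtain m where m: "m y = 0" "\<And>n. opnorm (a (x, y, n) - proj_comb {} m (x, y, n)) \<le> e"
        using near[of x y e] xy(2) by blast
      then show "\<exists>c. \<forall>n. opnorm (a (x, y, n) - mat_scale c proj_E) \<le> e"
        using xy(1) by (intro exI[of _ "m x"]) (simp add: proj_comb_def matrix_simps)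
    qed (simp_all add: proj_simps)
    show "\<exists>c. \<forall>n. a (x, y, n) = mat_scale c (proj_Q n)" if xy: "x \<noteq> y" "x \<notin> C" for x y
    proof (rule near_multiples_imp_multiple)
      fix e :: real assume "0 < e"
      then obtain m where m: "m x = 0" "\<And>n. opnorm (a (x, y, n) - proj_comb {} m (x, y, n)) \<le> e"
        using near[of x y e] xy(2) by blast
      then show "\<exists>c. \<forall>n. opnorm (a (x, y, n) - mat_scale c (proj_Q n)) \<le> e"
        using xy(1) by (intro exI[of _ "m y"]) (simp add: proj_comb_def matrix_simps)
    qed (simp_all add: proj_simps)
  qed
qed

lemma subset_of_card_aleph1:
  assumes "(aleph1, card_of (UNIV :: 'k set)) \<in> ordLess"
  obtains X :: "'k set" where "(card_of X, aleph1) \<in> ordIso"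
proof -
  have Card: "Card_order aleph1" by (rule cardSuc_Card_order[OF natLeq_Card_order])
  have "(card_of (Field aleph1), card_of (UNIV :: 'k set)) \<in> ordLeq"
    using assms card_of_Field_ordIso[OF Card] ordIso_ordLess_trans ordLess_imp_ordLeq by blast
  then obtain g :: "nat set \<Rightarrow> 'k" where "inj_on g (Field aleph1)"
    using card_of_ordLeq[of "Field aleph1" "UNIV :: 'k set"] by blast
  then have "(card_of (Field aleph1), card_of (g ` Field aleph1)) \<in> ordIso"
    using card_of_ordIso inj_on_imp_bij_betw by blast
  then have "(card_of (g ` Field aleph1), aleph1) \<in> ordIso"
    using card_of_Field_ordIso[OF Card] ordIso_symmetric ordIso_transitive by blast
  then show thesis by (rule that)
qed

text \<open>\<open>y\<close> is chosen outside the union of the sets \<open>f x\<close> for \<open>\<aleph>\<^sub>1\<close> many \<open>x\<close>, and then \<open>x\<close> among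
  these outside \<open>f y\<close>.\<close>

lemma free_pair_exists:
  fixes f :: "'k \<Rightarrow> 'k set"
  assumes big: "(aleph1, card_of (UNIV :: 'k set)) \<in> ordLess" and f: "\<And>x. countable (f x)"
  obtains x y where "x \<noteq> y" "x \<notin> f y" "y \<notin> f x"
proof -
  obtain X :: "'k set" where X: "(card_of X, aleph1) \<in> ordIso"
    using subset_of_card_aleph1[OF big] by blast
  have "(card_of (\<Union>x\<in>X. insert x (f x)), aleph1) \<in> ordLeq"
  proof (rule card_of_UNION_ordLeq_infinite_Field)
    show "(card_of X, aleph1) \<in> ordLeq" using X by (rule ordIso_imp_ordLeq)
    show "\<forall>x\<in>X. (card_of (insert x (f x)), aleph1) \<in> ordLeq"
      using f by (simp add: countable_ordLess_aleph1 ordLess_imp_ordLeq)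
  qed (rule infinite_Field_aleph1, rule cardSuc_Card_order[OF natLeq_Card_order])
  then have "(\<Union>x\<in>X. insert x (f x)) \<noteq> UNIV"
    using big ordLeq_ordLess_trans ordLess_irreflexive by metis
  then obtain y where y: "y \<notin> (\<Union>x\<in>X. insert x (f x))" by blast
  have "\<not> X \<subseteq> f y"
    using countable_ordLess_aleph1[OF countable_subset[OF _ f]] X not_ordLess_ordIso by blast
  then obtain x where "x \<in> X" "x \<notin> f y" by blast
  then show thesis using y by (intro that[of x y]) auto
qed

lemma finite_range_in_fd_subalgebra:
  assumes D: "fd_subalgebra twisted_c0 D" and w: "w \<in> D" "\<And>n. w (x, y, n) = mat_scale (z n) proj_E"
  shows "finite (range z)"
proof -
  define v where "v k = ((\<lambda>a i. a i ** w i) ^^ k) w" for k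
  have v_mem: "v k \<in> D" for k
    by (induction k) (use w(1) D in \<open>auto simp: v_def fd_subalgebra_def\<close>)
  have v: "v k (x, y, n) = mat_scale (z n ^ Suc k) proj_E" for k n
    by (induction k) (simp_all add: v_def w(2) matrix_simps proj_simps mult_ac)
  obtain B where B: "finite B" "D \<subseteq> families.span B"
    using D by (auto simp: fd_subalgebra_def lin_span_twisted_c0)
  obtain p where p: "p \<noteq> 0" "(\<Sum>k\<le>degree p. (\<lambda>i. mat_scale (coeff p k) (v k i))) = 0"
    using families.span_poly_relation[OF B(1), of v] B(2) v_mem by blast
  have "z n * poly p (z n) = 0" for n
  proof -
    have "mat_scale (z n * poly p (z n)) proj_E
        = (\<Sum>k\<le>degree p. mat_scale (coeff p k) (v k (x, y, n)))"
      by (simp add: v poly_altdef sum_distrib_left mat_scale_sum_left matrix_simps mult_ac)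
    also have "\<dots> = 0" using fun_cong[OF p(2), of "(x, y, n)"] by (simp add: sum_family_apply)
    finally have "opnorm (mat_scale (z n * poly p (z n)) proj_E) = 0" by simp
    then show ?thesis by (simp add: opnorm_scale proj_simps)
  qed
  then have "range z \<subseteq> insert 0 {c. poly p c = 0}" by auto
  then show ?thesis using poly_roots_finite[OF p(1)] finite_subset by blast
qed

lemma near_generator_nonzero:
  assumes a: "a \<in> twisted_c0_carrier" "cdist twisted_c0 (generator z) a < 1 / 2"
    and i: "opnorm (generator z i) = 1"
  shows "a i \<noteq> 0"
proof
  assume "a i = 0"
  then have "opnorm (generator z i - a i) = 1" using i by simp
  then show False using opnorm_le_cdist[OF generator_carrier[of z] a(1), of i] a(2) by simp
qed

text \<open>If \<open>a\<close> and \<open>b\<close> approximate \<open>p\<^sub>x\<close> and \<open>p\<^sub>y\<close>, and their countable supports avoid \<open>y\<close> and \<open>x\<close>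
  respectively, then \<open>a b a\<close> takes infinitely many scalar multiples of \<open>proj_E\<close> as values.\<close>

lemma not_in_common_fd_subalgebra:
  assumes D: "fd_subalgebra twisted_c0 D" "a \<in> D" "b \<in> D" and xy: "x \<noteq> y"
    and near: "cdist twisted_c0 (generator x) a < 1 / 2" "cdist twisted_c0 (generator y) b < 1 / 2"
    and a: "\<And>n. a (x, y, n) = mat_scale \<mu> proj_E" and b: "\<And>n. b (x, y, n) = mat_scale \<nu> (proj_Q n)"
  shows False
proof -
  have carrier: "a \<in> twisted_c0_carrier" "b \<in> twisted_c0_carrier"
    using D by (auto simp: fd_subalgebra_def)
  have "\<mu> \<noteq> 0"
    using near_generator_nonzero[OF carrier(1) near(1), of "(x, y, 0)"] xy
    by (auto simp: a generator_left proj_simps matrix_simps)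
  have "\<nu> \<noteq> 0"
    using near_generator_nonzero[OF carrier(2) near(2), of "(x, y, 0)"] xy
    by (auto simp: b generator_right proj_simps matrix_simps)
  define z where "z n = \<mu> * \<nu> * \<mu> * of_real ((angle_sin n)\<^sup>2)" for n
  have "inj z"
  proof
    fix m n assume "z m = z n"
    then have "(angle_sin m)\<^sup>2 = (angle_sin n)\<^sup>2"
      using \<open>\<mu> \<noteq> 0\<close> \<open>\<nu> \<noteq> 0\<close> by (simp add: z_def flip: of_real_power)
    then have "angle_sin m = angle_sin n"
      using angle_sin_pos[of m] angle_sin_pos[of n] by (simp add: power2_eq_iff_nonneg)
    then show "m = n" using inj_angle_sin by (simp add: inj_def)
  qed
  have "(\<lambda>i. a i ** b i ** a i) \<in> D" using D by (simp add: fd_subalgebra_def)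
  moreover have "a (x, y, n) ** b (x, y, n) ** a (x, y, n) = mat_scale (z n) proj_E" for n
  proof -
    have "a (x, y, n) ** b (x, y, n) ** a (x, y, n)
        = mat_scale (\<mu> * \<nu> * \<mu>) (proj_E ** proj_Q n ** proj_E)"
      by (simp add: a b matrix_simps mult_ac)
    then show ?thesis by (simp add: proj_E_Q_E matrix_simps z_def)
  qed
  ultimately have "finite (range z)" by (rule finite_range_in_fd_subalgebra[OF D(1)])
  then show False using \<open>inj z\<close> range_inj_infinite by blast
qed

theorem not_is_AF_twisted_c0:
  assumes big: "(aleph1, card_of (UNIV :: 'k set)) \<in> ordLess"
  shows "\<not> is_AF (twisted_c0 :: ('k index \<Rightarrow> complex^2^2) cstar_struct)"
proof
  assume "is_AF (twisted_c0 :: ('k index \<Rightarrow> complex^2^2) cstar_struct)"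
  then obtain \<D> :: "('k index \<Rightarrow> complex^2^2) set set"
    where fd: "\<And>D. D \<in> \<D> \<Longrightarrow> fd_subalgebra twisted_c0 D"
      and directed: "\<And>D\<^sub>1 D\<^sub>2. D\<^sub>1 \<in> \<D> \<Longrightarrow> D\<^sub>2 \<in> \<D> \<Longrightarrow> \<exists>D\<^sub>3\<in>\<D>. D\<^sub>1 \<union> D\<^sub>2 \<subseteq> D\<^sub>3"
      and dense: "dense_in twisted_c0 (\<Union>\<D>)"
    unfolding is_AF_def by metis
  have "\<exists>a\<in>\<Union>\<D>. cdist twisted_c0 (generator x) a < 1 / 2" for x :: 'k
    by (rule dense_inD[OF dense]) (simp_all add: generator_carrier)
  then obtain a where a: "\<And>x. a x \<in> \<Union>\<D>"
      and near: "\<And>x :: 'k. cdist twisted_c0 (generator x) (a x) < 1 / 2"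
    by metis
  have carrier: "a x \<in> twisted_c0_carrier" for x using a dense by (auto simp: dense_in_def)
  obtain C where C: "\<And>x. countable (C x)" "\<And>x. supported_on (a x) (C x)"
    using countable_support_exists[OF carrier] by metis
  obtain x y where xy: "x \<noteq> y" "x \<notin> C y" "y \<notin> C x" by (rule free_pair_exists[OF big C(1)])
  obtain \<mu> where \<mu>: "\<And>n. a x (x, y, n) = mat_scale \<mu> proj_E"
    using supported_onD(1)[OF C(2) xy(1,3)] by blast
  obtain \<nu> where \<nu>: "\<And>n. a y (x, y, n) = mat_scale \<nu> (proj_Q n)"
    using supported_onD(2)[OF C(2) xy(1,2)] by blast
  obtain D\<^sub>1 D\<^sub>2 where D12: "D\<^sub>1 \<in> \<D>" "a x \<in> D\<^sub>1" "D\<^sub>2 \<in> \<D>" "a y \<in> D\<^sub>2"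
    using a[of x] a[of y] by blast
  obtain D where D: "D \<in> \<D>" "D\<^sub>1 \<union> D\<^sub>2 \<subseteq> D" using directed[OF D12(1,3)] by blast
  then have "a x \<in> D" "a y \<in> D" using D12(2,4) by auto
  then show False by (rule not_in_common_fd_subalgebra[OF fd[OF D(1)] _ _ xy(1) near near \<mu> \<nu>])
qed

subsection \<open>The density character\<close>

lemma card_of_lists_ordLeq_infinite_Field:
  fixes X :: "'b set"
  assumes inf: "infinite (Field r)" and r: "Card_order r" and X: "(card_of X, r) \<in> ordLeq"
  shows "(card_of (lists X), r) \<in> ordLeq"
proof -
  have length: "(card_of {xs \<in> lists X. length xs = n}, r) \<in> ordLeq" for n
  proof (induction n)
    case 0
    have "Field r \<noteq> {}" using inf by auto
    then have "(card_of {[] :: 'b list}, r) \<in> ordLeq"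
      by (rule ordLeq_ordIso_trans[OF card_of_singl_ordLeq card_of_Field_ordIso[OF r]])
    moreover have "{xs \<in> lists X. length xs = 0} = {[]}" by auto
    ultimately show ?case by simp
  next
    case (Suc n)
    have eq: "{xs \<in> lists X. length xs = Suc n}
        = (\<lambda>(x, xs). x # xs) ` (X \<times> {xs \<in> lists X. length xs = n})"
      by (auto simp: length_Suc_conv image_iff)
    show ?case
      unfolding eq
      by (rule
          ordLeq_transitive[OF card_of_image card_of_Times_ordLeq_infinite_Field[OF inf X Suc r]])
  qed
  have "lists X = (\<Union>n. {xs \<in> lists X. length xs = n})" by auto
  moreover have "(natLeq, r) \<in> ordLeq"
    using inf r by (intro natLeq_ordLeq_cinfinite) (simp add: cinfinite_def)
  then have "(card_of (UNIV :: nat set), r) \<in> ordLeq" by (rule ordIso_ordLeq_trans[OF card_of_nat])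
  then have "(card_of (\<Union>n. {xs \<in> lists X. length xs = n}), r) \<in> ordLeq"
    using length by (intro card_of_UNION_ordLeq_infinite_Field[OF inf r]) simp_all
  ultimately show ?thesis by simp
qed

lemma card_of_countable_ordLeq_infinite_Field:
  assumes "infinite (Field r)" "Card_order r" "countable C"
  shows "(card_of C, r) \<in> ordLeq"
proof -
  have "(card_of C, natLeq) \<in> ordLeq"
    using assms(3) card_of_ordLeq[of C "UNIV :: nat set"] card_of_nat ordLeq_ordIso_trans
    by (auto simp: countable_def)
  moreover have "(natLeq, r) \<in> ordLeq"
    using assms(1,2) by (intro natLeq_ordLeq_cinfinite) (simp add: cinfinite_def)
  ultimately show ?thesis by (rule ordLeq_transitive)
qed

lemma card_of_index_ordLeq:
  assumes "infinite (UNIV :: 'k set)"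
  shows "(card_of (UNIV :: 'k index set), card_of (UNIV :: 'k set)) \<in> ordLeq"
proof -
  let ?r = "card_of (UNIV :: 'k set)"
  have Field: "infinite (Field ?r)" using assms by (simp add: Field_card_of)
  have k: "(?r, ?r) \<in> ordLeq" by (rule ordLeq_refl[OF card_of_Card_order])
  have "(card_of ((UNIV :: 'k set) \<times> (UNIV :: 'k set) \<times> (UNIV :: nat set)), ?r) \<in> ordLeq"
    by (intro card_of_Times_ordLeq_infinite_Field[OF Field]
        card_of_countable_ordLeq_infinite_Field[OF Field] k
        card_of_Card_order countableI_type)
  then show ?thesis by simp
qed

definition patch :: "('a \<Rightarrow> 'b) \<Rightarrow> ('a \<times> 'b) list \<Rightarrow> 'a \<Rightarrow> 'b" where
  "patch f xs x = (case map_of xs x of None \<Rightarrow> f x | Some c \<Rightarrow> c)"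

lemma patch_graph: "patch f (map (\<lambda>x. (x, g x)) X) x = (if x \<in> set X then g x else f x)"
  by (simp add: patch_def map_of_map_restrict restrict_map_def)

lemma finite_patch_neq: "finite {x. patch f xs x \<noteq> f x}"
  by (rule finite_subset[OF _ finite_dom_map_of[of xs]]) (auto simp: patch_def split: option.splits)

definition patched_combs :: "complex set \<Rightarrow> (complex^2^2) set \<Rightarrow> ('k index \<Rightarrow> complex^2^2) set" where
  "patched_combs Q R =
     (\<lambda>(xs, ys). patch (proj_comb {} (patch (\<lambda>_. 0) xs)) ys) `
       (lists (UNIV \<times> Q) \<times> lists (UNIV \<times> R))"

lemma patched_combs_subset_carrier: "patched_combs Q R \<subseteq> twisted_c0_carrier"
proof
  fix a :: "'k index \<Rightarrow> complex^2^2" assume "a \<in> patched_combs Q R"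
  then obtain xs ys where a: "a = patch (proj_comb {} (patch (\<lambda>_. 0) xs)) ys"
    by (auto simp: patched_combs_def)
  have "\<forall>\<^sub>F i in cofinite. a i = proj_comb {} (patch (\<lambda>_. 0) xs) i"
    unfolding eventually_cofinite a by (rule finite_patch_neq)
  then have "\<forall>\<^sub>F i in cofinite. opnorm (a i - proj_comb {} (patch (\<lambda>_. 0) xs) i) \<le> e"
      if "0 < e" for e
    using that by (auto elim: eventually_mono)
  then show "a \<in> twisted_c0_carrier"
    using finite_patch_neq[of "\<lambda>_. 0" xs]
    by (intro twisted_c0_carrierI exI[of _ "patch (\<lambda>_. 0) xs"]) (simp add: approx_comb_def)
qed

lemma patched_combs_near:
  assumes Q: "\<And>U. open U \<Longrightarrow> U \<noteq> {} \<Longrightarrow> \<exists>q\<in>Q. q \<in> U" and R: "\<And>U. open U \<Longrightarrow> U \<noteq> {} \<Longrightarrow> \<exists>r\<in>R. r \<in> U"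
    and a: "a \<in> twisted_c0_carrier" and e: "0 < e"
  shows "\<exists>b\<in>patched_combs Q R. cdist twisted_c0 a b < e"
proof -
  have eighth: "0 < e / 8" using e by simp
  obtain l where l: "approx_comb a (e / 4) l" using twisted_c0_carrierD[OF a, of "e / 4"] e by auto
  define L where "L = {i. \<not> opnorm (a i - proj_comb {} l i) \<le> e / 4}"
  have "finite L" using l by (simp add: L_def approx_comb_def eventually_cofinite)
  then obtain Y where Y: "set Y = L" using finite_list by blast
  obtain X where X: "set X = {x. l x \<noteq> 0}"
    using finite_list[OF approx_comb_finite_support[OF l]] by blast
  have "\<exists>q\<in>Q. q \<in> ball (l x) (e / 8)" for x using Q[of "ball (l x) (e / 8)"] eighth by auto
  then obtain q where q: "\<And>x. q x \<in> Q" "\<And>x. cmod (l x - q x) < e / 8" by (simp add: dist_norm) metis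
  have "\<exists>r\<in>R. r \<in> ball (a i) (e / 8)" for i using R[of "ball (a i) (e / 8)"] eighth by auto
  then obtain r where r: "\<And>i. r i \<in> R" "\<And>i. norm (a i - r i) < e / 8" by (simp add: dist_norm) metis
  define m where "m = patch (\<lambda>_. 0) (map (\<lambda>x. (x, q x)) X)"
  define b where "b = patch (proj_comb {} m) (map (\<lambda>i. (i, r i)) Y)"
  have "b \<in> patched_combs Q R"
    unfolding patched_combs_def b_def m_def using q(1) r(1)
    by (intro image_eqI[of _ _ "(map (\<lambda>x. (x, q x)) X, map (\<lambda>i. (i, r i)) Y)"]) auto
  moreover have "opnorm (a i - b i) \<le> e / 2" for i
  proof (cases "i \<in> L")
    case True
    then show ?thesis
      using opnorm_le_norm[of "a i - r i"] r(2)[of i] by (simp add: b_def patch_graph Y)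
  next
    case False
    have "cmod (l x - m x) \<le> e / 8" for x
      using q(2)[of x] eighth by (simp add: m_def patch_graph X)
    then have "opnorm (proj_comb {} l i - proj_comb {} m i) \<le> 2 * (e / 8)"
      unfolding proj_comb_diff[symmetric] by (rule opnorm_proj_comb_le)
    moreover have "b i = proj_comb {} m i" using False by (simp add: b_def patch_graph Y)
    ultimately show ?thesis
      using opnorm_diff_triangle[of "a i" "b i" "proj_comb {} l i"] False by (simp add: L_def)
  qed
  then have "cdist twisted_c0 a b \<le> e / 2" by (rule cdist_twisted_c0_leI)
  then have "cdist twisted_c0 a b < e" using e by simp
  ultimately show ?thesis by blast
qed

lemma card_of_patched_combs:
  assumes inf: "infinite (UNIV :: 'k set)" and Q: "countable Q" and R: "countable R"
  shows "(card_of (patched_combs Q R :: ('k index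
      \<Rightarrow> complex^2^2) set), card_of (UNIV :: 'k set)) \<in> ordLeq"
proof -
  let ?r = "card_of (UNIV :: 'k set)"
  have Field: "infinite (Field ?r)" using inf by (simp add: Field_card_of)
  note times = card_of_Times_ordLeq_infinite_Field[OF Field _ _ card_of_Card_order]
  note lists = card_of_lists_ordLeq_infinite_Field[OF Field card_of_Card_order]
  note countable = card_of_countable_ordLeq_infinite_Field[OF Field card_of_Card_order]
  have k: "(?r, ?r) \<in> ordLeq" by (rule ordLeq_refl[OF card_of_Card_order])
  have "(card_of (lists ((UNIV :: 'k set) \<times> Q) \<times> lists ((UNIV :: 'k index set) \<times> R)), ?r) \<in> ordLeq"
    by (intro times lists k card_of_index_ordLeq countable inf Q R)
  then show ?thesis unfolding patched_combs_def using card_of_image ordLeq_transitive by blast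
qed

lemma card_of_dense_in_twisted_c0:
  assumes inf: "infinite (UNIV :: 'k set)"
    and S: "dense_in (twisted_c0 :: ('k index \<Rightarrow> complex^2^2) cstar_struct) S"
  shows "(card_of (UNIV :: 'k set), card_of S) \<in> ordLeq"
proof -
  have S_carrier: "S \<subseteq> twisted_c0_carrier" using S by (simp add: dense_in_def)
  have "\<exists>s\<in>S. cdist twisted_c0 (generator x) s < 1 / 2" for x :: 'k
    by (rule dense_inD[OF S]) (simp_all add: generator_carrier)
  then obtain s where s: "\<And>x. s x \<in> S"
      and near: "\<And>x :: 'k. cdist twisted_c0 (generator x) (s x) < 1 / 2"
    by metis
  have close: "opnorm (generator x i - s x i) < 1 / 2" for x i
    using opnorm_le_cdist[OF generator_carrier, of "s x" x i] near[of x] s[of x] S_carrier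
    by fastforce
  have "inj s"
  proof (rule injI, rule ccontr)
    fix x y assume eq: "s x = s y" and "x \<noteq> y"
    obtain z where "z \<notin> {x, y}" using inf ex_new_if_finite[of "{x, y}"] by blast
    then have "x \<noteq> z" "y \<noteq> z" by auto
    have "opnorm (generator x (x, z, 0) - generator y (x, z, 0)) = 1"
      using \<open>x \<noteq> y\<close>
      by (simp add: generator_left[OF \<open>x \<noteq> z\<close>] generator_other[OF _ \<open>y \<noteq> z\<close>] proj_simps)
    moreover have "opnorm (s x (x, z, 0) - generator y (x, z, 0)) < 1 / 2"
      unfolding eq opnorm_diff_commute[of "s y (x, z, 0)"] by (rule close)
    ultimately show False
      using opnorm_diff_triangle[of "generator x (x, z, 0)" "generator y (x, z, 0)" "s x (x, z, 0)"]
        close[of x "(x, z, 0)"] by linarith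
  qed
  then show ?thesis using s card_of_ordLeq[of "UNIV :: 'k set" S] by blast
qed

theorem density_eq_twisted_c0:
  assumes inf: "infinite (UNIV :: 'k set)"
  shows "density_eq (twisted_c0 :: ('k index
      \<Rightarrow> complex^2^2) cstar_struct) (card_of (UNIV :: 'k set))"
proof -
  obtain Q :: "complex set" where Q: "countable Q" "\<And>U. open U \<Longrightarrow> U \<noteq> {} \<Longrightarrow> \<exists>q\<in>Q. q \<in> U"
    by (rule countable_dense_setE) blast
  obtain R :: "(complex^2^2) set" where R: "countable R" "\<And>U. open U \<Longrightarrow> U \<noteq> {} \<Longrightarrow> \<exists>r\<in>R. r \<in> U"
    by (rule countable_dense_setE) blast
  let ?S = "patched_combs Q R :: ('k index \<Rightarrow> complex^2^2) set"
  have dense: "dense_in twisted_c0 ?S"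
    unfolding dense_in_def twisted_c0_sel using patched_combs_subset_carrier
      patched_combs_near[OF Q(2) R(2)]
    by blast
  then have "(card_of ?S, card_of (UNIV :: 'k set)) \<in> ordIso"
    using card_of_patched_combs[OF inf Q(1) R(1)] card_of_dense_in_twisted_c0[OF inf]
    by (simp add: ordIso_iff_ordLeq)
  then show ?thesis
    unfolding density_eq_def using dense card_of_dense_in_twisted_c0[OF inf] by blast
qed

section \<open>Transport along an injection\<close>

definition transport :: "('a \<Rightarrow> 'b) \<Rightarrow> 'a cstar_struct \<Rightarrow> 'b cstar_struct" where
  "transport J A =
     \<lparr>carrier = J ` carrier A, zer = J (zer A), add = (\<lambda>x y. J (add A (inv J x) (inv J y))),
      smul = (\<lambda>c x. J (smul A c (inv J x))), mul = (\<lambda>x y. J (mul A (inv J x) (inv J y))),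
      star = (\<lambda>x. J (star A (inv J x))), nrm = (\<lambda>x. nrm A (inv J x))\<rparr>"

locale transported =
  fixes J :: "'a \<Rightarrow> 'b" and A :: "'a cstar_struct"
  assumes inj: "inj J"
begin

lemma transport_sel:
  "carrier (transport J A) = J ` carrier A" "zer (transport J A) = J (zer A)"
  "add (transport J A) (J x) (J y) = J (add A x y)" "smul (transport J A) c (J x) = J (smul A c x)"
  "mul (transport J A) (J x) (J y) = J (mul A x y)" "star (transport J A) (J x) = J (star A x)"
  "nrm (transport J A) (J x) = nrm A x" "cdist (transport J A) (J x) (J y) = cdist A x y"
  by (simp_all add: transport_def cdist_def inv_f_f[OF inj])

lemma transport_complete:
  assumes "cstar_algebra A"
  shows "\<forall>f :: nat \<Rightarrow> 'b. (\<forall>n. f n \<in> J ` carrier A) \<longrightarrow>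
    (\<forall>e>0. \<exists>N. \<forall>m\<ge>N. \<forall>n\<ge>N. cdist (transport J A) (f m) (f n) < e) \<longrightarrow>
    (\<exists>x\<in>J ` carrier A. \<forall>e>0. \<exists>N. \<forall>n\<ge>N. cdist (transport J A) (f n) x < e)"
proof (intro allI impI)
  interpret cstar A by unfold_locales (rule assms)
  fix f :: "nat \<Rightarrow> 'b"
  assume f: "\<forall>n. f n \<in> J ` carrier A"
    and Cauchy: "\<forall>e>0. \<exists>N. \<forall>m\<ge>N. \<forall>n\<ge>N. cdist (transport J A) (f m) (f n) < e"
  have "\<forall>n. \<exists>x\<in>carrier A. f n = J x" using f by blast
  then obtain g where g: "\<And>n. g n \<in> carrier A" "\<And>n. f n = J (g n)" by metis
  have "\<exists>x\<in>carrier A. \<forall>e>0. \<exists>N. \<forall>n\<ge>N. cdist A (g n) x < e"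
    using complete[of g] g(1) Cauchy by (simp add: g(2) transport_sel)
  then show "\<exists>x\<in>J ` carrier A. \<forall>e>0. \<exists>N. \<forall>n\<ge>N. cdist (transport J A) (f n) x < e"
    by (auto simp: g(2) transport_sel)
qed

lemma cstar_algebra_transport:
  assumes A: "cstar_algebra A"
  shows "cstar_algebra (transport J A)"
  unfolding cstar_algebra_def transport_sel(1,2) ball_simps(9) transport_sel(3-7) inj_eq[OF inj]
    inj_image_mem_iff[OF inj]
  by (insert A[unfolded cstar_algebra_def], elim conjE, intro conjI)
     (assumption | rule transport_complete[OF A])+

lemma lin_span_transport: "lin_span (transport J A) (J ` B) = J ` lin_span A B"
proof
  show "lin_span (transport J A) (J ` B) \<subseteq> J ` lin_span A B"
  proof
    fix x assume "x \<in> lin_span (transport J A) (J ` B)"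
    then show "x \<in> J ` lin_span A B"
      by induction (auto simp: transport_sel intro: lin_span.intros)
  qed
  have "J x \<in> lin_span (transport J A) (J ` B)" if "x \<in> lin_span A B" for x
    using that
  proof induction
    case span_zero
    then show ?case using lin_span.span_zero[of "transport J A"] by (simp add: transport_sel)
  next
    case (span_base x)
    then show ?case by (intro lin_span.span_base) blast
  next
    case (span_add x y)
    then show ?case
      using lin_span.span_add[of "J x" "transport J A" "J ` B" "J y"] by (simp add: transport_sel)
  next
    case (span_smul x c)
    then show ?case
      using lin_span.span_smul[of "J x" "transport J A" "J ` B" c] by (simp add: transport_sel)
  qed
  then show "J ` lin_span A B \<subseteq> lin_span (transport J A) (J ` B)" by blast
qed

lemma finitely_spanned_transport:
  "(\<exists>B. finite B \<and> B \<subseteq> J ` D \<and> J ` D \<subseteq> lin_span (transport J A) B) \<longleftrightarrow>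
   (\<exists>B. finite B \<and> B \<subseteq> D \<and> D \<subseteq> lin_span A B)"
proof
  assume "\<exists>B. finite B \<and> B \<subseteq> J ` D \<and> J ` D \<subseteq> lin_span (transport J A) B"
  then obtain B where B: "finite B" "B \<subseteq> J ` D" "J ` D \<subseteq> lin_span (transport J A) B" by blast
  then obtain B' where B': "B' \<subseteq> D" "finite B'" "B = J ` B'"
    using finite_subset_image[OF B(1,2)] by blast
  then have "D \<subseteq> lin_span A B'"
    using B(3) by (simp add: lin_span_transport inj_image_subset_iff[OF inj])
  then show "\<exists>B. finite B \<and> B \<subseteq> D \<and> D \<subseteq> lin_span A B" using B' by blast
next
  assume "\<exists>B. finite B \<and> B \<subseteq> D \<and> D \<subseteq> lin_span A B"
  then obtain B where B: "finite B" "B \<subseteq> D" "D \<subseteq> lin_span A B" by blast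
  then have "J ` D \<subseteq> lin_span (transport J A) (J ` B)" by (simp add: lin_span_transport image_mono)
  then show "\<exists>B. finite B \<and> B \<subseteq> J ` D \<and> J ` D \<subseteq> lin_span (transport J A) B"
    using B(1,2) by (intro exI[of _ "J ` B"] conjI finite_imageI image_mono)
qed

lemma fd_subalgebra_transport: "fd_subalgebra (transport J A) (J ` D) \<longleftrightarrow> fd_subalgebra A D"
  unfolding fd_subalgebra_def finitely_spanned_transport
  by (simp add: transport_sel inj_image_subset_iff[OF inj] inj_image_mem_iff[OF inj])

lemma dense_in_transport: "dense_in (transport J A) (J ` S) \<longleftrightarrow> dense_in A S"
  unfolding dense_in_def by (simp add: transport_sel inj_image_subset_iff[OF inj])

lemma subset_carrier_transport: "S \<subseteq> carrier (transport J A) \<Longrightarrow> S = J ` (J -` S)"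
  by (auto simp: transport_sel)

lemma fd_subalgebra_vimage:
  assumes "fd_subalgebra (transport J A) D"
  shows "fd_subalgebra A (J -` D)"
proof -
  have "D = J ` (J -` D)"
    using assms by (intro subset_carrier_transport) (simp add: fd_subalgebra_def)
  then show ?thesis using assms fd_subalgebra_transport by metis
qed

lemma dense_in_vimage:
  assumes "dense_in (transport J A) S"
  shows "dense_in A (J -` S)"
proof -
  have "S = J ` (J -` S)" using assms by (intro subset_carrier_transport) (simp add: dense_in_def)
  then show ?thesis using assms dense_in_transport by metis
qed

lemma is_LF_transport:
  assumes "is_LF A"
  shows "is_LF (transport J A)"
  unfolding is_LF_def
proof (intro allI impI, elim conjE)
  fix F e assume F: "finite F" "F \<subseteq> carrier (transport J A)" and e: "(0 :: real) < e"
  then obtain F' where F': "F' \<subseteq> carrier A" "finite F'" "F = J ` F'"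
    using finite_subset_image[of F J "carrier A"] by (auto simp: transport_sel)
  then obtain D where D: "fd_subalgebra A D" "approx_subset A e F' D"
    using assms e unfolding is_LF_def by meson
  have "approx_subset (transport J A) e F (J ` D)"
    using D(2) by (auto simp: approx_subset_def F'(3) transport_sel)
  moreover have "fd_subalgebra (transport J A) (J ` D)"
    using D(1) by (simp only: fd_subalgebra_transport)
  ultimately show "\<exists>D. fd_subalgebra (transport J A) D \<and> approx_subset (transport J A) e F D"
    by blast
qed

lemma is_AF_transport_imp_is_AF:
  assumes "is_AF (transport J A)"
  shows "is_AF A"
proof -
  obtain \<D> where D: "\<D> \<noteq> {}" "\<And>D. D \<in> \<D> \<Longrightarrow> fd_subalgebra (transport J A) D"
      and directed: "\<And>D\<^sub>1 D\<^sub>2. D\<^sub>1 \<in> \<D> \<Longrightarrow> D\<^sub>2 \<in> \<D> \<Longrightarrow> \<exists>D\<^sub>3\<in>\<D>. D\<^sub>1 \<union> D\<^sub>2 \<subseteq> D\<^sub>3"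
      and dense: "dense_in (transport J A) (\<Union>\<D>)"
    using assms unfolding is_AF_def by metis
  have "\<exists>E\<in>(-`) J ` \<D>. J -` D\<^sub>1 \<union> J -` D\<^sub>2 \<subseteq> E" if D12: "D\<^sub>1 \<in> \<D>" "D\<^sub>2 \<in> \<D>" for D\<^sub>1 D\<^sub>2
  proof -
    obtain D\<^sub>3 where "D\<^sub>3 \<in> \<D>" "D\<^sub>1 \<union> D\<^sub>2 \<subseteq> D\<^sub>3" using directed[OF D12] by blast
    then show ?thesis by (intro bexI[of _ "J -` D\<^sub>3"]) auto
  qed
  moreover have "dense_in A (\<Union>((-`) J ` \<D>))"
    using dense_in_vimage[OF dense] by (simp add: vimage_Union)
  ultimately show ?thesis
    unfolding is_AF_def using D fd_subalgebra_vimage by (intro exI[of _ "(-`) J ` \<D>"]) simp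
qed

lemma card_of_image_inj: "(card_of (J ` S), card_of S) \<in> ordIso"
proof -
  have "bij_betw J S (J ` S)" by (simp add: bij_betw_def inj_on_subset[OF inj])
  then show ?thesis using card_of_ordIso ordIso_symmetric by blast
qed

lemma density_eq_transport:
  assumes "density_eq A r"
  shows "density_eq (transport J A) r"
proof -
  obtain S where S: "dense_in A S" "(card_of S, r) \<in> ordIso"
      and lower: "\<And>S. dense_in A S \<Longrightarrow> (r, card_of S) \<in> ordLeq"
    using assms unfolding density_eq_def by blast
  have "dense_in (transport J A) (J ` S)" using S(1) by (simp only: dense_in_transport)
  moreover have "(card_of (J ` S), r) \<in> ordIso"
    by (rule ordIso_transitive[OF card_of_image_inj S(2)])
  moreover have "(r, card_of S') \<in> ordLeq" if "dense_in (transport J A) S'" for S'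
  proof -
    have "J ` (J -` S') \<subseteq> S'" by auto
    then have "(card_of (J ` (J -` S')), card_of S') \<in> ordLeq" by (rule card_of_mono1)
    then have "(card_of (J -` S'), card_of S') \<in> ordLeq"
      by (rule ordIso_ordLeq_trans[OF ordIso_symmetric[OF card_of_image_inj]])
    then show ?thesis by (rule ordLeq_transitive[OF lower[OF dense_in_vimage[OF that]]])
  qed
  ultimately show ?thesis unfolding density_eq_def by blast
qed

end

text \<open>A function into a second-countable \<open>T\<^sub>1\<close> space is determined by the preimages of the basic
  open sets.\<close>

lemma inj_functions_into_sets:
  assumes "(card_of (UNIV :: ('i \<times> nat) set), card_of (UNIV :: 'k set)) \<in> ordLeq"
  obtains J :: "('i \<Rightarrow> 'b :: {second_countable_topology, t1_space}) \<Rightarrow> 'k set" where "inj J"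
proof -
  obtain h :: "'i \<times> nat \<Rightarrow> 'k" where h: "inj h"
    using assms card_of_ordLeq[of "UNIV :: ('i \<times> nat) set" "UNIV :: 'k set"] by auto
  obtain B :: "'b set set" where B: "countable B" "topological_basis B"
    using ex_countable_basis by blast
  define J :: "('i \<Rightarrow> 'b) \<Rightarrow> 'k set" where "J f = h ` {(i, n). f i \<in> from_nat_into B n}" for f
  have "inj J"
  proof
    fix f g assume "J f = J g"
    then have "{(i, n). f i \<in> from_nat_into B n} = {(i, n). g i \<in> from_nat_into B n}"
      unfolding J_def by (simp add: inj_image_eq_iff[OF h])
    then have eq: "f i \<in> from_nat_into B n \<longleftrightarrow> g i \<in> from_nat_into B n" for i n by blast
    show "f = g"
    proof (rule ext, rule ccontr)
      fix i assume "f i \<noteq> g i"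
      then obtain U where U: "open U" "f i \<in> U" "g i \<notin> U" using t1_space by blast
      obtain V where V: "V \<in> B" "f i \<in> V" "V \<subseteq> U" using topological_basisE[OF B(2) U(1,2)] by blast
      obtain n where "V = from_nat_into B n" using from_nat_into_surj[OF B(1) V(1)] by metis
      then show False using eq[of i n] V U(3) by blast
    qed
  qed
  then show thesis by (rule that)
qed

theorem LF_not_AF_exists:
  assumes big: "(aleph1, card_of (UNIV :: 'k set)) \<in> ordLess"
  shows "\<exists>A :: 'k set cstar_struct.
    cstar_algebra A \<and> is_LF A \<and> \<not> is_AF A \<and> density_eq A (card_of (UNIV :: 'k set))"
proof -
  have "(natLeq, card_of (UNIV :: 'k set)) \<in> ordLeq"
    using ordLess_transitive[OF cardSuc_greater[OF natLeq_Card_order] big]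
    by (rule ordLess_imp_ordLeq)
  then have inf: "infinite (UNIV :: 'k set)" using infinite_iff_natLeq_ordLeq by blast
  then have Field: "infinite (Field (card_of (UNIV :: 'k set)))" by (simp add: Field_card_of)
  have "(card_of ((UNIV :: 'k index set) \<times> (UNIV :: nat set)), card_of (UNIV :: 'k set)) \<in> ordLeq"
    by (intro card_of_Times_ordLeq_infinite_Field[OF Field]
        card_of_countable_ordLeq_infinite_Field[OF Field]
        card_of_index_ordLeq[OF inf] card_of_Card_order countableI_type)
  then obtain J :: "('k index \<Rightarrow> complex^2^2) \<Rightarrow> 'k set" where "inj J"
    using inj_functions_into_sets by auto
  then interpret transported J twisted_c0 by unfold_locales
  show ?thesis
    using cstar_algebra_transport[OF cstar_algebra_twisted_c0] is_LF_transport[OF is_LF_twisted_c0]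
      is_AF_transport_imp_is_AF not_is_AF_twisted_c0[OF big]
      density_eq_transport[OF density_eq_twisted_c0[OF inf]]
    by blast
qed

theorem theorem1p5:
  shows "(\<forall>A :: 'a cstar_struct. cstar_algebra A \<and> density_le A aleph1 \<longrightarrow> (is_AF A \<longleftrightarrow> is_LF A)) \<and>
         ((aleph1, card_of (UNIV :: 'k set)) \<in> ordLess \<longrightarrow>
            (\<exists>A :: 'k set cstar_struct. cstar_algebra A \<and> is_LF A \<and> \<not> is_AF A \<and>
                density_eq A (card_of (UNIV :: 'k set))))"
  using is_AF_iff_is_LF LF_not_AF_exists by blast

end
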